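(* Let $U\subsetneq{}^*\mathbb N$ be a $\Delta^{\rm ss}_2$ cut with $\mathbb N\subseteq U$, closed under ${}^*K$ and exponential. Let $n\in\mathbb N$, $\kappa\in{}^*\mathbb N\setminus U$, and let $\mathsf E$ be a $\Delta^{\rm ss}_2$ equivalence relation on $[\kappa]^n$. If there is no internal set $Y\subseteq[\kappa]^n$ of pairwise $\mathsf E$-inequivalent elements with $\#Y\notin U$, then there is an internal set $A\subseteq\kappa$ with $\#A\notin U$ that is homogeneous for $\mathsf E$, i.e. all elements of $[A]^n$ are pairwise $\mathsf E$-equivalent.
   Context: Work in Hrbacek set theory HST, in the language with $\in$ and a standardness predicate $\mathrm{st}$; its universe contains the standard sets $\mathbb S$, the internal sets $\mathbb I=\{y:\exists^{\mathrm{st}}x\,(y\in x)\}$ (transitive, satisfying ZFC, elementary extension of $\mathbb S$) and the well-founded sets $\mathbb V$, with an $\in$-isomorphism $x\mapsto{}^*x$ of $\mathbb V$ onto $\mathbb S$; the universe is the von Neumann superstructure over $\mathbb I$. $\mathbb N\subseteq{}^*\mathbb N$ are the natural and internal natural numbers; $\#x$ is the internal cardinality of internal $x$; each $\kappa\in{}^*\mathbb N$ is identified with $\{0,\dots,\kappa-1\}$, and $[A]^n$ denotes the internal set of all $n$-element internal subsets of an internal set $A$. $\Delta^{\rm ss}_2$ sets are subsets of $\mathbb I$ representable both as $\bigcup_{a\in A}\bigcap_{b\in B}X_{ab}$ and as $\bigcap_{a\in A}\bigcup_{b\in B}X_{ab}$ with $A,B\in\mathbb V$ and $X_{ab}$ internal.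 In $\mathbb V$, $K(\ell,s,n)$ is the least $k\in\mathbb N$ such that every partition of the $n$-element subsets of $k$ into $s$ parts has a homogeneous set of size $\ell$ (finite Ramsey theorem); ${}^*K:{}^*\mathbb N^3\to{}^*\mathbb N$ is its image under $*$. A cut $U\subseteq{}^*\mathbb N$ is an initial segment; it is closed under ${}^*K$ if $\ell,s,n\in U\Rightarrow{}^*K(\ell,s,n)\in U$, and exponential if $\kappa\in U\Rightarrow2^\kappa\in U$. *)

theory Defs
  imports Main
begin

text \<open>
  A theorem of Hrbacek set theory HST is rendered as a statement about an arbitrary model of HST
  (a type of class \<open>hst\<close> below).  HST is a first-order theory, so its axiom schemata are
  stated for first-order formulas with parameters, given by the following deep embedding with
  named variables.  (The second-order form of the schemata, over arbitrary predicates, must not be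
  used: with full second-order Collection, HST is inconsistent.)
\<close>

datatype fm = Mem nat nat | Eq nat nat | St nat | Neg fm | Conj fm fm | All nat fm

primrec in_formula :: "fm \<Rightarrow> bool"  \<comment> \<open>formulas of the language of \<open>\<in>\<close> alone\<close>
  where
  "in_formula (Mem i j) = True"
| "in_formula (Eq i j) = True"
| "in_formula (St i) = False"
| "in_formula (Neg p) = in_formula p"
| "in_formula (Conj p q) = (in_formula p \<and> in_formula q)"
| "in_formula (All i p) = in_formula p"

text \<open>
  Signature: \<open>x \<in> elts y\<close> is the membership relation of the universe, \<open>st x\<close> is
  the standardness predicate.
\<close>

class in_st =
  fixes elts :: "'a \<Rightarrow> 'a set"
    and st :: "'a \<Rightarrow> bool"
begin

primrec sat :: "'a set \<Rightarrow> fm \<Rightarrow> (nat \<Rightarrow> 'a) \<Rightarrow> bool"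
  \<comment> \<open>\<open>sat D p e\<close>: the relativization of \<open>p\<close> to the class \<open>D\<close> holds at \<open>e\<close>\<close>
  where
  "sat D (Mem i j) e = (e i \<in> elts (e j))"
| "sat D (Eq i j) e = (e i = e j)"
| "sat D (St i) e = st (e i)"
| "sat D (Neg p) e = (\<not> sat D p e)"
| "sat D (Conj p q) e = (sat D p e \<and> sat D q e)"
| "sat D (All i p) e = (\<forall>a\<in>D. sat D p (e(i := a)))"

text \<open>The classes of standard, of internal and of well-founded sets.\<close>

definition Standard :: "'a set"
  where "Standard = {x. st x}"

definition Internal :: "'a set"
  where "Internal = {y. \<exists>x. st x \<and> y \<in> elts x}"

definition transitive :: "'a \<Rightarrow> bool"
  where "transitive x \<longleftrightarrow> (\<forall>y\<in>elts x. elts y \<subseteq> elts x)"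

definition WF :: "'a set"
  where "WF = {x. \<exists>t. transitive t \<and> x \<in> elts t \<and>
     (\<forall>y. elts y \<noteq> {} \<and> elts y \<subseteq> elts t \<longrightarrow> (\<exists>z\<in>elts y. elts z \<inter> elts y = {}))}"

text \<open>The set with a given extension, ordered pairs, and functions as sets of pairs.\<close>

definition set_of :: "'a set \<Rightarrow> 'a"
  where "set_of X = (THE x. elts x = X)"

definition opair :: "'a \<Rightarrow> 'a \<Rightarrow> 'a"
  where "opair x y = set_of {set_of {x}, set_of {x, y}}"

definition is_function :: "'a \<Rightarrow> bool"
  where "is_function f \<longleftrightarrow> (\<forall>p\<in>elts f. \<exists>x y. p = opair x y) \<and>
     (\<forall>x y z. opair x y \<in> elts f \<and> opair x z \<in> elts f \<longrightarrow> y = z)"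

definition fdom :: "'a \<Rightarrow> 'a set"
  where "fdom f = {x. \<exists>y. opair x y \<in> elts f}"

definition frange :: "'a \<Rightarrow> 'a set"
  where "frange f = {y. \<exists>x. opair x y \<in> elts f}"

definition fapp :: "'a \<Rightarrow> 'a \<Rightarrow> 'a"
  where "fapp f x = (THE y. opair x y \<in> elts f)"

definition is_bijection :: "'a \<Rightarrow> 'a \<Rightarrow> 'a \<Rightarrow> bool"
  where "is_bijection f x y \<longleftrightarrow>
     is_function f \<and> fdom f = elts x \<and> bij_betw (fapp f) (elts x) (elts y)"

definition is_inductive :: "'a \<Rightarrow> bool"
  where "is_inductive x \<longleftrightarrow> (\<exists>z\<in>elts x. elts z = {}) \<and>
     (\<forall>y\<in>elts x. \<exists>z\<in>elts x. elts z = insert y (elts y))"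

definition omega :: 'a  \<comment> \<open>the natural numbers\<close>
  where "omega = (THE w. is_inductive w \<and> (\<forall>x. is_inductive x \<longrightarrow> elts w \<subseteq> elts x))"

text \<open>\<open>D\<close> satisfies ZFC, i.e. the relativizations to \<open>D\<close> of all axioms of ZFC hold.
  In the schemata the variables 0 and 1 are the arguments, all others are parameters.\<close>

definition ZFC :: "'a set \<Rightarrow> bool"
  where "ZFC D \<longleftrightarrow> (let E = (\<lambda>x. elts x \<inter> D) in
    \<comment> \<open>Extensionality\<close>
    (\<forall>x\<in>D. \<forall>y\<in>D. E x = E y \<longrightarrow> x = y) \<and>
    \<comment> \<open>Pair\<close>
    (\<forall>x\<in>D. \<forall>y\<in>D. \<exists>z\<in>D. E z = {x, y}) \<and>
    \<comment> \<open>Union\<close>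
    (\<forall>x\<in>D. \<exists>y\<in>D. E y = (\<Union>z\<in>E x. E z)) \<and>
    \<comment> \<open>Power Set\<close>
    (\<forall>x\<in>D. \<exists>y\<in>D. E y = {z\<in>D. E z \<subseteq> E x}) \<and>
    \<comment> \<open>Infinity\<close>
    (\<exists>x\<in>D. (\<exists>z\<in>E x. E z = {}) \<and> (\<forall>y\<in>E x. \<exists>z\<in>E x. E z = insert y (E y))) \<and>
    \<comment> \<open>Regularity\<close>
    (\<forall>x\<in>D. E x \<noteq> {} \<longrightarrow> (\<exists>y\<in>E x. E y \<inter> E x = {})) \<and>
    \<comment> \<open>Separation\<close>
    (\<forall>p e. in_formula p \<and> range e \<subseteq> D \<longrightarrow>
       (\<forall>x\<in>D. \<exists>y\<in>D. E y = {z\<in>E x. sat D p (e(0 := z))})) \<and>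
    \<comment> \<open>Replacement\<close>
    (\<forall>p e. in_formula p \<and> range e \<subseteq> D \<longrightarrow>
       (\<forall>x\<in>D. (\<forall>a\<in>E x. \<exists>!b. b \<in> D \<and> sat D p (e(0 := a, 1 := b))) \<longrightarrow>
          (\<exists>y\<in>D. E y = {b\<in>D. \<exists>a\<in>E x. sat D p (e(0 := a, 1 := b))}))) \<and>
    \<comment> \<open>Choice\<close>
    (\<forall>x\<in>D. (\<forall>y\<in>E x. E y \<noteq> {}) \<and> (\<forall>y\<in>E x. \<forall>z\<in>E x. y \<noteq> z \<longrightarrow> E y \<inter> E z = {}) \<longrightarrow>
       (\<exists>c\<in>D. \<forall>y\<in>E x. \<exists>!z. z \<in> E c \<inter> E y)))"

definition standard_size :: "'a \<Rightarrow> bool"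
  \<comment> \<open>sets of the form \<open>{f(x) : x \<in> X, st x}\<close> with \<open>X\<close> standard and \<open>f\<close> a function\<close>
  where "standard_size z \<longleftrightarrow>
     (\<exists>x f. st x \<and> is_function f \<and> fdom f = elts x \<inter> Standard \<and> frange f = elts z)"

end

text \<open>The axioms of HST, in the form given by Kanovei and Reeken.\<close>

class hst = in_st +
  assumes Extensionality: "elts x = elts y \<Longrightarrow> x = y"
    and Pair: "\<exists>z. elts z = {x, y}"
    and Union: "\<exists>y. elts y = (\<Union>z\<in>elts x. elts z)"
    and Infinity: "\<exists>x. is_inductive x"
    and Separation: "\<exists>y. elts y = {z\<in>elts x. sat UNIV p (e(0 := z))}"
    and Collection: "\<exists>y. \<forall>a\<in>elts x. (\<exists>b. sat UNIV p (e(0 := a, 1 := b))) \<longrightarrow>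
      (\<exists>b\<in>elts y. sat UNIV p (e(0 := a, 1 := b)))"
    and ZFC_standard: "ZFC Standard"
    and Transfer: "in_formula p \<Longrightarrow> range e \<subseteq> Standard \<Longrightarrow> sat Standard p e \<longleftrightarrow> sat Internal p e"
    and Transitivity_Internal: "x \<in> Internal \<Longrightarrow> elts x \<subseteq> Internal"
    and Regularity_over_Internal: "elts x \<noteq> {} \<Longrightarrow> \<exists>y\<in>elts x. elts y \<inter> elts x \<subseteq> Internal"
    and Standardization: "\<exists>y. st y \<and> elts y \<inter> Standard = elts x \<inter> Standard"
    and Saturation: "standard_size z \<Longrightarrow> elts z \<subseteq> Internal \<Longrightarrow> \<forall>x\<in>elts z. elts x \<noteq> {} \<Longrightarrow>
      \<forall>x\<in>elts z. \<forall>y\<in>elts z. \<exists>w\<in>elts z. elts w = elts x \<inter> elts y \<Longrightarrow>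
      \<exists>a. \<forall>x\<in>elts z. a \<in> elts x"
    and Standard_Size_Choice: "standard_size z \<Longrightarrow> is_function g \<Longrightarrow> fdom g = elts z \<Longrightarrow>
      \<forall>x\<in>elts z. elts (fapp g x) \<noteq> {} \<Longrightarrow>
      \<exists>f. is_function f \<and> fdom f = elts z \<and> (\<forall>x\<in>elts z. fapp f x \<in> elts (fapp g x))"
    and Dependent_Choice: "elts x \<noteq> {} \<Longrightarrow> \<forall>a\<in>elts x. \<exists>b\<in>elts x. opair a b \<in> elts r \<Longrightarrow>
      \<exists>f. is_function f \<and> fdom f = elts omega \<and> frange f \<subseteq> elts x \<and>
        (\<forall>m\<in>elts omega. \<forall>n\<in>elts omega. elts n = insert m (elts m) \<longrightarrow>
           opair (fapp f m) (fapp f n) \<in> elts r)"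

context in_st
begin

text \<open>
  The isomorphism \<open>x \<mapsto> *x\<close> of the well-founded universe onto the standard universe is the inverse
  of the map on standard sets given recursively by \<open>h(s) = {h(u) : u \<in> s, st u}\<close>.
  The recursion is witnessed by a set \<open>f\<close> of the universe: a model need not be well-founded from
  the outside, so a recursive equation for a meta-level function would not determine the map.
\<close>

definition collapses_to :: "'a \<Rightarrow> 'a \<Rightarrow> bool"
  where "collapses_to s w \<longleftrightarrow> (\<exists>t f. st t \<and> transitive t \<and> s \<in> elts t \<and>
     is_function f \<and> fdom f = elts t \<inter> Standard \<and>
     (\<forall>u\<in>elts t \<inter> Standard. elts (fapp f u) = fapp f ` (elts u \<inter> Standard)) \<and>
     fapp f s = w)"

definition star :: "'a \<Rightarrow> 'a"
  where "star w = (THE s. st s \<and> collapses_to s w)"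

definition hnat :: 'a  \<comment> \<open>the internal natural numbers\<close>
  where "hnat = star omega"

text \<open>Cardinality, and the set of subsets with \<open>n\<close> elements, in a transitive class \<open>D\<close>
  satisfying ZFC (used for \<open>D = WF\<close> and \<open>D = Internal\<close>).\<close>

definition is_ordinal :: "'a \<Rightarrow> bool"
  where "is_ordinal c \<longleftrightarrow> transitive c \<and>
     (\<forall>x\<in>elts c. \<forall>y\<in>elts c. x \<in> elts y \<or> x = y \<or> y \<in> elts x)"

definition card_in :: "'a set \<Rightarrow> 'a \<Rightarrow> 'a"
  where "card_in D x = (THE c. c \<in> D \<and> is_ordinal c \<and> (\<exists>f\<in>D. is_bijection f x c) \<and>
     (\<forall>d\<in>elts c. \<not> (\<exists>f\<in>D. is_bijection f x d)))"

definition nsubsets_in :: "'a set \<Rightarrow> 'a \<Rightarrow> 'a \<Rightarrow> 'a"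
  where "nsubsets_in D A n = set_of {x\<in>D. elts x \<subseteq> elts A \<and> card_in D x = n}"

abbreviation icard :: "'a \<Rightarrow> 'a"
  where "icard \<equiv> card_in Internal"

abbreviation nsubsets :: "'a \<Rightarrow> 'a \<Rightarrow> 'a"
  where "nsubsets \<equiv> nsubsets_in Internal"

definition ipow2 :: "'a \<Rightarrow> 'a"
  \<comment> \<open>\<open>2\<^sup>\<kappa>\<close>: the internal number of internal functions from \<open>\<kappa>\<close> to \<open>2 = {0, 1}\<close>\<close>
  where "ipow2 \<kappa> = icard (set_of
     {f\<in>Internal. is_function f \<and> fdom f = elts \<kappa> \<and> frange f \<subseteq> {set_of {}, set_of {set_of {}}}})"

text \<open>The Ramsey function \<open>K\<close> of the well-founded universe.  A partition into \<open>s\<close> parts is given by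
  a map to \<open>s = {0, \<dots>, s - 1}\<close>, so parts may be empty.\<close>

definition ramsey_good :: "'a \<Rightarrow> 'a \<Rightarrow> 'a \<Rightarrow> 'a \<Rightarrow> bool"
  where "ramsey_good l s n k \<longleftrightarrow>
     (\<forall>c\<in>WF. is_function c \<and> fdom c = elts (nsubsets_in WF k n) \<and> frange c \<subseteq> elts s \<longrightarrow>
        (\<exists>H\<in>WF. elts H \<subseteq> elts k \<and> card_in WF H = l \<and>
           (\<forall>x\<in>elts (nsubsets_in WF H n). \<forall>y\<in>elts (nsubsets_in WF H n). fapp c x = fapp c y)))"

definition ramsey_num :: "'a \<Rightarrow> 'a \<Rightarrow> 'a \<Rightarrow> 'a"
  where "ramsey_num l s n =
     (THE k. k \<in> elts omega \<and> ramsey_good l s n k \<and> (\<forall>j\<in>elts k. \<not> ramsey_good l s n j))"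

definition triple :: "'a \<Rightarrow> 'a \<Rightarrow> 'a \<Rightarrow> 'a"
  where "triple x y z = opair x (opair y z)"

definition ramsey_fun :: 'a
  where "ramsey_fun = set_of {opair (triple l s n) (ramsey_num l s n) | l s n.
     l \<in> elts omega \<and> s \<in> elts omega \<and> n \<in> elts omega}"

definition star_ramsey :: "'a \<Rightarrow> 'a \<Rightarrow> 'a \<Rightarrow> 'a"
  where "star_ramsey l s n = fapp (star ramsey_fun) (triple l s n)"

definition internal_family :: "'a \<Rightarrow> 'a \<Rightarrow> 'a \<Rightarrow> bool"
  \<comment> \<open>\<open>F\<close> is a family \<open>(X\<^sub>a\<^sub>b)\<close>, \<open>a \<in> A\<close>, \<open>b \<in> B\<close>, of internal sets, with \<open>A\<close>, \<open>B\<close> well-founded\<close>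
  where "internal_family A B F \<longleftrightarrow> A \<in> WF \<and> B \<in> WF \<and> is_function F \<and>
     fdom F = {opair a b | a b. a \<in> elts A \<and> b \<in> elts B} \<and> frange F \<subseteq> Internal"

text \<open>An intersection over an empty index set is the universe here, which is not the extension of
  a set; so empty index sets admit no unintended representations.\<close>

definition Delta_ss_2 :: "'a \<Rightarrow> bool"
  where "Delta_ss_2 X \<longleftrightarrow> elts X \<subseteq> Internal \<and>
     (\<exists>A B F. internal_family A B F \<and>
        elts X = (\<Union>a\<in>elts A. \<Inter>b\<in>elts B. elts (fapp F (opair a b)))) \<and>
     (\<exists>A B F. internal_family A B F \<and>
        elts X = (\<Inter>a\<in>elts A. \<Union>b\<in>elts B. elts (fapp F (opair a b))))"

text \<open>The order of the internal natural numbers is membership.\<close>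

definition is_cut :: "'a \<Rightarrow> bool"
  where "is_cut U \<longleftrightarrow> elts U \<subseteq> elts hnat \<and>
     (\<forall>x\<in>elts U. \<forall>y\<in>elts hnat. y \<in> elts x \<longrightarrow> y \<in> elts U)"

definition closed_under_star_ramsey :: "'a \<Rightarrow> bool"
  where "closed_under_star_ramsey U \<longleftrightarrow>
     (\<forall>l\<in>elts U. \<forall>s\<in>elts U. \<forall>n\<in>elts U. star_ramsey l s n \<in> elts U)"

definition exponential :: "'a \<Rightarrow> bool"
  where "exponential U \<longleftrightarrow> (\<forall>\<kappa>\<in>elts U. ipow2 \<kappa> \<in> elts U)"

definition is_equivalence_on :: "'a \<Rightarrow> 'a \<Rightarrow> bool"
  where "is_equivalence_on P E \<longleftrightarrow> (\<forall>p\<in>elts E. \<exists>x y. p = opair x y) \<and>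
     equiv (elts P) {(x, y). opair x y \<in> elts E}"

end

end

theory Submission
  imports Defs
begin

text \<open>
  Write \<open>E = \<Union>\<^sub>a \<Inter>\<^sub>b X\<^sub>a\<^sub>b\<close>.  Since \<open>U\<close> is not internal, the closure of \<open>U\<close> under \<open>*K\<close> and under
  \<open>2\<^sup>\<kappa>\<close> overspills: there is \<open>u \<notin> U\<close> such that every internal colouring of \<open>[\<kappa>]\<^sup>2\<^sup>n\<close> with \<open>2\<^sup>u\<close>
  colours has a homogeneous set with \<open>u\<close> elements.  As \<open>u\<close> is nonstandard, saturation puts all
  \<open>X\<^sub>a\<^sub>b\<close> into one internal sequence of length \<open>u\<close>.  Colour a \<open>2n\<close>-set by the set of those \<open>i < u\<close>
  for which the pair of its lower and its upper half belongs to the \<open>i\<close>-th member of the sequence.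
  On a homogeneous set \<open>H\<close>, whether \<open>x E y\<close> holds is the same for all \<open>n\<close>-sets \<open>x < y\<close>.
  If it always holds, \<open>H\<close> without its last \<open>n\<close> elements is homogeneous for \<open>E\<close>.  If it never holds,
  consecutive blocks of \<open>n\<close> elements of \<open>H\<close> are pairwise inequivalent; that there are \<open>\<notin> U\<close> many
  blocks follows from a second application of the Ramsey property, to the colouring of pairs
  \<open>a < b\<close> of elements of \<open>H\<close> by whether \<open>[a, b)\<close> contains \<open>n\<close> elements of \<open>H\<close>.
\<close>


section \<open>Definability\<close>

text \<open>HST grants Separation, Collection and Transfer for first-order formulas only, so every
  set that is formed and every induction inside a class needs a proof that the predicate is
  definable there; predicates stay HOL terms, and a calculus of definability recovers the formulas.
  \<open>E\<close> is external, so no internal colouring can mention it; what can be coloured is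
  membership of pairs in the internal sets \<open>X_ab\<close>, of which there may be infinitely
  many. A nonstandard \<open>u\<close> makes room for all of them at the price of 2^u colours, and
  \<open>u\<close> must lie outside \<open>U\<close> because homogeneous sets of that size are
  wanted: overspill finds such \<open>u\<close> with the Ramsey number of \<open>u\<close> and 2^u
  still below \<kappa>. Splitting a set of size 2n into halves only compares sets one of which lies
  entirely below the other; arbitrary n-sets are compared through a third one above both. Cardinal
  arithmetic is avoided: sizes are internal bijections with numbers, and both closure of
  \<open>U\<close> under sums and the count of blocks are extracted from the Ramsey property instead
  of from laws for sums and products.\<close>

primrec vars :: "fm \<Rightarrow> nat set" where
  "vars (Mem i j) = {i, j}"
| "vars (Eq i j) = {i, j}"
| "vars (St i) = {i}"
| "vars (Neg p) = vars p"
| "vars (Conj p q) = vars p \<union> vars q"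
| "vars (All i p) = insert i (vars p)"

lemma finite_vars: "finite (vars p)"
  by (induction p) auto

text \<open>\<open>vars\<close> counts bound variables too, which makes the quantifier case
  immediate; a finite superset of the free variables is all that later choices of fresh names
  require.\<close>

lemma sat_cong: "(\<And>i. i \<in> vars p \<Longrightarrow> e i = e' i) \<Longrightarrow> sat D p e = sat D p e'"
proof (induction p arbitrary: e e')
  case (All i p)
  have "sat D p (e(i := a)) = sat D p (e'(i := a))" for a
    by (rule All.IH) (use All.prems in auto)
  then show ?case by simp
next
  case (Conj p q)
  then have "sat D p e = sat D p e'" "sat D q e = sat D q e'"
    by (metis UnCI vars.simps(5))+
  then show ?case by simp
next
  case (Neg p)
  then have "sat D p e = sat D p e'" by (metis vars.simps(4))
  then show ?case by simp
qed auto

lemma fresh_nat: "finite A \<Longrightarrow> \<exists>j::nat. j \<notin> A"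
  by (rule ex_new_if_finite) auto

text \<open>The bound name becomes a \<open>j\<close> outside the image of \<open>vars p\<close>, so
  nothing is captured even if \<open>\<rho>\<close> is not injective. One \<open>q\<close> serves
  all classes \<open>D\<close>, as needed to compare a formula in two structures.\<close>

lemma renaming:
  "\<exists>q. in_formula q = in_formula p \<and> (\<forall>(D::'a::in_st set) e. sat D q e = sat D p (\<lambda>n. e (\<rho> n)))"
proof (induction p arbitrary: \<rho>)
  case (Mem i j)
  show ?case by (rule exI[of _ "Mem (\<rho> i) (\<rho> j)"]) simp
next
  case (Eq i j)
  show ?case by (rule exI[of _ "Eq (\<rho> i) (\<rho> j)"]) simp
next
  case (St i)
  show ?case by (rule exI[of _ "St (\<rho> i)"]) simp
next
  case (Neg p)
  then obtain q where "in_formula q = in_formula p" "\<forall>(D::'a set) e. sat D q e = sat D p (\<lambda>n. e (\<rho> n))" by blast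
  then show ?case by (intro exI[of _ "Neg q"]) simp
next
  case (Conj p p')
  obtain q where "in_formula q = in_formula p" "\<forall>(D::'a set) e. sat D q e = sat D p (\<lambda>n. e (\<rho> n))"
    using Conj by blast
  moreover obtain q' where "in_formula q' = in_formula p'" "\<forall>(D::'a set) e. sat D q' e = sat D p' (\<lambda>n. e (\<rho> n))"
    using Conj by blast
  ultimately show ?case by (intro exI[of _ "Conj q q'"]) simp
next
  case (All k p)
  obtain j where j: "j \<notin> \<rho> ` vars p"
    using fresh_nat[of "\<rho> ` vars p"] finite_vars by auto
  obtain q where q: "in_formula q = in_formula p"
    "\<forall>(D::'a set) e. sat D q e = sat D p (\<lambda>n. e ((\<rho>(k := j)) n))"
    using All by blast
  have "sat D p (\<lambda>n. (e(j := x)) ((\<rho>(k := j)) n)) = sat D p ((\<lambda>n. e (\<rho> n))(k := x))" for x e and D :: "'a set"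
    by (rule sat_cong) (use j in auto)
  then show ?case by (intro exI[of _ "All j q"]) (use q in \<open>simp del: fun_upd_apply\<close>)
qed

text \<open>Trades the named quantifier for one over index 0 of a shifted environment;
  \<open>j\<close> is a name that no shifted variable of \<open>p\<close> occupies.\<close>

lemma forall_formula:
  "\<exists>q. in_formula q = in_formula p \<and>
    (\<forall>(D::'a::in_st set) e. sat D q e \<longleftrightarrow> (\<forall>x\<in>D. sat D p (case_nat x e)))"
proof -
  obtain j where j: "j \<notin> (\<lambda>n. n - 1) ` vars p"
    using fresh_nat[of "(\<lambda>n. n - 1) ` vars p"] finite_vars by auto
  obtain q where q: "in_formula q = in_formula p"
    "\<forall>(D::'a set) e. sat D q e = sat D p (\<lambda>n. e (case_nat j id n))"
    using renaming[of p "case_nat j id"] by blast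
  have "sat D p (\<lambda>n. (e(j := x)) (case_nat j id n)) = sat D p (case_nat x e)" for x e and D :: "'a set"
    by (rule sat_cong) (use j in \<open>force split: nat.split\<close>)
  then show ?thesis by (intro exI[of _ "All j q"]) (use q in \<open>simp del: fun_upd_apply\<close>)
qed

text \<open>In \<open>uf b D C P\<close> one formula, free of \<open>st\<close> unless \<open>b\<close>, defines \<open>P i\<close> in every structure \<open>D i\<close>.  Its
  constants are drawn from \<open>C\<close> and may depend on the index \<open>i\<close> (for the transfer along \<open>*\<close>, \<open>w\<close> in one
  structure corresponds to \<open>*w\<close> in the other).  Environments are de Bruijn style, so quantifiers shift
  the variables.\<close>

definition mix :: "(nat \<Rightarrow> 'a) \<Rightarrow> (nat \<Rightarrow> 'a) \<Rightarrow> nat \<Rightarrow> 'a"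
  where "mix e c n = (if even n then e (n div 2) else c (n div 2))"

definition uf :: "bool \<Rightarrow> ('i \<Rightarrow> 'a::in_st set) \<Rightarrow> ('i \<Rightarrow> 'a) set \<Rightarrow> ('i \<Rightarrow> (nat \<Rightarrow> 'a) \<Rightarrow> bool) \<Rightarrow> bool"
  where "uf b D C P \<longleftrightarrow> (\<forall>c\<in>C. \<forall>i. c i \<in> D i) \<and> (\<exists>p c. (b \<or> in_formula p) \<and> range c \<subseteq> C \<and>
     (\<forall>i e. range e \<subseteq> D i \<longrightarrow> P i e = sat (D i) p (mix e (\<lambda>n. c n i))))"

text \<open>Operations enter formulas through their graphs: an operation is admissible when every
  structure is closed under it and its graph is uniformly definable.\<close>

definition tm :: "bool \<Rightarrow> ('i \<Rightarrow> 'a::in_st set) \<Rightarrow> ('i \<Rightarrow> 'a) set \<Rightarrow> ('i \<Rightarrow> (nat \<Rightarrow> 'a) \<Rightarrow> 'a) \<Rightarrow> bool"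
  where "tm b D C t \<longleftrightarrow> (\<forall>i e. range e \<subseteq> D i \<longrightarrow> t i e \<in> D i) \<and>
     uf b D C (\<lambda>i e. e 0 = t i (\<lambda>n. e (Suc n)))"

definition consts_ok :: "('i \<Rightarrow> 'a::in_st set) \<Rightarrow> ('i \<Rightarrow> 'a) set \<Rightarrow> bool"
  where "consts_ok D C \<longleftrightarrow> C \<noteq> {} \<and> (\<forall>c\<in>C. \<forall>i. c i \<in> D i)"

text \<open>Rules that follow the syntax of a predicate, so that \<open>intro ufi\<close> settles
  the definability goal raised by each use of Separation, Collection, induction or transfer.\<close>

named_theorems ufi

lemma uf_consts: "uf b D C P \<Longrightarrow> consts_ok D C"
  unfolding uf_def consts_ok_def by auto

lemma uf_cong:
  assumes "uf b D C P" "\<And>i e. range e \<subseteq> D i \<Longrightarrow> Q i e = P i e"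
  shows "uf b D C Q"
  using assms unfolding uf_def by (metis (full_types))

text \<open>\<open>mix\<close> wants a sequence of constants even where none occurs;
  \<open>c0\<close> fills it, which is why \<open>consts_ok\<close> asks for a nonempty
  \<open>C\<close>.\<close>

lemma uf_atom:
  assumes "consts_ok D C" "b \<or> in_formula p" "\<And>i e. P i e = sat (D i) p e"
  shows "uf b D C P"
proof -
  obtain c0 where c0: "c0 \<in> C" using assms(1) by (auto simp: consts_ok_def)
  obtain q where q: "in_formula q = in_formula p"
    "\<forall>(D::'b set) e. sat D q e = sat D p (\<lambda>n. e (2 * n))" using renaming[of p "\<lambda>n. 2*n"] by blast
  have "(\<lambda>n. mix e c (2 * n)) = e" for e c :: "nat \<Rightarrow> 'b" by (auto simp: mix_def)
  then show ?thesis unfolding uf_def using assms q c0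
    by (intro conjI exI[of _ q] exI[of _ "\<lambda>_. c0"]) (auto simp: consts_ok_def)
qed

lemma uf_var_mem: "consts_ok D C \<Longrightarrow> uf b D C (\<lambda>i e. e j \<in> elts (e k))"
  by (rule uf_atom[where p = "Mem j k"]) auto

lemma uf_var_eq: "consts_ok D C \<Longrightarrow> uf b D C (\<lambda>i e. e j = e k)"
  by (rule uf_atom[where p = "Eq j k"]) auto

lemma uf_var_st: "consts_ok D C \<Longrightarrow> uf True D C (\<lambda>i e. st (e j))"
  by (rule uf_atom[where p = "St j"]) auto

section \<open>Connectives, quantifiers and parameters\<close>

lemma uf_not[ufi]: "uf b D C P \<Longrightarrow> uf b D C (\<lambda>i e. \<not> P i e)"
proof -
  assume *: "uf b D C P"
  then obtain p c where "b \<or> in_formula p" "range c \<subseteq> C"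
     "\<forall>i e. range e \<subseteq> D i \<longrightarrow> P i e = sat (D i) p (mix e (\<lambda>n. c n i))"
    unfolding uf_def by blast
  then show ?thesis using * unfolding uf_def
    by (intro conjI exI[of _ "Neg p"] exI[of _ c]) (auto)
qed

lemma uf_conj[ufi]: assumes "uf b D C P" "uf b D C Q" shows "uf b D C (\<lambda>i e. P i e \<and> Q i e)"
proof -
  obtain p c where p: "b \<or> in_formula p" "range c \<subseteq> C"
     "\<And>i e. range e \<subseteq> D i \<Longrightarrow> P i e = sat (D i) p (mix e (\<lambda>n. c n i))"
    using assms(1) unfolding uf_def by blast
  obtain q d where q: "b \<or> in_formula q" "range d \<subseteq> C"
     "\<And>i e. range e \<subseteq> D i \<Longrightarrow> Q i e = sat (D i) q (mix e (\<lambda>n. d n i))"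
    using assms(2) unfolding uf_def by blast
  \<comment> \<open>The two sequences of constants are interleaved as \<open>mix c d\<close>;
    \<open>r1\<close> and \<open>r2\<close> leave the variables alone and send constant number k to
    numbers 2k and 2k+1.\<close>
  define r1 :: "nat \<Rightarrow> nat" where "r1 n = (if even n then n else 2 * (2 * (n div 2)) + 1)" for n
  define r2 :: "nat \<Rightarrow> nat" where "r2 n = (if even n then n else 2 * (2 * (n div 2) + 1) + 1)" for n
  obtain p' where p': "in_formula p' = in_formula p"
    "\<forall>(D::'b set) e. sat D p' e = sat D p (\<lambda>n. e (r1 n))" using renaming[of p r1] by blast
  obtain q' where q': "in_formula q' = in_formula q"
    "\<forall>(D::'b set) e. sat D q' e = sat D q (\<lambda>n. e (r2 n))" using renaming[of q r2] by blast
  have 1: "(\<lambda>n. mix e (\<lambda>n. mix c d n i) (r1 n)) = mix e (\<lambda>n. c n i)" for e :: "nat \<Rightarrow> 'b" and i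
    by (rule ext) (auto simp: mix_def r1_def elim!: oddE)
  have 2: "(\<lambda>n. mix e (\<lambda>n. mix c d n i) (r2 n)) = mix e (\<lambda>n. d n i)" for e :: "nat \<Rightarrow> 'b" and i
    by (rule ext) (auto simp: mix_def r2_def elim!: oddE)
  have "range (mix c d) \<subseteq> C" using p(2) q(2) by (auto simp: mix_def)
  moreover have "P i e \<and> Q i e \<longleftrightarrow> sat (D i) (Conj p' q') (mix e (\<lambda>n. mix c d n i))"
    if "range e \<subseteq> D i" for i e
    using that p(3) q(3) p'(2) q'(2) 1 2 by simp
  moreover have "b \<or> in_formula (Conj p' q')" using p p' q q' by auto
  ultimately show ?thesis using assms(1) unfolding uf_def
    by (intro conjI exI[of _ "Conj p' q'"] exI[of _ "mix c d"]) auto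
qed

lemma uf_disj[ufi]: "uf b D C P \<Longrightarrow> uf b D C Q \<Longrightarrow> uf b D C (\<lambda>i e. P i e \<or> Q i e)"
  by (drule (1) uf_conj[OF uf_not uf_not, THEN uf_not]) (simp only: de_Morgan_conj not_not)

lemma uf_imp[ufi]: "uf b D C P \<Longrightarrow> uf b D C Q \<Longrightarrow> uf b D C (\<lambda>i e. P i e \<longrightarrow> Q i e)"
  unfolding imp_conv_disj by (intro ufi)

lemma uf_iff[ufi]: "uf b D C P \<Longrightarrow> uf b D C Q \<Longrightarrow> uf b D C (\<lambda>i e. P i e \<longleftrightarrow> Q i e)"
  unfolding iff_conv_conj_imp by (intro ufi)

lemma uf_ball[ufi]:
  assumes "uf b D C (\<lambda>i e. P i (\<lambda>n. e (Suc n)) (e 0))"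
  shows "uf b D C (\<lambda>i e. \<forall>x\<in>D i. P i e x)"
proof -
  obtain p c where p: "b \<or> in_formula p" "range c \<subseteq> C"
     "\<And>i e. range e \<subseteq> D i \<Longrightarrow> P i (\<lambda>n. e (Suc n)) (e 0) = sat (D i) p (mix e (\<lambda>n. c n i))"
    using assms(1) unfolding uf_def by blast
  \<comment> \<open>Putting \<open>x\<close> in front of the interleaved environment moves every
    slot by one, putting it in front of the variables alone moves the even slots by two;
    \<open>r\<close> reconciles both layouts.\<close>
  define r :: "nat \<Rightarrow> nat" where "r n = (if n = 0 then 0 else if even n then n - 1 else n + 1)" for n
  obtain p' where p': "in_formula p' = in_formula p"
    "\<forall>(D::'b set) e. sat D p' e = sat D p (\<lambda>n. e (r n))" using renaming[of p r] by blast
  obtain q where q: "in_formula q = in_formula p'"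
    "\<forall>(D::'b set) e. sat D q e \<longleftrightarrow> (\<forall>x\<in>D. sat D p' (case_nat x e))" using forall_formula[of p'] by blast
  have r: "(\<lambda>n. case_nat x (mix e c) (r n)) = mix (case_nat x e) c" for x and e c :: "nat \<Rightarrow> 'b"
    by (rule ext, case_tac n) (auto simp: mix_def r_def  elim!: oddE)
  have "(\<forall>x\<in>D i. P i e x) \<longleftrightarrow> sat (D i) q (mix e (\<lambda>n. c n i))" if e: "range e \<subseteq> D i" for i e
  proof -
    have "P i e x = sat (D i) p (mix (case_nat x e) (\<lambda>n. c n i))" if "x \<in> D i" for x
      using p(3)[of "case_nat x e" i] e that by (auto split: nat.split simp: image_subset_iff)
    then show ?thesis using q(2) p'(2) r by simp
  qed
  then show ?thesis using assms p(1,2) p'(1) q(1) unfolding uf_def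
    by (intro conjI exI[of _ q] exI[of _ c]) auto
qed

lemma uf_bex[ufi]:
  assumes "uf b D C (\<lambda>i e. P i (\<lambda>n. e (Suc n)) (e 0))"
  shows "uf b D C (\<lambda>i e. \<exists>x\<in>D i. P i e x)"
proof -
  have "uf b D C (\<lambda>i e. \<not> (\<forall>x\<in>D i. \<not> P i e x))" by (intro ufi assms)
  then show ?thesis by simp
qed

text \<open>Introduces a parameter: definability is shown with the parameter as variable 0, then its
  value is put in front of the sequence of constants.\<close>

lemma uf_const_abs:
  assumes "c \<in> C" "uf b D C (\<lambda>i e. P i (\<lambda>n. e (Suc n)) (e 0))"
  shows "uf b D C (\<lambda>i e. P i e (c i))"
proof -
  obtain p d where p: "b \<or> in_formula p" "range d \<subseteq> C"
     "\<And>i e. range e \<subseteq> D i \<Longrightarrow> P i (\<lambda>n. e (Suc n)) (e 0) = sat (D i) p (mix e (\<lambda>n. d n i))"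
    using assms(2) unfolding uf_def by blast
  have cD: "\<And>i. c i \<in> D i" using assms by (auto simp: uf_def)
  define r :: "nat \<Rightarrow> nat" where "r n = (if n = 0 then 1 else if even n then n - 2 else n + 2)" for n
  obtain p' where p': "in_formula p' = in_formula p"
    "\<forall>(D::'b set) e. sat D p' e = sat D p (\<lambda>n. e (r n))" using renaming[of p r] by blast
  have r: "(\<lambda>n. mix e (\<lambda>n. case_nat c d n i) (r n)) = mix (case_nat (c i) e) (\<lambda>n. d n i)" for i and e :: "nat \<Rightarrow> 'b"
    by (rule ext, case_tac n) (auto simp: mix_def r_def  elim!: oddE)
  have "P i e (c i) \<longleftrightarrow> sat (D i) p' (mix e (\<lambda>n. case_nat c d n i))" if e: "range e \<subseteq> D i" for i e
    using p(3)[of "case_nat (c i) e" i] e cD p'(2) r by (auto split: nat.split simp: image_subset_iff)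
  moreover have "range (case_nat c d) \<subseteq> C" using p(2) assms(1) by (auto split: nat.splits simp: image_subset_iff)
  ultimately show ?thesis using assms(2) p(1) p'(1) unfolding uf_def
    by (intro conjI exI[of _ p'] exI[of _ "case_nat c d"]) auto
qed

lemma uf_rename: "uf b D C P \<Longrightarrow> uf b D C (\<lambda>i e. P i (\<lambda>n. e (\<rho> n)))"
proof -
  assume *: "uf b D C P"
  then obtain p c where p: "b \<or> in_formula p" "range c \<subseteq> C"
     "\<And>i e. range e \<subseteq> D i \<Longrightarrow> P i e = sat (D i) p (mix e (\<lambda>n. c n i))"
    unfolding uf_def by blast
  define r :: "nat \<Rightarrow> nat" where "r n = (if even n then 2 * \<rho> (n div 2) else n)" for n
  obtain p' where p': "in_formula p' = in_formula p"
    "\<forall>(D::'b set) e. sat D p' e = sat D p (\<lambda>n. e (r n))" using renaming[of p r] by blast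
  have r: "(\<lambda>n. mix e c (r n)) = mix (\<lambda>n. e (\<rho> n)) c" for e c :: "nat \<Rightarrow> 'b"
    by (auto simp: mix_def r_def)
  have "P i (\<lambda>n. e (\<rho> n)) = sat (D i) p' (mix e (\<lambda>n. c n i))" if e: "range e \<subseteq> D i" for i e
    using p(3)[of "\<lambda>n. e (\<rho> n)" i] e p'(2) r by auto
  then show ?thesis using * p(1,2) p'(1) unfolding uf_def
    by (intro conjI exI[of _ p'] exI[of _ c]) auto
qed

section \<open>Terms and their substitution\<close>

lemma tm_var[ufi]: "consts_ok D C \<Longrightarrow> tm b D C (\<lambda>i e. e k)"
  unfolding tm_def by (auto intro: uf_var_eq)

lemma tm_const[ufi]:
  assumes "consts_ok D C" "c \<in> C" shows "tm b D C (\<lambda>i e. c i)"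
proof -
  have "uf b D C (\<lambda>i e. e 0 = c i)"
    by (rule uf_const_abs[OF assms(2)]) (rule uf_var_eq[OF assms(1)])
  then show ?thesis using assms unfolding tm_def consts_ok_def by auto
qed

lemma tm_in: "tm b D C t \<Longrightarrow> range e \<subseteq> D i \<Longrightarrow> t i e \<in> D i"
  unfolding tm_def by auto

lemma tm_uf: "tm b D C t \<Longrightarrow> uf b D C (\<lambda>i e. e 0 = t i (\<lambda>n. e (Suc n)))"
  unfolding tm_def by auto

lemma tm_shift: "tm b D C t \<Longrightarrow> tm b D C (\<lambda>i e. t i (\<lambda>n. e (Suc n)))"
  unfolding tm_def
  using uf_rename[where \<rho> = "case_nat 0 (\<lambda>n. Suc (Suc n))" and P = "\<lambda>i e. e 0 = t i (\<lambda>n. e (Suc n))"]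
  by (auto simp: image_subset_iff)

text \<open>A term is substituted by quantifying over its value, which \<open>tm_in\<close> keeps
  inside the structure. A relation between variables therefore suffices to handle all its
  instances.\<close>

lemma uf_lift1:
  assumes "uf b D C (\<lambda>i e. R i (e 0))" "tm b D C t"
  shows "uf b D C (\<lambda>i e. R i (t i e))"
proof (rule uf_cong)
  show "uf b D C (\<lambda>i e. \<exists>x\<in>D i. x = t i e \<and> R i x)"
    by (intro ufi tm_uf tm_shift assms(2) uf_rename[OF assms(1), where \<rho> = id, unfolded id_def])
qed (use tm_in[OF assms(2)] in auto)

lemma uf_lift2:
  assumes "uf b D C (\<lambda>i e. R i (e 0) (e (Suc 0)))" "tm b D C t" "tm b D C s"
  shows "uf b D C (\<lambda>i e. R i (t i e) (s i e))"
proof (rule uf_cong)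
  show "uf b D C (\<lambda>i e. \<exists>x\<in>D i. x = t i e \<and> (\<exists>y\<in>D i. y = s i e \<and> R i x y))"
    \<comment> \<open>Inner quantifiers occupy smaller indices, so the arguments arrive in reverse
      order; the renaming turns them back.\<close>
    by (intro ufi tm_uf tm_shift assms(2) uf_rename[OF assms(1), where \<rho> = "case_nat (Suc 0) (\<lambda>_. 0)", simplified]
       assms(3))
qed (use tm_in[OF assms(2)] tm_in[OF assms(3)] in auto)

lemma uf_lift3:
  assumes "uf b D C (\<lambda>i e. R i (e 0) (e (Suc 0)) (e (Suc (Suc 0))))" "tm b D C t" "tm b D C s" "tm b D C u"
  shows "uf b D C (\<lambda>i e. R i (t i e) (s i e) (u i e))"
proof (rule uf_cong)
  show "uf b D C (\<lambda>i e. \<exists>x\<in>D i. x = t i e \<and> (\<exists>y\<in>D i. y = s i e \<and> (\<exists>z\<in>D i. z = u i e \<and> R i x y z)))"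
    by (intro ufi tm_uf tm_shift assms(2) assms(3) tm_uf[OF tm_shift, OF tm_shift, OF assms(4)]
       uf_rename[OF assms(1), where \<rho> = "\<lambda>n. Suc (Suc 0) - n", simplified])
qed (use tm_in[OF assms(2)] tm_in[OF assms(3)] tm_in[OF assms(4)] in auto)

lemma uf_lift4:
  assumes "uf b D C (\<lambda>i e. R i (e 0) (e (Suc 0)) (e (Suc (Suc 0))) (e (Suc (Suc (Suc 0)))))" "tm b D C t" "tm b D C s" "tm b D C u" "tm b D C v"
  shows "uf b D C (\<lambda>i e. R i (t i e) (s i e) (u i e) (v i e))"
proof (rule uf_cong)
  show "uf b D C (\<lambda>i e. \<exists>x\<in>D i. x = t i e \<and> (\<exists>y\<in>D i. y = s i e \<and> (\<exists>z\<in>D i. z = u i e \<and>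
      (\<exists>w\<in>D i. w = v i e \<and> R i x y z w))))"
    by (intro ufi tm_uf tm_shift assms(2) assms(3) tm_uf[OF tm_shift, OF tm_shift, OF assms(4)]
       tm_uf[OF tm_shift, OF tm_shift, OF tm_shift, OF assms(5)]
       uf_rename[OF assms(1), where \<rho> = "\<lambda>n. Suc (Suc (Suc 0)) - n", simplified])
qed (use tm_in[OF assms(2)] tm_in[OF assms(3)] tm_in[OF assms(4)] tm_in[OF assms(5)] in auto)

lemma uf_mem[ufi]: "tm b D C t \<Longrightarrow> tm b D C s \<Longrightarrow> consts_ok D C \<Longrightarrow> uf b D C (\<lambda>i e. t i e \<in> elts (s i e))"
  by (rule uf_lift2[where R = "\<lambda>_ x y. x \<in> elts y"]) (rule uf_var_mem)

lemma uf_eq[ufi]: "tm b D C t \<Longrightarrow> tm b D C s \<Longrightarrow> consts_ok D C \<Longrightarrow> uf b D C (\<lambda>i e. t i e = s i e)"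
  by (rule uf_lift2[where R = "\<lambda>_ x y. x = y"]) (rule uf_var_eq)

lemma uf_st[ufi]: "tm True D C t \<Longrightarrow> consts_ok D C \<Longrightarrow> uf True D C (\<lambda>i e. st (t i e))"
  by (rule uf_lift1[where R = "\<lambda>_ x. st x"]) (rule uf_var_st)

section \<open>Elementary set theory in HST\<close>

definition small :: "'a::in_st set \<Rightarrow> bool" where "small X \<longleftrightarrow> (\<exists>x. elts x = X)"

lemma elts_eq_iff: "elts x = elts y \<longleftrightarrow> x = (y::'a::hst)"
  using Extensionality by blast

lemma elts_set_of: "small X \<Longrightarrow> elts (set_of X :: 'a::hst) = X"
  unfolding small_def set_of_def by (rule theI') (metis Extensionality)

lemma set_of_elts[simp]: "set_of (elts x) = (x::'a::hst)"
  unfolding set_of_def by (rule the_equality) (auto intro: Extensionality)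

lemma small_elts[simp]: "small (elts x)" by (auto simp: small_def)

lemma set_of_eqI: "elts x = X \<Longrightarrow> set_of X = (x::'a::hst)" by auto

lemma small_pair[simp]: "small {x, y::'a::hst}" unfolding small_def by (rule Pair)
lemma small_sing[simp]: "small {x::'a::hst}" using small_pair[of x x] by simp

lemma small_Union: "small X \<Longrightarrow> small (\<Union>z\<in>X. elts (z::'a::hst))"
  unfolding small_def using Union by metis

lemma small_Un: assumes "small X" "small Y" shows "small (X \<union> (Y::'a::hst set))"
proof -
  obtain x y where "elts x = X" "elts y = Y" using assms by (auto simp: small_def)
  then show ?thesis using small_Union[OF small_pair[of x y]] by simp
qed

lemma small_insert[simp]: "small X \<Longrightarrow> small (insert a (X::'a::hst set))"
  using small_Un[of "{a}" X] by simp

definition upair :: "'a::in_st \<Rightarrow> 'a \<Rightarrow> 'a" where "upair x y = set_of {x, y}"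
definition ins :: "'a::in_st \<Rightarrow> 'a \<Rightarrow> 'a" where "ins a x = set_of (insert a (elts x))"

definition un :: "'a::in_st \<Rightarrow> 'a \<Rightarrow> 'a" where "un x y = set_of (elts x \<union> elts y)"

lemma elts_upair[simp]: "elts (upair x y) = {x, y::'a::hst}" by (simp add: upair_def elts_set_of)
lemma elts_ins[simp]: "elts (ins a x) = insert a (elts (x::'a::hst))" by (simp add: ins_def elts_set_of)

lemma elts_un[simp]: "elts (un x y) = elts x \<union> elts (y::'a::hst)" by (simp add: un_def elts_set_of small_Un)

lemma opair_upair: "opair x y = upair (upair x x) (upair x y)"
  by (simp add: opair_def upair_def)

lemma upair_eq: "upair x y = upair a b \<longleftrightarrow> {x, y} = {a, b::'a::hst}"
  by (metis elts_upair elts_eq_iff)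

lemma opair_eq[simp]: "opair x y = opair a b \<longleftrightarrow> x = a \<and> y = (b::'a::hst)"
  unfolding opair_upair upair_eq by (auto simp: upair_eq doubleton_eq_iff)

text \<open>What makes bounded quantifiers, pairs and successors mean the same in a structure as in
  the universe. \<open>Standard\<close> is no instance, since a standard set may have nonstandard
  elements.\<close>

definition tpc :: "('i \<Rightarrow> 'a::in_st set) \<Rightarrow> bool" where
  "tpc D \<longleftrightarrow> (\<forall>i. (\<forall>x\<in>D i. elts x \<subseteq> D i) \<and> (\<forall>x\<in>D i. \<forall>y\<in>D i. upair x y \<in> D i \<and> ins x y \<in> D i \<and> un x y \<in> D i))"

lemma tpc_trans: "tpc D \<Longrightarrow> x \<in> D i \<Longrightarrow> y \<in> elts x \<Longrightarrow> y \<in> D i" unfolding tpc_def by blast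
lemma tpc_upair: "tpc D \<Longrightarrow> x \<in> D i \<Longrightarrow> y \<in> D i \<Longrightarrow> upair x y \<in> D i" unfolding tpc_def by blast
lemma tpc_ins: "tpc D \<Longrightarrow> x \<in> D i \<Longrightarrow> y \<in> D i \<Longrightarrow> ins x y \<in> D i" unfolding tpc_def by blast
lemma tpc_un: "tpc D \<Longrightarrow> x \<in> D i \<Longrightarrow> y \<in> D i \<Longrightarrow> un x y \<in> D i" unfolding tpc_def by blast
lemma tpc_opair: "tpc D \<Longrightarrow> x \<in> D i \<Longrightarrow> y \<in> D i \<Longrightarrow> opair x y \<in> D i"
  unfolding opair_upair by (simp add: tpc_upair)
lemma tpc_opairD:
  fixes x y :: "'a::hst" shows "tpc D \<Longrightarrow> opair x y \<in> D i \<Longrightarrow> x \<in> D i \<and> y \<in> D i"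
proof -
  assume D: "tpc D" and p: "opair x y \<in> D i"
  have "upair x y \<in> D i" using tpc_trans[OF D p, of "upair x y"] by (simp add: opair_upair)
  then show ?thesis using tpc_trans[OF D, of "upair x y" i] by simp
qed

lemma uf_elts_ball[ufi]:
  assumes "tpc D" "tm b D C t" "uf b D C (\<lambda>i e. P i (\<lambda>n. e (Suc n)) (e 0))"
  shows "uf b D C (\<lambda>i e. \<forall>x\<in>elts (t i e). P i e x)"
proof (rule uf_cong)
  have c: "consts_ok D C" by (rule uf_consts[OF assms(3)])
  show "uf b D C (\<lambda>i e. \<forall>x\<in>D i. x \<in> elts (t i e) \<longrightarrow> P i e x)"
    by (intro ufi tm_shift[OF assms(2)] assms c)
qed (use tpc_trans[OF assms(1)] tm_in[OF assms(2)] in blast)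

lemma uf_elts_bex[ufi]:
  assumes "tpc D" "tm b D C t" "uf b D C (\<lambda>i e. P i (\<lambda>n. e (Suc n)) (e 0))"
  shows "uf b D C (\<lambda>i e. \<exists>x\<in>elts (t i e). P i e x)"
proof -
  have "uf b D C (\<lambda>i e. \<not> (\<forall>x\<in>elts (t i e). \<not> P i e x))" by (intro ufi assms)
  then show ?thesis by simp
qed

lemma uf_all[ufi]:
  "uf b (\<lambda>_. UNIV) C (\<lambda>i e. P i (\<lambda>n. e (Suc n)) (e 0)) \<Longrightarrow> uf b (\<lambda>_. UNIV) C (\<lambda>i e. \<forall>x. P i e x)"
  using uf_ball[of b "\<lambda>_. UNIV"] by auto
lemma uf_ex[ufi]:
  "uf b (\<lambda>_. UNIV) C (\<lambda>i e. P i (\<lambda>n. e (Suc n)) (e 0)) \<Longrightarrow> uf b (\<lambda>_. UNIV) C (\<lambda>i e. \<exists>x. P i e x)"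
  using uf_bex[of b "\<lambda>_. UNIV"] by auto
lemma uf_subset[ufi]:
  assumes "tpc D" "tm b D C t" "tm b D C s"
  shows "uf b D C (\<lambda>i e. elts (t i e) \<subseteq> elts (s i e))"
proof -
  have c: "consts_ok D C" using assms(2) unfolding tm_def by (auto dest: uf_consts)
  show ?thesis unfolding subset_eq by (intro ufi assms c tm_shift[OF assms(3)])
qed

lemma tm_lift2:
  assumes "uf b D C (\<lambda>i e. e 0 = f i (e (Suc 0)) (e (Suc (Suc 0))))" "tm b D C t" "tm b D C s"
    "\<And>i x y. x \<in> D i \<Longrightarrow> y \<in> D i \<Longrightarrow> f i x y \<in> D i"
  shows "tm b D C (\<lambda>i e. f i (t i e) (s i e))"
  unfolding tm_def
proof (intro conjI allI impI)
  have c: "consts_ok D C" by (rule uf_consts[OF assms(1)])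
  show "uf b D C (\<lambda>i e. e 0 = f i (t i (\<lambda>n. e (Suc n))) (s i (\<lambda>n. e (Suc n))))"
    by (rule uf_lift3[where R = "\<lambda>i x y z. x = f i y z"]) (intro assms ufi c tm_shift[OF assms(2)] tm_shift[OF assms(3)])+
qed (use assms tm_in[OF assms(2)] tm_in[OF assms(3)] in auto)

lemma tm_consts: "tm b D C t \<Longrightarrow> consts_ok D C"
  unfolding tm_def by (auto dest: uf_consts)

lemma tm_upair[ufi]:
  fixes D :: "'i \<Rightarrow> 'a::hst set"
  assumes "tpc D" "tm b D C t" "tm b D C s"
  shows "tm b D C (\<lambda>i e. upair (t i e) (s i e))"
proof (rule tm_lift2[OF _ assms(2,3)])
  have c: "consts_ok D C" by (rule tm_consts[OF assms(2)])
  show "uf b D C (\<lambda>i e. e 0 = upair (e (Suc 0)) (e (Suc (Suc 0))))"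
  proof (rule uf_cong)
    show "uf b D C (\<lambda>i e. \<forall>u\<in>D i. u \<in> elts (e 0) \<longleftrightarrow> u = e (Suc 0) \<or> u = e (Suc (Suc 0)))"
      by (intro ufi c)
  next
    fix i and e :: "nat \<Rightarrow> 'a" assume e: "range e \<subseteq> D i"
    have "e 0 = upair (e (Suc 0)) (e (Suc (Suc 0))) \<longleftrightarrow> elts (e 0) = {e (Suc 0), e (Suc (Suc 0))}"
      by (metis elts_upair elts_eq_iff)
    moreover have "\<And>k. e k \<in> D i" "elts (e 0) \<subseteq> D i"
      using e tpc_trans[OF assms(1), of "e 0" i] by auto
    ultimately show "(e 0 = upair (e (Suc 0)) (e (Suc (Suc 0)))) =
         (\<forall>u\<in>D i. (u \<in> elts (e 0)) = (u = e (Suc 0) \<or> u = e (Suc (Suc 0))))"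
      by (auto simp: set_eq_iff)
  qed
qed (rule tpc_upair[OF assms(1)])

lemma tm_ins[ufi]:
  fixes D :: "'i \<Rightarrow> 'a::hst set"
  assumes "tpc D" "tm b D C t" "tm b D C s"
  shows "tm b D C (\<lambda>i e. ins (t i e) (s i e))"
proof (rule tm_lift2[OF _ assms(2,3)])
  have c: "consts_ok D C" by (rule tm_consts[OF assms(2)])
  show "uf b D C (\<lambda>i e. e 0 = ins (e (Suc 0)) (e (Suc (Suc 0))))"
  proof (rule uf_cong)
    show "uf b D C (\<lambda>i e. \<forall>u\<in>D i. u \<in> elts (e 0) \<longleftrightarrow> u = e (Suc 0) \<or> u \<in> elts (e (Suc (Suc 0))))"
      by (intro ufi c)
  next
    fix i and e :: "nat \<Rightarrow> 'a" assume e: "range e \<subseteq> D i"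
    have "e 0 = ins (e (Suc 0)) (e (Suc (Suc 0))) \<longleftrightarrow> elts (e 0) = insert (e (Suc 0)) (elts (e (Suc (Suc 0))))"
      by (metis elts_ins elts_eq_iff)
    moreover have "\<And>k. e k \<in> D i" "\<And>k. elts (e k) \<subseteq> D i"
      using e tpc_trans[OF assms(1)] by auto
    ultimately show "(e 0 = ins (e (Suc 0)) (e (Suc (Suc 0)))) =
         (\<forall>u\<in>D i. (u \<in> elts (e 0)) = (u = e (Suc 0) \<or> u \<in> elts (e (Suc (Suc 0)))))"
      by (auto simp: set_eq_iff)
  qed
qed (rule tpc_ins[OF assms(1)])

lemma tm_un[ufi]:
  fixes D :: "'i \<Rightarrow> 'a::hst set"
  assumes "tpc D" "tm b D C t" "tm b D C s"
  shows "tm b D C (\<lambda>i e. un (t i e) (s i e))"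
proof (rule tm_lift2[OF _ assms(2,3)])
  have c: "consts_ok D C" by (rule tm_consts[OF assms(2)])
  show "uf b D C (\<lambda>i e. e 0 = un (e (Suc 0)) (e (Suc (Suc 0))))"
  proof (rule uf_cong)
    show "uf b D C (\<lambda>i e. \<forall>u\<in>D i. u \<in> elts (e 0) \<longleftrightarrow> u \<in> elts (e (Suc 0)) \<or> u \<in> elts (e (Suc (Suc 0))))"
      by (intro ufi c)
  next
    fix i and e :: "nat \<Rightarrow> 'a" assume e: "range e \<subseteq> D i"
    have "e 0 = un (e (Suc 0)) (e (Suc (Suc 0))) \<longleftrightarrow> elts (e 0) = elts (e (Suc 0)) \<union> elts (e (Suc (Suc 0)))"
      by (metis elts_un elts_eq_iff)
    moreover have "\<And>k. e k \<in> D i" "\<And>k. elts (e k) \<subseteq> D i"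
      using e tpc_trans[OF assms(1)] by auto
    ultimately show "(e 0 = un (e (Suc 0)) (e (Suc (Suc 0)))) =
         (\<forall>u\<in>D i. (u \<in> elts (e 0)) = (u \<in> elts (e (Suc 0)) \<or> u \<in> elts (e (Suc (Suc 0)))))"
      by (auto simp: set_eq_iff)
  qed
qed (rule tpc_un[OF assms(1)])

lemma tm_opair[ufi]:
  fixes D :: "'i \<Rightarrow> 'a::hst set"
  assumes "tpc D" "tm b D C t" "tm b D C s"
  shows "tm b D C (\<lambda>i e. opair (t i e) (s i e))"
  unfolding opair_upair by (intro ufi assms)

section \<open>Separation and Collection for definable predicates\<close>

abbreviation dU :: "((nat \<Rightarrow> 'a::in_st) \<Rightarrow> bool) \<Rightarrow> bool"
  where "dU P \<equiv> uf True (\<lambda>_::unit. UNIV) UNIV (\<lambda>_. P)"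

lemma consts_ok_UNIV[ufi]: "consts_ok (\<lambda>_. UNIV) UNIV" by (simp add: consts_ok_def)
lemma tpc_UNIV[ufi]: "tpc (\<lambda>_. UNIV)" by (simp add: tpc_def)
declare UNIV_I[ufi]

lemma mix_upd: "(mix e c)(0 := z) = mix (e(0 := z)) c"
  by (rule ext) (auto simp: mix_def elim!: evenE)

lemma small_sepU:
  assumes "small X" "dU (\<lambda>e. P (e 0))" shows "small {z\<in>X. P (z::'a::hst)}"
proof -
  obtain x where x: "X = elts x" using assms(1) by (auto simp: small_def)
  obtain p c where p: "\<And>e::nat\<Rightarrow>'a. P (e 0) = sat UNIV p (mix e (\<lambda>n. c n ()))"
    using assms(2) unfolding uf_def by auto
  have "P z = sat UNIV p ((mix (\<lambda>_. z) (\<lambda>n. c n ()))(0 := z))" for z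
    using p[of "\<lambda>_. z"] by (simp add: mix_upd fun_upd_idem)
  moreover have "((mix (\<lambda>_. z) (\<lambda>n. c n ()))(0 := z)) = (mix (\<lambda>_. z) (\<lambda>n. c n ()))" for z
    by (simp add: mix_upd fun_upd_idem)
  moreover have "P z = sat UNIV p ((mix (\<lambda>_. x) (\<lambda>n. c n ()))(0 := z))" for z
    using p[of "(\<lambda>_. x)(0 := z)"] by (simp add: mix_upd)
  ultimately show ?thesis unfolding small_def x
    using Separation[of x p "mix (\<lambda>_. x) (\<lambda>n. c n ())"] by simp
qed

lemma collU:
  assumes "dU (\<lambda>e. P (e 0) (e (Suc 0)))"
  shows "\<exists>y. \<forall>a\<in>elts (x::'a::hst). (\<exists>b. P a b) \<longrightarrow> (\<exists>b\<in>elts y. P a b)"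
proof -
  obtain p c where p: "\<And>e::nat\<Rightarrow>'a. P (e 0) (e (Suc 0)) = sat UNIV p (mix e (\<lambda>n. c n ()))"
    using assms unfolding uf_def by auto
  \<comment> \<open>Collection writes its second argument into slot 1, which \<open>mix\<close>
    reserves for the first constant. Hence the constants move up by two, and all variables except 0
    read slot 1.\<close>
  define r :: "nat \<Rightarrow> nat" where "r n = (if n = 0 then 0 else if even n then 1 else n + 2)" for n
  obtain q where q: "\<forall>(D::'a set) e. sat D q e = sat D p (\<lambda>n. e (r n))" using renaming[of p r] by blast
  define E where "E = (\<lambda>m. c ((m - 2) div 2) ())"
  have "(\<lambda>n. (E(0 := a, 1 := b)) (r n)) = mix (case_nat a (\<lambda>_. b)) (\<lambda>n. c n ())" for a b
    by (rule ext) (auto simp: mix_def r_def E_def split: nat.splits elim!: evenE)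
  then have "P a b = sat UNIV q (E(0 := a, 1 := b))" for a b
    using q p[of "case_nat a (\<lambda>_. b)"] by simp
  then show ?thesis using Collection[of x q E] by simp
qed

lemma small_empty[simp]: "small ({}::'a::hst set)"
proof -
  have "dU (\<lambda>e::nat \<Rightarrow> 'a. e 0 \<noteq> e 0)" by (intro ufi)
  from small_sepU[OF small_elts this, of undefined] show ?thesis by simp
qed

lemma elts_empty[simp]: "elts (set_of {} :: 'a::hst) = {}" by (simp add: elts_set_of)

text \<open>Formulas speak about functions through their graphs, since \<open>fapp\<close> is a
  definite description.\<close>

definition rel :: "'a::in_st \<Rightarrow> 'a \<Rightarrow> 'a \<Rightarrow> bool" where "rel f x y \<longleftrightarrow> opair x y \<in> elts f"

lemma rel_ins: "rel (ins (opair a c) f) x y \<longleftrightarrow> x = a \<and> y = (c::'a::hst) \<or> rel f x y"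
  unfolding rel_def by auto

lemma uf_rel[ufi]:
  fixes D :: "'i \<Rightarrow> 'a::hst set"
  shows "tpc D \<Longrightarrow> tm b D C t \<Longrightarrow> tm b D C s \<Longrightarrow> tm b D C u \<Longrightarrow> uf b D C (\<lambda>i e. rel (t i e) (s i e) (u i e))"
  unfolding rel_def using tm_consts[of b D C t] by (intro ufi)

lemma fapp_eq: "is_function f \<Longrightarrow> rel f x y \<Longrightarrow> fapp f x = (y::'a::hst)"
  unfolding is_function_def fapp_def rel_def by blast

lemma fdom_rel: "x \<in> fdom f \<longleftrightarrow> (\<exists>y. rel f x y)" by (simp add: fdom_def rel_def)
lemma frange_rel: "y \<in> frange f \<longleftrightarrow> (\<exists>x. rel f x y)" by (simp add: frange_def rel_def)
lemma fapp_rel: "is_function f \<Longrightarrow> x \<in> fdom f \<Longrightarrow> rel f x (fapp f (x::'a::hst))"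
  using fapp_eq fdom_rel by metis

definition zero :: "'a::in_st" where "zero = set_of {}"
definition sc :: "'a::in_st \<Rightarrow> 'a" where "sc n = ins n n"

lemma elts_zero[simp]: "elts (zero::'a::hst) = {}" by (simp add: zero_def)
lemma elts_sc[simp]: "elts (sc n) = insert n (elts (n::'a::hst))" by (simp add: sc_def)
lemma eq_zero_iff: "elts x = {} \<longleftrightarrow> x = (zero::'a::hst)" by (metis elts_zero elts_eq_iff)

lemma tm_sc[ufi]:
  fixes D :: "'i \<Rightarrow> 'a::hst set"
  shows "tpc D \<Longrightarrow> tm b D C t \<Longrightarrow> tm b D C (\<lambda>i e. sc (t i e))"
  unfolding sc_def by (intro ufi)

text \<open>All quantifiers are bounded by the sets involved, so the notion is the same in every
  transitive class closed under pairs and is covered by the rules for definability.\<close>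

definition bijr :: "'a::in_st \<Rightarrow> 'a \<Rightarrow> 'a \<Rightarrow> bool" where
  "bijr f x y \<longleftrightarrow> (\<forall>p\<in>elts f. \<exists>a\<in>elts x. \<exists>b\<in>elts y. p = opair a b) \<and>
    (\<forall>a\<in>elts x. \<exists>b\<in>elts y. rel f a b \<and> (\<forall>c\<in>elts y. rel f a c \<longrightarrow> c = b)) \<and>
    (\<forall>b\<in>elts y. \<exists>a\<in>elts x. rel f a b \<and> (\<forall>c\<in>elts x. rel f c b \<longrightarrow> c = a))"

text \<open>Because the bijection must lie in \<open>D\<close>, finiteness is relative to the class:
  a nonstandard element of \<open>hnat\<close> counts as finite in \<open>Internal\<close>.\<close>

definition sz :: "'a::in_st set \<Rightarrow> 'a \<Rightarrow> 'a \<Rightarrow> bool" where "sz D x n \<longleftrightarrow> (\<exists>f\<in>D. bijr f x n)"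

lemma uf_bijr[ufi]:
  fixes D :: "'i \<Rightarrow> 'a::hst set"
  assumes "tpc D" "tm b D C t" "tm b D C s" "tm b D C u"
  shows "uf b D C (\<lambda>i e. bijr (t i e) (s i e) (u i e))"
proof -
  note c = tm_consts[OF assms(2)]
  show ?thesis by (rule uf_lift3[OF _ assms(2-4)]) (unfold bijr_def, intro ufi assms c)
qed

lemma uf_sz[ufi]:
  fixes D :: "'i \<Rightarrow> 'a::hst set"
  assumes "tpc D" "tm b D C t" "tm b D C s"
  shows "uf b D C (\<lambda>i e. sz (D i) (t i e) (s i e))"
proof -
  note c = tm_consts[OF assms(2)]
  show ?thesis by (rule uf_lift2[OF _ assms(2-3)]) (unfold sz_def, intro ufi assms c)
qed

lemma bijrD:
  assumes "bijr f x (y::'a::hst)"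
  shows "\<And>p. p \<in> elts f \<Longrightarrow> \<exists>a\<in>elts x. \<exists>b\<in>elts y. p = opair a b"
    and "\<And>a b. rel f a b \<Longrightarrow> a \<in> elts x" and "\<And>a b. rel f a b \<Longrightarrow> b \<in> elts y"
    and "\<And>a. a \<in> elts x \<Longrightarrow> \<exists>b. rel f a b" and "\<And>b. b \<in> elts y \<Longrightarrow> \<exists>a. rel f a b"
    and "\<And>a b c. rel f a b \<Longrightarrow> rel f a c \<Longrightarrow> b = c" and "\<And>a b c. rel f a c \<Longrightarrow> rel f b c \<Longrightarrow> a = b"
proof -
  show p: "\<exists>a\<in>elts x. \<exists>b\<in>elts y. p = opair a b" if "p \<in> elts f" for p
    using assms that unfolding bijr_def by blast
  show 1: "a \<in> elts x" if "rel f a b" for a b using p[of "opair a b"] that unfolding rel_def by fastforce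
  show 2: "b \<in> elts y" if "rel f a b" for a b using p[of "opair a b"] that unfolding rel_def by fastforce
  show "\<exists>b. rel f a b" if "a \<in> elts x" for a using assms that unfolding bijr_def by blast
  show "\<exists>a. rel f a b" if "b \<in> elts y" for b using assms that unfolding bijr_def by blast
  show "b = c" if "rel f a b" "rel f a c" for a b c
  proof -
    have "\<forall>a\<in>elts x. \<exists>b\<in>elts y. rel f a b \<and> (\<forall>c\<in>elts y. rel f a c \<longrightarrow> c = b)"
      using assms unfolding bijr_def by blast
    with 1[OF that(1)] obtain b' where "\<forall>c\<in>elts y. rel f a c \<longrightarrow> c = b'" by blast
    then show ?thesis using 2[OF that(1)] 2[OF that(2)] that by metis
  qed
  show "a = b" if "rel f a c" "rel f b c" for a b c
  proof -
    have "\<forall>b\<in>elts y. \<exists>a\<in>elts x. rel f a b \<and> (\<forall>c\<in>elts x. rel f c b \<longrightarrow> c = a)"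
      using assms unfolding bijr_def by blast
    with 2[OF that(1)] obtain b' where "\<forall>d\<in>elts x. rel f d c \<longrightarrow> d = b'" by blast
    then show ?thesis using 1[OF that(1)] 1[OF that(2)] that by metis
  qed
qed

lemma bijrI:
  assumes "\<And>p. p \<in> elts f \<Longrightarrow> \<exists>a\<in>elts x. \<exists>b\<in>elts y. p = opair a b"
    "\<And>a. a \<in> elts x \<Longrightarrow> \<exists>b. rel f a b" "\<And>b. b \<in> elts y \<Longrightarrow> \<exists>a. rel f a b"
    "\<And>a b c. rel f a b \<Longrightarrow> rel f a c \<Longrightarrow> b = c" "\<And>a b c. rel f a c \<Longrightarrow> rel f b c \<Longrightarrow> a = b"
  shows "bijr f x (y::'a::hst)"
proof -
  have 1: "a \<in> elts x \<and> b \<in> elts y" if "rel f a b" for a b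
    using assms(1)[of "opair a b"] that unfolding rel_def by fastforce
  show ?thesis unfolding bijr_def
  proof (intro conjI ballI)
    fix p assume "p \<in> elts f" then show "\<exists>a\<in>elts x. \<exists>b\<in>elts y. p = opair a b" by (rule assms(1))
  next
    fix a assume "a \<in> elts x"
    then obtain b where "rel f a b" using assms(2) by blast
    then show "\<exists>b\<in>elts y. rel f a b \<and> (\<forall>c\<in>elts y. rel f a c \<longrightarrow> c = b)" using 1 assms(4) by blast
  next
    fix b assume "b \<in> elts y"
    then obtain a where "rel f a b" using assms(3) by blast
    then show "\<exists>a\<in>elts x. rel f a b \<and> (\<forall>c\<in>elts x. rel f c b \<longrightarrow> c = a)" using 1 assms(5) by blast
  qed
qed

lemma is_functionI:
  assumes "\<And>p. p \<in> elts f \<Longrightarrow> \<exists>x y. p = opair x y" "\<And>x y z. rel f x y \<Longrightarrow> rel f x z \<Longrightarrow> y = z"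
  shows "is_function f"
  unfolding is_function_def using assms unfolding rel_def by blast

lemma is_functionD:
  assumes "is_function f" shows "\<And>p. p \<in> elts f \<Longrightarrow> \<exists>x y. p = opair x y"
    "\<And>x y z. rel f x y \<Longrightarrow> rel f x z \<Longrightarrow> y = z"
  using assms unfolding is_function_def rel_def by blast+

lemma is_bijection_iff: "is_bijection f x y \<longleftrightarrow> bijr f x (y::'a::hst)"
proof
  assume *: "is_bijection f x y"
  then have f: "is_function f" and d: "fdom f = elts x" and b: "bij_betw (fapp f) (elts x) (elts y)"
    by (auto simp: is_bijection_def)
  have im: "fapp f a \<in> elts y" if "a \<in> elts x" for a using b that by (auto simp: bij_betw_def)
  have r: "a \<in> elts x \<and> b = fapp f a" if "rel f a b" for a b
    using fapp_eq[OF f that] d fdom_rel[of a f] that by auto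
  have r': "rel f a (fapp f a)" if "a \<in> elts x" for a using fapp_rel[OF f] d that by auto
  show "bijr f x y"
  proof (rule bijrI)
    fix p assume "p \<in> elts f"
    then obtain a b where p: "p = opair a b" "rel f a b" using is_functionD(1)[OF f] unfolding rel_def by blast
    have ax: "a \<in> elts x" and "b = fapp f a" using r[OF p(2)] by blast+
    then have byy: "b \<in> elts y" using im[OF ax] by (simp only:)
    show "\<exists>a\<in>elts x. \<exists>b\<in>elts y. p = opair a b"
      using ax byy p(1) by blast
  next
    fix b assume "b \<in> elts y"
    then have "b \<in> fapp f ` elts x" using bij_betw_imp_surj_on[OF b] by simp
    then show "\<exists>a. rel f a b" using r' by auto
  next
    fix a b c assume ac: "rel f a c" and bc: "rel f b c"
    have "a \<in> elts x" "b \<in> elts x" "fapp f a = fapp f b" using r[OF ac] r[OF bc] by simp_all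
    then show "a = b" using bij_betw_imp_inj_on[OF b] by (simp add: inj_on_def)
  next
    fix a assume "a \<in> elts x" then show "\<exists>b. rel f a b" using r' by blast
  next
    fix a b c assume ab: "rel f a b" and ac: "rel f a c"
    then show "b = c" using r[OF ab] r[OF ac] by simp
  qed
next
  assume *: "bijr f x y"
  note B = bijrD[OF *]
  have fn: "is_function f" 
  proof (rule is_functionI)
    show "\<exists>x y. p = opair x y" if "p \<in> elts f" for p using B(1)[OF that] by blast
  qed (rule B(6))
  have d: "fdom f = elts x" using B(2,4) by (auto simp: fdom_rel)
  have a: "rel f a (fapp f a)" if "a \<in> elts x" for a using fapp_rel[OF fn] d that by auto
  have "inj_on (fapp f) (elts x)"
  proof (rule inj_onI)
    fix u v assume "u \<in> elts x" "v \<in> elts x" "fapp f u = fapp f v"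
    then have "rel f u (fapp f u)" "rel f v (fapp f u)" using a[of u] a[of v] by simp_all
    then show "u = v" by (rule B(7))
  qed
  moreover have "fapp f ` elts x = elts y"
  proof
    show "fapp f ` elts x \<subseteq> elts y" using B(3)[OF a] by auto
    show "elts y \<subseteq> fapp f ` elts x"
    proof
      fix b assume "b \<in> elts y"
      then obtain a where "rel f a b" using B(5) by blast
      then show "b \<in> fapp f ` elts x" using B(2) fapp_eq[OF fn] by (metis imageI)
    qed
  qed
  ultimately show "is_bijection f x y" using fn d by (auto simp: is_bijection_def bij_betw_def)
qed

section \<open>Natural numbers and finite sets in a transitive class\<close>

definition CD :: "'a set \<Rightarrow> (unit \<Rightarrow> 'a) set" where "CD D = {\<lambda>_. a | a. a \<in> D}"

lemma CD_I[ufi]: "a \<in> D \<Longrightarrow> (\<lambda>_. a) \<in> CD D" by (auto simp: CD_def)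
lemma CD_UNIV: "CD UNIV = UNIV" by (auto simp: CD_def fun_eq_iff)

definition rem :: "'a::in_st \<Rightarrow> 'a \<Rightarrow> 'a" where "rem x a = set_of (elts x - {a})"

text \<open>Common ground of three classes: the universe with formulas that may use
  \<open>st\<close>, and the well-founded and the internal sets with formulas that may not.
  \<open>least_N\<close> quantifies only over sets in \<open>D\<close>, which is what limits
  induction to definable predicates.\<close>

locale nat_class =
  fixes b :: bool and D :: "'a::hst set" and N :: 'a
  assumes tpcD[ufi]: "tpc (\<lambda>_::unit. D)"
    and N_in[simp, ufi]: "N \<in> D"
    and sepD: "\<And>x P. x \<in> D \<Longrightarrow> uf b (\<lambda>_::unit. D) (CD D) (\<lambda>_ e. P (e 0)) \<Longrightarrow>
           \<exists>y\<in>D. elts y = {z\<in>elts x. P z}"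
    and zero_N[simp]: "zero \<in> elts N"
    and sc_N[simp]: "n \<in> elts N \<Longrightarrow> sc n \<in> elts N"
    and least_N: "\<And>x. x \<in> D \<Longrightarrow> zero \<in> elts x \<Longrightarrow> (\<forall>n\<in>elts x. sc n \<in> elts x) \<Longrightarrow> elts N \<subseteq> elts x"
begin

abbreviation dD :: "((nat \<Rightarrow> 'a) \<Rightarrow> bool) \<Rightarrow> bool"
  where "dD P \<equiv> uf b (\<lambda>_::unit. D) (CD D) (\<lambda>_. P)"

lemma consts_okD[ufi]: "consts_ok (\<lambda>_. D) (CD D)"
  using N_in unfolding consts_ok_def CD_def by blast

lemma transD: "x \<in> D \<Longrightarrow> y \<in> elts x \<Longrightarrow> y \<in> D" using tpc_trans[OF tpcD] by blast
lemma pairD[simp]: "x \<in> D \<Longrightarrow> y \<in> D \<Longrightarrow> upair x y \<in> D" using tpc_upair[OF tpcD] by blast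
lemma insD[simp]: "x \<in> D \<Longrightarrow> y \<in> D \<Longrightarrow> ins x y \<in> D" using tpc_ins[OF tpcD] by blast
lemma unD[simp]: "x \<in> D \<Longrightarrow> y \<in> D \<Longrightarrow> un x y \<in> D" using tpc_un[OF tpcD] by blast
lemma opairD[simp]: "opair x y \<in> D \<longleftrightarrow> x \<in> D \<and> y \<in> D"
  using tpc_opair[OF tpcD] tpc_opairD[OF tpcD] by blast
lemma N_D[simp]: "n \<in> elts N \<Longrightarrow> n \<in> D" using transD[OF N_in] by blast
lemma zeroD[simp, ufi]: "zero \<in> D" by (rule N_D[OF zero_N])
lemma scD[simp]: "x \<in> D \<Longrightarrow> sc x \<in> D" by (simp add: sc_def)
lemma relD: "f \<in> D \<Longrightarrow> rel f x y \<Longrightarrow> x \<in> D \<and> y \<in> D"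
  unfolding rel_def using transD by fastforce

lemma sepE:
  assumes "x \<in> D" "uf b (\<lambda>_::unit. D) (CD D) (\<lambda>_ e. P (e 0))"
  obtains y where "y \<in> D" "elts y = {z\<in>elts x. P z}"
  using sepD[OF assms] by blast

lemma remD: assumes "x \<in> D" "a \<in> D" shows "rem x a \<in> D" and elts_rem: "elts (rem x a) = elts x - {a}"
proof -
  obtain y where y: "y \<in> D" "elts y = {z\<in>elts x. z \<noteq> a}"
    by (rule sepE[of x "\<lambda>z. z \<noteq> a"]) (intro ufi assms)+
  then have "elts y = elts x - {a}" by auto
  then show "rem x a \<in> D" "elts (rem x a) = elts x - {a}" using y(1) by (auto simp: rem_def set_of_eqI)
qed

text \<open>Auxiliary objects are quantified over \<open>D\<close> inside \<open>P\<close> instead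
  of being generalized by HOL, as only then is \<open>P\<close> a definable predicate of the
  number.\<close>

lemma ind:
  assumes "n \<in> elts N" "dD (\<lambda>e. P (e 0))" "P zero" "\<And>m. m \<in> elts N \<Longrightarrow> P m \<Longrightarrow> P (sc m)"
  shows "P n"
proof -
  obtain y where y: "y \<in> D" "elts y = {z\<in>elts N. P z}" by (rule sepE[OF N_in assms(2)])
  have "elts N \<subseteq> elts y" by (rule least_N) (use y assms in auto)
  then show ?thesis using y assms(1) by auto
qed

lemma N_elts: assumes "n \<in> elts N" "m \<in> elts n" shows "m \<in> elts N"
proof -
  have "elts n \<subseteq> elts N"
    by (rule ind[of n "\<lambda>n. elts n \<subseteq> elts N", OF assms(1)]) (intro ufi, auto)
  then show ?thesis using assms(2) by auto
qed

lemma N_transitive: assumes "n \<in> elts N" "m \<in> elts n" "k \<in> elts m" shows "k \<in> elts n"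
proof -
  have "\<forall>m\<in>elts n. elts m \<subseteq> elts n"
    by (rule ind[of n "\<lambda>n. \<forall>m\<in>elts n. elts m \<subseteq> elts n", OF assms(1)]) (intro ufi, auto)
  then show ?thesis using assms by auto
qed

lemma N_irrefl: assumes "n \<in> elts N" shows "n \<notin> elts n"
proof (rule ind[of n "\<lambda>n. n \<notin> elts n", OF assms])
  fix m assume m: "m \<in> elts N" "m \<notin> elts m"
  have 1: "m \<in> elts (sc m)" by simp
  show "sc m \<notin> elts (sc m)"
  proof
    assume "sc m \<in> elts (sc m)"
    then consider "sc m = m" | "sc m \<in> elts m" by auto
    then show False using m 1 N_transitive[OF m(1), of "sc m" m] by cases simp_all
  qed
qed ((intro ufi), simp)

lemma N_asym: "n \<in> elts N \<Longrightarrow> m \<in> elts n \<Longrightarrow> n \<notin> elts m"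
  using N_transitive[of n m n] N_irrefl by blast

lemma sc_inj: "n \<in> elts N \<Longrightarrow> m \<in> elts N \<Longrightarrow> sc n = sc m \<longleftrightarrow> n = m"
  using N_asym elts_sc by (metis insert_iff)

lemma sc_ne_zero[simp]: "sc n \<noteq> (zero::'a)" "(zero::'a) \<noteq> sc n"
proof -
  have "elts (sc n) \<noteq> elts (zero::'a)" unfolding elts_sc elts_zero by simp
  then show "sc n \<noteq> (zero::'a)" "(zero::'a) \<noteq> sc n" by metis+
qed

lemma N_cases: assumes "n \<in> elts N" obtains "n = zero" | m where "m \<in> elts N" "n = sc m"
proof -
  have "n = zero \<or> (\<exists>m\<in>elts N. n = sc m)"
    by (rule ind[of n "\<lambda>n. n = zero \<or> (\<exists>m\<in>elts N. n = sc m)", OF assms]) (intro ufi, auto)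
  then show thesis using that by blast
qed

lemma N_step: assumes "n \<in> elts N" "m \<in> elts n" shows "sc m \<in> elts n \<or> sc m = n"
proof -
  have "\<forall>m\<in>elts n. sc m \<in> elts n \<or> sc m = n"
    by (rule ind[of n "\<lambda>n. \<forall>m\<in>elts n. sc m \<in> elts n \<or> sc m = n", OF assms(1)]) (intro ufi, auto)
  then show ?thesis using assms by auto
qed

lemma N_linear: assumes n: "n \<in> elts N" "m \<in> elts N" shows "m \<in> elts n \<or> m = n \<or> n \<in> elts m"
proof -
  have mD: "m \<in> D" using assms by simp
  have "zero = k \<or> zero \<in> elts k" if "k \<in> elts N" for k
    by (rule ind[of k "\<lambda>k. zero = k \<or> zero \<in> elts k", OF that]) (intro ufi, auto)
  then have 0: "m = zero \<or> zero \<in> elts m" using assms by auto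
  show ?thesis
  proof (rule ind[of n "\<lambda>n. m \<in> elts n \<or> m = n \<or> n \<in> elts m", OF n(1)])
    fix k assume "k \<in> elts N" "m \<in> elts k \<or> m = k \<or> k \<in> elts m"
    then show "m \<in> elts (sc k) \<or> m = sc k \<or> sc k \<in> elts m" using N_step[OF n(2), of k] by auto
  qed ((intro ufi mD), use 0 in auto)
qed

text \<open>Membership in \<open>sc n\<close> serves as the non-strict order from here on.\<close>

lemma N_le_iff: "n \<in> elts N \<Longrightarrow> m \<in> elts N \<Longrightarrow> m \<in> elts (sc n) \<longleftrightarrow> elts m \<subseteq> elts n"
proof -
  assume n: "n \<in> elts N" "m \<in> elts N"
  show ?thesis
  proof
    assume "m \<in> elts (sc n)" then show "elts m \<subseteq> elts n" using N_transitive[OF n(1), of m] by (auto simp: subset_iff)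
  next
    assume *: "elts m \<subseteq> elts n"
    then have "n \<notin> elts m" using N_irrefl[OF n(1)] by (meson subsetD)
    then show "m \<in> elts (sc n)" using N_linear[OF n] by auto
  qed
qed

section \<open>Finite cardinality without arithmetic\<close>

lemma sz_zero[simp]: "sz D zero zero"
  unfolding sz_def by (rule bexI[of _ zero]) (auto intro!: bijrI simp: rel_def)

lemma sz_zero_iff: "sz D x zero \<longleftrightarrow> x = zero"
proof
  assume "sz D x zero"
  then obtain f where f: "bijr f x zero" unfolding sz_def by blast
  have "elts x = {}"
  proof (rule equals0I)
    fix a assume "a \<in> elts x"
    then obtain c where "rel f a c" using bijrD(4)[OF f] by blast
    then show False using bijrD(3)[OF f, of a c] by simp
  qed
  then show "x = zero" by (simp add: eq_zero_iff)
qed simp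

lemma sz_ins:
  assumes "sz D x n" "a \<in> D" "a \<notin> elts x" "n \<in> elts N"
  shows "sz D (ins a x) (sc n)"
proof -
  obtain f where f: "f \<in> D" "bijr f x n" using assms by (auto simp: sz_def)
  note B = bijrD[OF f(2)]
  have "bijr (ins (opair a n) f) (ins a x) (sc n)"
  proof (rule bijrI)
    fix p assume "p \<in> elts (ins (opair a n) f)"
    then show "\<exists>u\<in>elts (ins a x). \<exists>v\<in>elts (sc n). p = opair u v" using B(1) by fastforce
  next
    fix u assume "u \<in> elts (ins a x)" then show "\<exists>v. rel (ins (opair a n) f) u v" using B(4)[of u] by (auto simp: rel_ins)
  next
    fix v assume "v \<in> elts (sc n)" then show "\<exists>u. rel (ins (opair a n) f) u v" using B(5)[of v] by (auto simp: rel_ins)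
  next
    fix u v w assume "rel (ins (opair a n) f) u v" "rel (ins (opair a n) f) u w"
    then show "v = w" unfolding rel_ins using B(6) B(2) assms(3) by blast
  next
    fix u v w assume "rel (ins (opair a n) f) u w" "rel (ins (opair a n) f) v w"
    then show "u = v" unfolding rel_ins using B(7) B(3) N_irrefl[OF assms(4)] by blast
  qed
  then show ?thesis unfolding sz_def using f assms by (intro bexI[of _ "ins (opair a n) f"]) auto
qed

lemma sz_sc_ex: "sz D x (sc n) \<Longrightarrow> \<exists>a. a \<in> elts x"
  unfolding sz_def using bijrD(2,5) by (metis elts_sc insertI1)

text \<open>If \<open>a\<close> has the last index \<open>n\<close>, its pair is dropped. Otherwise
  the element \<open>c\<close> that has index \<open>n\<close> takes over the index \<open>m\<close>
  of \<open>a\<close>.\<close>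

lemma sz_rem:
  assumes "sz D x (sc n)" "x \<in> D" "a \<in> elts x" "n \<in> elts N"
  shows "sz D (rem x a) n"
proof -
  obtain f where f: "f \<in> D" "bijr f x (sc n)" using assms by (auto simp: sz_def)
  note B = bijrD[OF f(2)]
  have aD: "a \<in> D" using assms transD by blast
  note er = elts_rem[OF assms(2) aD]
  obtain m where m: "rel f a m" using B(4) assms(3) by blast
  obtain c where c: "rel f c n" using B(5)[of n] by auto
  note D = relD[OF f(1) m] relD[OF f(1) c]
  show ?thesis
  proof (cases "m = n")
    case True
    obtain g where g: "g \<in> D" "elts g = {p\<in>elts f. p \<noteq> opair a n}"
      by (rule sepE[of f "\<lambda>p. p \<noteq> opair a n"]) (intro ufi f D aD | simp add: D aD)+
    have r: "rel g x y \<longleftrightarrow> rel f x y \<and> x \<noteq> a" for x y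
      using g(2) m True B(6) by (auto simp: rel_def)
    have "bijr g (rem x a) n"
    proof (rule bijrI)
      fix p assume "p \<in> elts g"
      then obtain u v where "p = opair u v" "rel g u v" using g(2) B(1) by (fastforce simp: rel_def)
      moreover from this have "u \<in> elts x" "u \<noteq> a" "v \<in> elts (sc n)" "v \<noteq> n"
        using B(2,3) r B(7) m True by blast+
      ultimately show "\<exists>u\<in>elts (rem x a). \<exists>v\<in>elts n. p = opair u v" using er by auto
    next
      fix v assume "v \<in> elts n"
      then obtain u where "rel f u v" using B(5) by fastforce
      moreover have "u \<noteq> a" using B(6)[of u v n] calculation m True N_irrefl[OF assms(4)] \<open>v \<in> elts n\<close> by blast
      ultimately show "\<exists>u. rel g u v" using r by blast
    qed (use B er r in auto)
    then show ?thesis unfolding sz_def using g(1) by blast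
  next
    case False
    have mn: "m \<in> elts n" using B(3)[OF m] False by simp
    have ca: "c \<noteq> a" using B(6) m c False by blast
    obtain g where g: "g \<in> D" "elts g = {p\<in>elts f. p \<noteq> opair a m \<and> p \<noteq> opair c n}"
      by (rule sepE[of f "\<lambda>p. p \<noteq> opair a m \<and> p \<noteq> opair c n"]) (intro ufi f D aD | simp add: D aD)+
    have r0: "rel g x y \<longleftrightarrow> rel f x y \<and> x \<noteq> a \<and> x \<noteq> c" for x y
      using g(2) m c B(6) by (auto simp: rel_def)
    let ?h = "ins (opair c m) g"
    have r: "rel ?h x y \<longleftrightarrow> (if x = c then y = m else rel f x y \<and> x \<noteq> a)" for x y
      using r0 ca by (auto simp: rel_ins)
    have "bijr ?h (rem x a) n"
    proof (rule bijrI)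
      fix p assume "p \<in> elts ?h"
      then obtain u v where p: "p = opair u v" "rel ?h u v" using g(2) B(1) by (fastforce simp: rel_def)
      have "u \<in> elts x" "u \<noteq> a" "v \<in> elts n"
        using p(2) r[of u v] B(2)[of u v] B(2)[OF c] B(3)[of u v] mn ca B(7)[OF c, of u] by (auto split: if_splits)
      then show "\<exists>u\<in>elts (rem x a). \<exists>v\<in>elts n. p = opair u v" using er p(1) by auto
    next
      fix u assume "u \<in> elts (rem x a)"
      then show "\<exists>v. rel ?h u v" using er r B(4)[of u] by (cases "u = c") auto
    next
      fix v assume v: "v \<in> elts n"
      show "\<exists>u. rel ?h u v"
      proof (cases "v = m")
        case True then show ?thesis using r[of c v] by auto
      next
        case False
        obtain u where u: "rel f u v" using B(5)[of v] v by auto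
        have "u \<noteq> a" "u \<noteq> c" using B(6)[OF u] m c False v N_irrefl[OF assms(4)] by blast+
        then show ?thesis using r[of u v] u by auto
      qed
    next
      fix u v w assume "rel ?h u v" "rel ?h u w"
      then show "v = w" using r B(6) by (auto split: if_splits)
    next
      fix u v w assume "rel ?h u w" "rel ?h v w"
      then show "u = v" using r B(7) m by (auto split: if_splits)
    qed
    then show ?thesis unfolding sz_def using g(1) D by (intro bexI[of _ ?h]) auto
  qed
qed

lemma ins_rem: "x \<in> D \<Longrightarrow> a \<in> elts x \<Longrightarrow> ins a (rem x a) = x"
  using elts_rem[of x a] transD[of x a] by (intro Extensionality) auto

lemma sz_unique:
  assumes "n \<in> elts N" "m \<in> elts N" "x \<in> D" "sz D x n" "sz D x m" shows "n = m"
proof -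
  have "\<forall>x\<in>D. \<forall>m\<in>elts N. sz D x n \<longrightarrow> sz D x m \<longrightarrow> n = m"
  proof (rule ind[of n "\<lambda>n. \<forall>x\<in>D. \<forall>m\<in>elts N. sz D x n \<longrightarrow> sz D x m \<longrightarrow> n = m", OF assms(1)])
    show "\<forall>x\<in>D. \<forall>m\<in>elts N. sz D x zero \<longrightarrow> sz D x m \<longrightarrow> zero = m"
    proof (intro ballI impI)
      fix x m assume "x \<in> D" "m \<in> elts N" "sz D x zero" "sz D x m"
      then show "zero = m" using sz_sc_ex sz_zero_iff by (metis N_cases elts_zero empty_iff)
    qed
  next
    fix k assume k: "k \<in> elts N" and IH: "\<forall>x\<in>D. \<forall>m\<in>elts N. sz D x k \<longrightarrow> sz D x m \<longrightarrow> k = m"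
    show "\<forall>x\<in>D. \<forall>m\<in>elts N. sz D x (sc k) \<longrightarrow> sz D x m \<longrightarrow> sc k = m"
    proof (intro ballI impI)
      fix x m assume x: "x \<in> D" "m \<in> elts N" "sz D x (sc k)" "sz D x m"
      obtain a where a: "a \<in> elts x" using sz_sc_ex x by blast
      obtain j where j: "j \<in> elts N" "m = sc j"
        using x a sz_zero_iff by (metis N_cases elts_zero empty_iff)
      have "k = j" using IH sz_rem[OF x(3,1) a k] sz_rem[OF _ x(1) a j(1)] x j remD(1)[OF x(1)] transD[OF x(1) a] by blast
      then show "sc k = m" using j by simp
    qed
  qed (intro ufi)
  then show ?thesis using assms by blast
qed

text \<open>A proper subset misses some \<open>a\<close> and so lies in \<open>rem x a\<close>,
  where induction applies; this is what makes its size strictly smaller.\<close>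

lemma sz_subset:
  assumes "n \<in> elts N" "x \<in> D" "sz D x n" "y \<in> D" "elts y \<subseteq> elts x"
  shows "\<exists>m\<in>elts N. sz D y m \<and> (y = x \<or> m \<in> elts n)"
proof -
  have "\<forall>x\<in>D. \<forall>y\<in>D. sz D x n \<longrightarrow> elts y \<subseteq> elts x \<longrightarrow> (\<exists>m\<in>elts N. sz D y m \<and> (y = x \<or> m \<in> elts n))"
  proof (rule ind[of n "\<lambda>n. \<forall>x\<in>D. \<forall>y\<in>D. sz D x n \<longrightarrow> elts y \<subseteq> elts x \<longrightarrow>
       (\<exists>m\<in>elts N. sz D y m \<and> (y = x \<or> m \<in> elts n))", OF assms(1)])
    show "\<forall>x\<in>D. \<forall>y\<in>D. sz D x zero \<longrightarrow> elts y \<subseteq> elts x \<longrightarrow> (\<exists>m\<in>elts N. sz D y m \<and> (y = x \<or> m \<in> elts zero))"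
    proof (intro ballI impI)
      fix x y assume "sz D x zero" "elts y \<subseteq> elts x"
      then have "x = zero" "y = zero" by (auto simp: sz_zero_iff eq_zero_iff[symmetric])
      then show "\<exists>m\<in>elts N. sz D y m \<and> (y = x \<or> m \<in> elts zero)"
        by (intro bexI[of _ zero]) auto
    qed
  next
    fix k assume k: "k \<in> elts N" and IH: "\<forall>x\<in>D. \<forall>y\<in>D. sz D x k \<longrightarrow> elts y \<subseteq> elts x \<longrightarrow>
       (\<exists>m\<in>elts N. sz D y m \<and> (y = x \<or> m \<in> elts k))"
    show "\<forall>x\<in>D. \<forall>y\<in>D. sz D x (sc k) \<longrightarrow> elts y \<subseteq> elts x \<longrightarrow> (\<exists>m\<in>elts N. sz D y m \<and> (y = x \<or> m \<in> elts (sc k)))"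
    proof (intro ballI impI)
      fix x y assume x: "x \<in> D" "y \<in> D" "sz D x (sc k)" "elts y \<subseteq> elts x"
      show "\<exists>m\<in>elts N. sz D y m \<and> (y = x \<or> m \<in> elts (sc k))"
      proof (cases "y = x")
        case True then show ?thesis using x(3) k by (intro bexI[of _ "sc k"]) auto
      next
        case False
        then obtain a where a: "a \<in> elts x" "a \<notin> elts y" using x(4) elts_eq_iff by blast
        have aD: "a \<in> D" using transD x(1) a(1) by blast
        have "elts y \<subseteq> elts (rem x a)" using elts_rem[OF x(1) aD] x(4) a by auto
        moreover have "sz D (rem x a) k" "rem x a \<in> D" using sz_rem[OF x(3,1) a(1) k] remD(1)[OF x(1) aD] by auto
        ultimately obtain m where "m \<in> elts N" "sz D y m" "y = rem x a \<or> m \<in> elts k" using IH x by blast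
        moreover from this have "m = k \<or> m \<in> elts k"
          using sz_unique \<open>sz D (rem x a) k\<close> k x(2) by blast
        ultimately show ?thesis by auto
      qed
    qed
  qed (intro ufi)
  then show ?thesis using assms by blast
qed

lemma sz_eq_subset: "n \<in> elts N \<Longrightarrow> x \<in> D \<Longrightarrow> y \<in> D \<Longrightarrow> sz D x n \<Longrightarrow> sz D y n \<Longrightarrow> elts y \<subseteq> elts x \<Longrightarrow> y = x"
  using sz_subset[of n x y] sz_unique[of _ n y] N_irrefl by blast

lemma sz_self: "n \<in> elts N \<Longrightarrow> sz D n n"
proof -
  assume n: "n \<in> elts N"
  show ?thesis
  proof (rule ind[of n "\<lambda>n. sz D n n", OF n])
    show "sz D (sc m) (sc m)" if "m \<in> elts N" "sz D m m" for m
      using sz_ins[OF that(2) _ _ that(1), of m] that N_irrefl by (auto simp: sc_def[of m])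
  qed (intro ufi, simp)
qed

lemma sz_sub_ex:
  assumes "n \<in> elts N" "m \<in> elts (sc n)" "x \<in> D" "sz D x n"
  shows "\<exists>y\<in>D. elts y \<subseteq> elts x \<and> sz D y m"
proof -
  have "\<forall>x\<in>D. \<forall>m\<in>elts (sc n). sz D x n \<longrightarrow> (\<exists>y\<in>D. elts y \<subseteq> elts x \<and> sz D y m)"
  proof (rule ind[of n "\<lambda>n. \<forall>x\<in>D. \<forall>m\<in>elts (sc n). sz D x n \<longrightarrow> (\<exists>y\<in>D. elts y \<subseteq> elts x \<and> sz D y m)", OF assms(1)])
    fix k assume k: "k \<in> elts N" and IH: "\<forall>x\<in>D. \<forall>m\<in>elts (sc k). sz D x k \<longrightarrow> (\<exists>y\<in>D. elts y \<subseteq> elts x \<and> sz D y m)"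
    show "\<forall>x\<in>D. \<forall>m\<in>elts (sc (sc k)). sz D x (sc k) \<longrightarrow> (\<exists>y\<in>D. elts y \<subseteq> elts x \<and> sz D y m)"
    proof (intro ballI impI)
      fix x m assume x: "x \<in> D" "m \<in> elts (sc (sc k))" "sz D x (sc k)"
      show "\<exists>y\<in>D. elts y \<subseteq> elts x \<and> sz D y m"
      proof (cases "m = sc k")
        case False
        then have m: "m \<in> elts (sc k)" using x(2) by simp
        obtain a where a: "a \<in> elts x" using sz_sc_ex x(3) by blast
        have aD: "a \<in> D" using transD x(1) a by blast
        obtain y where "y \<in> D" "elts y \<subseteq> elts (rem x a)" "sz D y m"
          using IH m sz_rem[OF x(3,1) a k] remD(1)[OF x(1) aD] by blast
        then show ?thesis using elts_rem[OF x(1) aD] by blast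
      qed (use x in blast)
    qed
  next
    show "\<forall>x\<in>D. \<forall>m\<in>elts (sc zero). sz D x zero \<longrightarrow> (\<exists>y\<in>D. elts y \<subseteq> elts x \<and> sz D y m)"
      unfolding elts_sc elts_zero by blast
  qed (intro ufi)
  then show ?thesis using assms by blast
qed

text \<open>Composing the bijections would first require a set in \<open>D\<close> from which to
  separate the composite. Removing one matched pair at a time gets by with Separation from given
  sets.\<close>

lemma sz_bij:
  assumes "n \<in> elts N" "x \<in> D" "y \<in> D" "g \<in> D" "bijr g x y" "sz D x n"
  shows "sz D y n"
proof -
  have "\<forall>x\<in>D. \<forall>y\<in>D. \<forall>g\<in>D. bijr g x y \<longrightarrow> sz D x n \<longrightarrow> sz D y n"
  proof (rule ind[of n "\<lambda>n. \<forall>x\<in>D. \<forall>y\<in>D. \<forall>g\<in>D. bijr g x y \<longrightarrow> sz D x n \<longrightarrow> sz D y n", OF assms(1)])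
    show "\<forall>x\<in>D. \<forall>y\<in>D. \<forall>g\<in>D. bijr g x y \<longrightarrow> sz D x zero \<longrightarrow> sz D y zero"
    proof (intro ballI impI)
      fix x y g assume g: "bijr g x y" "sz D x zero"
      then have "elts x = {}" by (simp add: sz_zero_iff)
      then have "elts y = {}" using bijrD(2,5)[OF g(1)] by blast
      then show "sz D y zero" by (simp add: sz_zero_iff eq_zero_iff)
    qed
  next
    fix k assume k: "k \<in> elts N" and IH: "\<forall>x\<in>D. \<forall>y\<in>D. \<forall>g\<in>D. bijr g x y \<longrightarrow> sz D x k \<longrightarrow> sz D y k"
    show "\<forall>x\<in>D. \<forall>y\<in>D. \<forall>g\<in>D. bijr g x y \<longrightarrow> sz D x (sc k) \<longrightarrow> sz D y (sc k)"
    proof (intro ballI impI)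
      fix x y g assume x: "x \<in> D" "y \<in> D" "g \<in> D" "bijr g x y" "sz D x (sc k)"
      note B = bijrD[OF x(4)]
      obtain a where a: "a \<in> elts x" using sz_sc_ex x by blast
      obtain c where c: "rel g a c" using B(4) a by blast
      have cy: "c \<in> elts y" using B(3) c by blast
      have D: "a \<in> D" "c \<in> D" "opair a c \<in> D" using relD[OF x(3) c] by auto
      note er = elts_rem[OF x(1) D(1)] elts_rem[OF x(2) D(2)] elts_rem[OF x(3) D(3)]
      have r: "rel (rem g (opair a c)) u v \<longleftrightarrow> rel g u v \<and> u \<noteq> a" for u v
        using B(6) c by (auto simp: rel_def er)
      have "bijr (rem g (opair a c)) (rem x a) (rem y c)"
      proof (rule bijrI)
        fix p assume p: "p \<in> elts (rem g (opair a c))"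
        then obtain u v where uv: "p = opair u v" "rel (rem g (opair a c)) u v"
          using B(1) by (fastforce simp: rel_def er)
        then have g: "rel g u v" "u \<noteq> a" using r by blast+
        then have "u \<in> elts x" "v \<in> elts y" using B(2,3) by blast+
        moreover have "v \<noteq> c" using B(7)[OF c, of u] g by blast
        moreover note g(2)
        ultimately have "u \<in> elts x" "v \<in> elts y" "u \<noteq> a" "v \<noteq> c" by blast+
        then show "\<exists>u\<in>elts (rem x a). \<exists>v\<in>elts (rem y c). p = opair u v" using uv er by auto
      next
        fix v assume "v \<in> elts (rem y c)"
        then obtain u where "rel g u v" "v \<noteq> c" using B(5) er by blast
        then show "\<exists>u. rel (rem g (opair a c)) u v" using r B(6) c by blast
      next
        fix u assume "u \<in> elts (rem x a)"
        then show "\<exists>v. rel (rem g (opair a c)) u v" using er r B(4) by auto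
      next
        fix u v w assume "rel (rem g (opair a c)) u v" "rel (rem g (opair a c)) u w"
        then show "v = w" unfolding r using B(6) by blast
      next
        fix u v w assume "rel (rem g (opair a c)) u w" "rel (rem g (opair a c)) v w"
        then show "u = v" unfolding r using B(7) by blast
      qed
      then have "sz D (rem y c) k" using IH sz_rem[OF x(5,1) a k] remD(1) x D by blast
      then have "sz D (ins c (rem y c)) (sc k)" by (rule sz_ins) (use D er k in auto)
      then show "sz D y (sc k)" using ins_rem[OF x(2) cy] by simp
    qed
  qed (intro ufi)
  then show ?thesis using assms by blast
qed

lemma sz_add_step:
  assumes "n \<in> elts N" "k \<in> elts N" "\<forall>x\<in>D. \<forall>y\<in>D. sz D x n \<longrightarrow> sz D y m \<longrightarrow> elts x \<inter> elts y = {} \<longrightarrow> sz D (un x y) k" "m \<in> elts N"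
  shows "\<forall>x\<in>D. \<forall>y\<in>D. sz D x n \<longrightarrow> sz D y (sc m) \<longrightarrow> elts x \<inter> elts y = {} \<longrightarrow> sz D (un x y) (sc k)"
proof (intro ballI impI)
  fix x y assume x: "x \<in> D" "y \<in> D" "sz D x n" "sz D y (sc m)" "elts x \<inter> elts y = {}"
  obtain a where a: "a \<in> elts y" using sz_sc_ex x by blast
  have aD: "a \<in> D" using transD x a by blast
  note er = elts_rem[OF x(2) aD]
  have "sz D (un x (rem y a)) k"
    using assms(3) x sz_rem[OF x(4,2) a assms(4)] remD(1)[OF x(2) aD] er by blast
  then have "sz D (ins a (un x (rem y a))) (sc k)" by (rule sz_ins) (use a x er aD assms in auto)
  moreover have "ins a (un x (rem y a)) = un x y" using er a by (intro Extensionality) auto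
  ultimately show "sz D (un x y) (sc k)" by simp
qed

text \<open>The number \<open>k\<close> is the sum of \<open>n\<close> and \<open>m\<close>,
  produced by induction on \<open>m\<close> and uniform in the two disjoint sets; no addition
  function is defined anywhere.\<close>

lemma sz_add:
  assumes "n \<in> elts N" "m \<in> elts N"
  shows "\<exists>k\<in>elts N. \<forall>x\<in>D. \<forall>y\<in>D. sz D x n \<longrightarrow> sz D y m \<longrightarrow> elts x \<inter> elts y = {} \<longrightarrow> sz D (un x y) k"
proof -
  have nD: "n \<in> D" using assms by simp
  \<comment> \<open>Disjointness is restated with a bounded quantifier so that the definability
    rules recognize it.\<close>
  have e: "elts x \<inter> elts y = {} \<longleftrightarrow> (\<forall>z\<in>elts x. z \<notin> elts y)" for x y :: 'a by auto
  show ?thesis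
  proof (rule ind[of m "\<lambda>m. \<exists>k\<in>elts N. \<forall>x\<in>D. \<forall>y\<in>D. sz D x n \<longrightarrow> sz D y m \<longrightarrow> elts x \<inter> elts y = {} \<longrightarrow> sz D (un x y) k", OF assms(2)])
    have "un x zero = x" for x :: 'a by (intro Extensionality) auto
    then show "\<exists>k\<in>elts N. \<forall>x\<in>D. \<forall>y\<in>D. sz D x n \<longrightarrow> sz D y zero \<longrightarrow> elts x \<inter> elts y = {} \<longrightarrow> sz D (un x y) k"
      using assms(1) by (intro bexI[of _ n]) (auto simp: sz_zero_iff)
  next
    fix m assume m: "m \<in> elts N" and "\<exists>k\<in>elts N. \<forall>x\<in>D. \<forall>y\<in>D. sz D x n \<longrightarrow> sz D y m \<longrightarrow> elts x \<inter> elts y = {} \<longrightarrow> sz D (un x y) k"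
    then obtain k where "k \<in> elts N" "\<forall>x\<in>D. \<forall>y\<in>D. sz D x n \<longrightarrow> sz D y m \<longrightarrow> elts x \<inter> elts y = {} \<longrightarrow> sz D (un x y) k" by blast
    then show "\<exists>k\<in>elts N. \<forall>x\<in>D. \<forall>y\<in>D. sz D x n \<longrightarrow> sz D y (sc m) \<longrightarrow> elts x \<inter> elts y = {} \<longrightarrow> sz D (un x y) k"
      by (intro bexI[of _ "sc k"] sz_add_step[OF assms(1)] m) simp_all
  qed (unfold e, intro ufi nD)
qed

lemma diffD: assumes "x \<in> D" "y \<in> D" obtains z where "z \<in> D" "elts z = elts x - elts y"
proof -
  obtain z where "z \<in> D" "elts z = {v\<in>elts x. v \<notin> elts y}"
    by (rule sepE[of x "\<lambda>v. v \<notin> elts y"]) (intro ufi assms)+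
  moreover from this have "elts z = elts x - elts y" by auto
  ultimately show thesis using that by blast
qed

lemma sz_un:
  assumes "n \<in> elts N" "m \<in> elts N" "x \<in> D" "y \<in> D" "sz D x n" "sz D y m"
  shows "\<exists>k\<in>elts N. sz D (un x y) k"
proof -
  obtain z where z: "z \<in> D" "elts z = elts y - elts x" using diffD assms by blast
  obtain j where j: "j \<in> elts N" "sz D z j" using sz_subset[OF assms(2,4,6) z(1)] z(2) by auto
  have "un x y = un x z" using z by (intro Extensionality) auto
  moreover have "elts x \<inter> elts z = {}" using z by auto
  ultimately show ?thesis using sz_add[OF assms(1) j(1)] assms z j by metis
qed

end

section \<open>The collapse of the standard universe\<close>

lemma is_inductive_iff: "is_inductive (x::'a::hst) \<longleftrightarrow> zero \<in> elts x \<and> (\<forall>y\<in>elts x. sc y \<in> elts x)"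
proof -
  have "z = sc y" if "elts z = insert y (elts y)" for z y :: 'a
    using that by (metis elts_sc elts_eq_iff)
  then show ?thesis unfolding is_inductive_def by (metis eq_zero_iff elts_sc)
qed

lemma omega_props:
  shows "is_inductive (omega::'a::hst)" and "is_inductive x \<Longrightarrow> elts (omega::'a) \<subseteq> elts x"
proof -
  obtain I :: 'a where I: "is_inductive I" using Infinity by blast
  have "small {n\<in>elts I. \<forall>x. zero \<in> elts x \<and> (\<forall>y\<in>elts x. sc y \<in> elts x) \<longrightarrow> n \<in> elts x}"
    by (rule small_sepU[OF small_elts]) (intro ufi)
  then obtain w where w: "elts w = {n\<in>elts I. \<forall>x. is_inductive x \<longrightarrow> n \<in> elts x}"
    unfolding small_def is_inductive_iff by blast
  have *: "is_inductive w \<and> (\<forall>x. is_inductive x \<longrightarrow> elts w \<subseteq> elts x)"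
  proof (intro conjI)
    show "is_inductive w" using I unfolding is_inductive_iff w by blast
  qed (use w in auto)
  have "omega = w" unfolding omega_def
  proof (rule the_equality, rule *)
    fix v :: 'a assume "is_inductive v \<and> (\<forall>x. is_inductive x \<longrightarrow> elts v \<subseteq> elts x)"
    then show "v = w" using * Extensionality[of v w] by blast
  qed
  then show "is_inductive (omega::'a)" "is_inductive x \<Longrightarrow> elts (omega::'a) \<subseteq> elts x" using * by auto
qed

text \<open>The external instance, for inductions over the true natural numbers whose predicates
  mention \<open>st\<close>. The rewrite makes its parameters agree with those of
  \<open>dU\<close>.\<close>

interpretation U: nat_class True "UNIV :: 'a::hst set" omega
  rewrites "CD (UNIV :: 'a set) = UNIV"
proof -
  show "nat_class True (UNIV :: 'a set) omega"
  proof
    fix x :: 'a and P :: "'a \<Rightarrow> bool"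
    assume "uf True (\<lambda>_::unit. UNIV) (CD UNIV) (\<lambda>_ e. P (e 0))"
    then show "\<exists>y\<in>UNIV. elts y = {z\<in>elts x. P z}"
      using small_sepU[OF small_elts, of P x] unfolding CD_UNIV small_def by simp
  qed (use omega_props in \<open>auto simp: is_inductive_iff tpc_UNIV\<close>)
qed (rule CD_UNIV)

section \<open>Standard sets and Transfer\<close>

lemma st_iff: "st x \<longleftrightarrow> x \<in> Standard" by (simp add: Standard_def)

lemmas ZFC_conj = ZFC_standard[unfolded ZFC_def Let_def]
lemmas ZFC_parts =
  ZFC_conj[THEN conjunct1]
  ZFC_conj[THEN conjunct2, THEN conjunct1]
  ZFC_conj[THEN conjunct2, THEN conjunct2, THEN conjunct1]
  ZFC_conj[THEN conjunct2, THEN conjunct2, THEN conjunct2, THEN conjunct1]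
  ZFC_conj[THEN conjunct2, THEN conjunct2, THEN conjunct2, THEN conjunct2, THEN conjunct1]
  ZFC_conj[THEN conjunct2, THEN conjunct2, THEN conjunct2, THEN conjunct2, THEN conjunct2, THEN conjunct1]
  ZFC_conj[THEN conjunct2, THEN conjunct2, THEN conjunct2, THEN conjunct2, THEN conjunct2, THEN conjunct2, THEN conjunct1]

lemma std_ext: "st (x::'a::hst) \<Longrightarrow> st y \<Longrightarrow> elts x \<inter> Standard = elts y \<inter> Standard \<Longrightarrow> x = y"
  using ZFC_parts(1) unfolding st_iff by blast

lemma std_pair_ex: "st (x::'a::hst) \<Longrightarrow> st y \<Longrightarrow> \<exists>z. st z \<and> elts z \<inter> Standard = {x, y}"
  using ZFC_parts(2) unfolding st_iff by blast

lemma std_union_ex: "st (x::'a::hst) \<Longrightarrow> \<exists>y. st y \<and> elts y \<inter> Standard = (\<Union>z\<in>elts x \<inter> Standard. elts z \<inter> Standard)"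
  using ZFC_parts(3) unfolding st_iff by blast

lemma std_reg: "st (x::'a::hst) \<Longrightarrow> elts x \<inter> Standard \<noteq> {} \<Longrightarrow>
    \<exists>y\<in>elts x \<inter> Standard. (elts y \<inter> Standard) \<inter> (elts x \<inter> Standard) = {}"
  using ZFC_parts(6) unfolding st_iff by blast

lemma std_zero_ex: "\<exists>z::'a::hst. st z \<and> elts z \<inter> Standard = {}"
  using ZFC_parts(5) unfolding st_iff by blast

lemma std_internal: "st (x::'a::hst) \<Longrightarrow> x \<in> Internal"
  using std_pair_ex[of x x] unfolding Internal_def by auto

lemma internal_trans: "x \<in> Internal \<Longrightarrow> y \<in> elts x \<Longrightarrow> y \<in> (Internal :: 'a::hst set)"
  using Transitivity_Internal by blast

text \<open>Transfer as a pair of structures, \<open>False\<close> for the standard and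
  \<open>True\<close> for the internal sets; the constants in \<open>CS\<close> are standard and
  denote themselves in both.\<close>

definition SI :: "bool \<Rightarrow> 'a::in_st set" where "SI i = (if i then Internal else Standard)"
definition CS :: "(bool \<Rightarrow> 'a::in_st) set" where "CS = {\<lambda>_. a | a. st a}"

lemma std_zero_aux: "\<exists>z::'a::hst. st z" using std_zero_ex by blast

lemma CS_I[ufi]: "st a \<Longrightarrow> (\<lambda>_. a) \<in> CS" by (auto simp: CS_def)
lemma consts_ok_CS[ufi]: "consts_ok SI (CS :: (bool \<Rightarrow> 'a::hst) set)"
  using std_zero_aux std_internal by (auto simp: consts_ok_def CS_def SI_def st_iff)

lemma transfer:
  assumes "uf False SI CS P" "st (a::'a::hst)"
  shows "P False (\<lambda>_. a) \<longleftrightarrow> P True (\<lambda>_. a)"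
proof -
  obtain p c where p: "in_formula p" "range c \<subseteq> CS"
    "\<And>i e. range e \<subseteq> SI i \<Longrightarrow> P i e = sat (SI i) p (mix e (\<lambda>n. c n i))"
    using assms(1) unfolding uf_def by blast
  have "c n \<in> CS" for n using p(2) by auto
  then have c: "c n True = c n False" "st (c n False)" for n by (auto simp: CS_def) (metis, metis)
  have "range (mix (\<lambda>_. a) (\<lambda>n. c n False)) \<subseteq> Standard" using c assms(2) by (auto simp: mix_def st_iff)
  from Transfer[OF p(1) this] show ?thesis
    using p(3)[of "\<lambda>_. a" False] p(3)[of "\<lambda>_. a" True] assms(2) std_internal[OF assms(2)] c(1)
    by (simp add: SI_def st_iff)
qed

lemma transfer_ball:
  fixes P :: "bool \<Rightarrow> 'a::hst \<Rightarrow> bool"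
  assumes "uf False SI CS (\<lambda>i e. P i (e 0))"
  shows "(\<forall>x. st x \<longrightarrow> P False x) \<longleftrightarrow> (\<forall>x\<in>Internal. P True x)"
proof -
  have u: "uf False SI CS (\<lambda>i (e::nat \<Rightarrow> 'a). \<forall>x\<in>SI i. P i x)" by (intro ufi assms)
  obtain z :: 'a where "st z" using std_zero_aux by blast
  from transfer[OF u this] show ?thesis by (simp add: SI_def st_iff Ball_def)
qed

text \<open>ZFC in \<open>Standard\<close> gives a set that is the pair as far as standard elements
  can tell. Transfer extends this to internal elements, and a standard set has no others. Unions and
  the empty set follow the same pattern.\<close>

lemma std_upair[simp]: assumes "st (x::'a::hst)" "st y" shows "st (upair x y)"
proof -
  obtain z where z: "st z" "elts z \<inter> Standard = {x, y}" using std_pair_ex assms by blast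
  have "uf False SI CS (\<lambda>i e. e 0 \<in> elts z \<longleftrightarrow> e 0 = x \<or> e 0 = y)" by (intro ufi assms z)
  from transfer_ball[where P = "\<lambda>_ u. u \<in> elts z \<longleftrightarrow> u = x \<or> u = y", OF this]
  have "\<forall>u\<in>Internal. u \<in> elts z \<longleftrightarrow> u = x \<or> u = y" using z by (auto simp: st_iff)
  then have "elts z = {x, y}" using std_internal assms internal_trans[OF std_internal[OF z(1)]] by blast
  then show ?thesis using z by (simp add: upair_def set_of_eqI)
qed

lemma std_Union: assumes "st (x::'a::hst)" shows "\<exists>y. st y \<and> elts y = (\<Union>z\<in>elts x. elts z)"
proof -
  obtain y where y: "st y" "elts y \<inter> Standard = (\<Union>z\<in>elts x \<inter> Standard. elts z \<inter> Standard)"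
    using std_union_ex assms by blast
  have "uf False SI CS (\<lambda>i e. e 0 \<in> elts y \<longleftrightarrow> (\<exists>z\<in>SI i. z \<in> elts x \<and> e 0 \<in> elts z))" by (intro ufi assms y)
  from transfer_ball[where P = "\<lambda>i u. u \<in> elts y \<longleftrightarrow> (\<exists>z\<in>SI i. z \<in> elts x \<and> u \<in> elts z)", OF this]
  have "\<forall>u\<in>Internal. u \<in> elts y \<longleftrightarrow> (\<exists>z\<in>Internal. z \<in> elts x \<and> u \<in> elts z)"
    using y unfolding SI_def st_iff by auto
  then have *: "u \<in> elts y \<longleftrightarrow> (\<exists>z\<in>Internal. z \<in> elts x \<and> u \<in> elts z)" if "u \<in> Internal" for u using that by blast
  have "u \<in> elts y \<longleftrightarrow> (\<exists>z\<in>elts x. u \<in> elts z)" for u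
    using *[of u] internal_trans[OF std_internal[OF y(1)], of u] internal_trans[OF std_internal[OF assms]] internal_trans[of _ u]
    by metis
  then have "elts y = (\<Union>z\<in>elts x. elts z)" by blast
  then show ?thesis using y by blast
qed

lemma std_un[simp]: assumes "st (x::'a::hst)" "st y" shows "st (un x y)"
proof -
  obtain z where "st z" "elts z = (\<Union>z\<in>elts (upair x y). elts z)" using std_Union[OF std_upair[OF assms]] by blast
  moreover from this have "elts z = elts x \<union> elts y" by auto
  ultimately show ?thesis by (simp add: un_def set_of_eqI)
qed

lemma std_zero[simp]: "st (zero::'a::hst)"
proof -
  obtain z :: 'a where z: "st z" "elts z \<inter> Standard = {}" using std_zero_ex by blast
  have "uf False SI CS (\<lambda>i e. e 0 \<notin> elts z)" by (intro ufi z)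
  from transfer_ball[where P = "\<lambda>_ u. u \<notin> elts z", OF this]
  have "elts z = {}" using z internal_trans[OF std_internal[OF z(1)]] by (auto simp: st_iff)
  then show ?thesis using z eq_zero_iff by metis
qed

text \<open>Standardization replaces \<open>X\<close> by a standard set with the same standard
  elements, and Regularity in \<open>Standard\<close> applies to that set.\<close>

lemma std_found:
  assumes "st u" "u \<in> X" "small X" obtains m where "st m" "m \<in> X" "\<And>v. st v \<Longrightarrow> v \<in> elts m \<Longrightarrow> v \<notin> (X::'a::hst set)"
proof -
  obtain x where x: "elts x = X" using assms(3) by (auto simp: small_def)
  obtain y where y: "st y" "elts y \<inter> Standard = elts x \<inter> Standard" using Standardization by blast
  have "elts y \<inter> Standard \<noteq> {}" using y x assms by (auto simp: st_iff)
  from std_reg[OF y(1) this] show thesis using that y x by (auto simp: st_iff)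
qed

section \<open>Transitive standard sets around a given standard set\<close>

definition isU :: "'a::in_st \<Rightarrow> 'a \<Rightarrow> bool" where "isU u v \<longleftrightarrow> (\<forall>x. x \<in> elts u \<longleftrightarrow> (\<exists>y\<in>elts v. x \<in> elts y))"
text \<open>A derivation of iterated unions of \<open>s\<close>: every pair is either the start or
  justified by a pair one step earlier. Then \<open>reach s n u\<close> makes \<open>u\<close> the
  \<open>n\<close>-th iterated union. Such a \<open>g\<close> need not be a function; uniqueness is
  a separate induction.\<close>

definition chain :: "'a::in_st \<Rightarrow> 'a \<Rightarrow> bool" where
  "chain s g \<longleftrightarrow> (\<forall>p\<in>elts g. \<exists>k u. p = opair k u \<and> k \<in> elts omega \<and> st u \<and>
     (k = zero \<and> u = s \<or> (\<exists>j\<in>elts omega. \<exists>v. k = sc j \<and> isU u v \<and> rel g j v)))"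
definition reach :: "'a::in_st \<Rightarrow> 'a \<Rightarrow> 'a \<Rightarrow> bool" where
  "reach s n u \<longleftrightarrow> (\<exists>g. chain s g \<and> rel g n u)"

lemma chainD:
  assumes "chain s g" "rel g k u"
  shows "k \<in> elts omega \<and> st u \<and> (k = zero \<and> u = s \<or> (\<exists>j\<in>elts omega. \<exists>v. k = sc j \<and> isU u v \<and> rel g j (v::'a::hst)))"
  using assms unfolding chain_def rel_def by fastforce

lemma reach_zero: "st s \<Longrightarrow> reach s zero (s::'a::hst)"
  unfolding reach_def by (rule exI[of _ "ins (opair zero s) zero"]) (auto simp: chain_def rel_ins)

lemma reach_sc:
  assumes "reach s n u" "st v" "isU v u" shows "reach s (sc n) (v::'a::hst)"
proof -
  obtain g where g: "chain s g" "rel g n u" using assms(1) by (auto simp: reach_def)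
  have n: "n \<in> elts omega" using chainD[OF g] by blast
  have "chain s (ins (opair (sc n) v) g)" unfolding chain_def
  proof
    fix p assume "p \<in> elts (ins (opair (sc n) v) g)"
    then consider "p = opair (sc n) v" | "p \<in> elts g" by auto
    then show "\<exists>k u. p = opair k u \<and> k \<in> elts omega \<and> st u \<and> (k = zero \<and> u = s \<or>
      (\<exists>j\<in>elts omega. \<exists>va. k = sc j \<and> isU u va \<and> rel (ins (opair (sc n) v) g) j va))"
    proof cases
      case 1 then show ?thesis using n assms(2,3) g(2) unfolding rel_ins
        by (intro exI[of _ "sc n"] exI[of _ v]) auto
    next
      case 2 then show ?thesis using g(1) unfolding chain_def rel_ins by blast
    qed
  qed
  then show ?thesis unfolding reach_def using rel_ins by blast
qed

lemma isU_unique: "isU u v \<Longrightarrow> isU w v \<Longrightarrow> u = (w::'a::hst)"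
  unfolding isU_def by (intro Extensionality) auto

lemma uf_isU[ufi]: "uf True (\<lambda>_::unit. UNIV) UNIV (\<lambda>_ e. isU (e j) (e (k::nat) :: 'a::hst))"
  unfolding isU_def by (intro ufi)

lemma uf_reach[ufi]: "uf True (\<lambda>_::unit. UNIV) UNIV (\<lambda>_ e. reach (s::'a::hst) (e j) (e k))"
  unfolding reach_def chain_def by (intro ufi)

lemma reach_unique:
  assumes "n \<in> elts omega" "reach s n u" "reach s n v" shows "u = (v::'a::hst)"
proof -
  have "\<forall>u v. reach s n u \<longrightarrow> reach s n v \<longrightarrow> u = v"
  proof (rule U.ind[of n "\<lambda>n. \<forall>u v. reach s n u \<longrightarrow> reach s n v \<longrightarrow> u = v", OF assms(1)])
    show "\<forall>u v. reach s zero u \<longrightarrow> reach s zero v \<longrightarrow> u = v"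
      unfolding reach_def using chainD U.sc_ne_zero by metis
  next
    fix m assume m: "m \<in> elts omega" "\<forall>u v. reach s m u \<longrightarrow> reach s m v \<longrightarrow> u = v"
    have "\<exists>w. reach s m w \<and> isU u w" if u: "reach s (sc m) u" for u
    proof -
      obtain g where g: "chain s g" "rel g (sc m) u" using u unfolding reach_def by blast
      from chainD[OF this] obtain j w where "j \<in> elts omega" "sc m = sc j" "isU u w" "rel g j w" by auto
      then show ?thesis using U.sc_inj m(1) g(1) unfolding reach_def by metis
    qed
    then show "\<forall>u v. reach s (sc m) u \<longrightarrow> reach s (sc m) v \<longrightarrow> u = v" using m(2) isU_unique by metis
  qed (intro ufi)
  then show ?thesis using assms by blast
qed

lemma reach_std: "reach s n u \<Longrightarrow> n \<in> elts omega \<and> st (u::'a::hst)"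
  unfolding reach_def using chainD by blast

text \<open>The union of all iterated unions of \<open>s\<close> would be transitive but has to be
  standard as well, so transitivity is arranged for standard elements first and then
  transferred.\<close>

lemma std_transitive_ex:
  assumes "st (s::'a::hst)" shows "\<exists>t. st t \<and> transitive t \<and> s \<in> elts t"
proof -
  have "dU (\<lambda>e. reach s (e 0) (e (Suc 0)))" by (intro ufi)
  from collU[OF this, of omega] obtain y where
    y: "\<forall>n\<in>elts omega. (\<exists>b. reach s n b) \<longrightarrow> (\<exists>b\<in>elts y. reach s n b)" by blast
  have "small {v\<in>elts y. \<exists>n\<in>elts omega. reach s n v}"
    by (rule small_sepU[OF small_elts]) (intro ufi)
  then obtain S where S: "elts S = {v\<in>elts y. \<exists>n\<in>elts omega. reach s n v}" by (auto simp: small_def)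
  have inS: "v \<in> elts S" if "reach s n v" for n v
    using y reach_unique that reach_std[OF that] S by blast
  \<comment> \<open>Only the standard members of \<open>T\<close> are known to be iterated unions;
    other members of \<open>T\<close> are controlled by Transfer alone.\<close>
  obtain T where T: "st T" "elts T \<inter> Standard = elts S \<inter> Standard" using Standardization by blast
  obtain V where V: "st V" "elts V = (\<Union>z\<in>elts T. elts z)" using std_Union[OF T(1)] by blast
  let ?t = "un (upair s s) V"
  have t: "st ?t" using V assms by simp
  have sT: "s \<in> elts T" using inS[OF reach_zero[OF assms]] T assms by (auto simp: st_iff)
  have *: "x \<in> elts ?t" if x: "st v" "v \<in> elts ?t" "st x" "x \<in> elts v" for v x
  proof -
    consider "v = s" | "v \<in> elts V" using x by auto
    then show ?thesis
    proof cases
      case 1 then show ?thesis using sT V x by auto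
    next
      case 2
      \<comment> \<open>\<open>v\<close> is standard and lies in some internal member of
        \<open>T\<close>, hence in a standard one, and that is an iterated union of
        \<open>s\<close>.\<close>
      have "uf False SI CS (\<lambda>i (e::nat \<Rightarrow> 'a). \<exists>w\<in>SI i. w \<in> elts T \<and> v \<in> elts w)" by (intro ufi T x)
      from transfer[OF this x(1)] have "(\<exists>w. st w \<and> w \<in> elts T \<and> v \<in> elts w) \<longleftrightarrow> (\<exists>w\<in>Internal. w \<in> elts T \<and> v \<in> elts w)"
        by (auto simp: SI_def st_iff)
      moreover have "\<exists>w\<in>Internal. w \<in> elts T \<and> v \<in> elts w"
        using 2 V(2) internal_trans[OF std_internal[OF T(1)]] by auto
      ultimately obtain w where w: "st w" "w \<in> elts T" "v \<in> elts w" by blast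
      then obtain n where n: "n \<in> elts omega" "reach s n w" using T S by (auto simp: st_iff)
      obtain w' where w': "st w'" "elts w' = (\<Union>z\<in>elts w. elts z)" using std_Union w by blast
      have "reach s (sc n) w'" by (rule reach_sc[OF n(2) w'(1)]) (auto simp: isU_def w')
      then have "w' \<in> elts T" using inS T w'(1) by (auto simp: st_iff)
      then show ?thesis using V w' x w by auto
    qed
  qed
  have "uf False SI CS (\<lambda>i e. e 0 \<in> elts ?t \<longrightarrow> (\<forall>x\<in>SI i. x \<in> elts (e 0) \<longrightarrow> x \<in> elts ?t))" by (intro ufi t)
  from transfer_ball[where P = "\<lambda>i v. v \<in> elts ?t \<longrightarrow> (\<forall>x\<in>SI i. x \<in> elts v \<longrightarrow> x \<in> elts ?t)", OF this]
  have "\<forall>v\<in>Internal. v \<in> elts ?t \<longrightarrow> (\<forall>x\<in>Internal. x \<in> elts v \<longrightarrow> x \<in> elts ?t)"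
    using * by (simp add: SI_def st_iff)
  then have "transitive ?t" unfolding transitive_def
    using internal_trans internal_trans[OF std_internal[OF t]] by blast
  then show ?thesis using t by (intro exI[of _ ?t]) auto
qed

section \<open>Recursion over the standard sets\<close>

lemma small_imageU:
  assumes "small X" "dU (\<lambda>e. R (e 0) (e (Suc 0)))" "\<And>a b c. R a b \<Longrightarrow> R a c \<Longrightarrow> b = c"
  shows "small {b. \<exists>a\<in>X. R a (b::'a::hst)}"
proof -
  obtain x where x: "elts x = X" using assms(1) by (auto simp: small_def)
  obtain y where y: "\<forall>a\<in>elts x. (\<exists>b. R a b) \<longrightarrow> (\<exists>b\<in>elts y. R a b)" using collU[OF assms(2)] by blast
  have R: "dU (\<lambda>e. R (e 0) (e (Suc 0)))" by (rule assms)
  have R2: "dU (\<lambda>e. R (e 0) (e (Suc 0)))" by (rule assms)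
  have "small {b\<in>elts y. \<exists>a\<in>elts x. R a b}"
    by (rule small_sepU[OF small_elts]) (rule uf_elts_bex tpc_UNIV tm_const consts_ok_UNIV UNIV_I R)+
  moreover have "{b\<in>elts y. \<exists>a\<in>elts x. R a b} = {b. \<exists>a\<in>X. R a b}" using y x assms(3) by blast
  ultimately show ?thesis by simp
qed

text \<open>A set-sized approximation to the recursion h(u) = {h(v) : v in u, st v}. Its domain is
  only required to be closed under standard elements, so approximations can be united and extended
  by a single pair.\<close>

definition apx :: "'a::in_st \<Rightarrow> bool" where
  "apx g \<longleftrightarrow> (\<forall>p\<in>elts g. \<exists>u w. p = opair u w \<and> st u) \<and>
     (\<forall>u w w'. rel g u w \<longrightarrow> rel g u w' \<longrightarrow> w = w') \<and>
     (\<forall>u w. rel g u w \<longrightarrow> (\<forall>v\<in>elts u. st v \<longrightarrow> (\<exists>w'. rel g v w')) \<and>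
        (\<forall>x. x \<in> elts w \<longleftrightarrow> (\<exists>v\<in>elts u. st v \<and> rel g v x)))"

definition col :: "'a::in_st \<Rightarrow> 'a \<Rightarrow> bool" where "col u w \<longleftrightarrow> (\<exists>g. apx g \<and> rel g u w)"

lemma uf_col[ufi]: "uf True (\<lambda>_::unit. UNIV) UNIV (\<lambda>_ e. col (e j) (e (k::nat) :: 'a::hst))"
  unfolding col_def apx_def by (intro ufi)
lemma uf_apx[ufi]: "uf True (\<lambda>_::unit. UNIV) UNIV (\<lambda>_ e. apx (e (k::nat) :: 'a::hst))"
  unfolding apx_def by (intro ufi)

lemma apx_st: "apx g \<Longrightarrow> rel g u w \<Longrightarrow> st (u::'a::hst)"
  unfolding apx_def rel_def by fastforce
lemma apx_dom: "apx g \<Longrightarrow> rel g u w \<Longrightarrow> st v \<Longrightarrow> v \<in> elts u \<Longrightarrow> \<exists>w'. rel g v w'"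
  unfolding apx_def by blast
lemma apx_elts: "apx g \<Longrightarrow> rel g u w \<Longrightarrow> x \<in> elts w \<longleftrightarrow> (\<exists>v\<in>elts u. st v \<and> rel g v x)"
  unfolding apx_def by blast

text \<open>A counterexample lies in a standard transitive set, where \<open>std_found\<close>
  provides one without standard counterexamples among its elements.\<close>

lemma std_induct:
  assumes "st (u::'a::hst)" "dU (\<lambda>e. P (e 0))" "\<And>u. st u \<Longrightarrow> (\<And>v. st v \<Longrightarrow> v \<in> elts u \<Longrightarrow> P v) \<Longrightarrow> P u"
  shows "P u"
proof (rule ccontr)
  assume "\<not> P u"
  obtain t where t: "st t" "transitive t" "u \<in> elts t" using std_transitive_ex assms(1) by blast
  have s: "small {v\<in>elts t. \<not> P v}" by (rule small_sepU[OF small_elts]) (intro ufi assms)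
  obtain m where m: "st m" "m \<in> {v\<in>elts t. \<not> P v}" "\<And>v. st v \<Longrightarrow> v \<in> elts m \<Longrightarrow> v \<notin> {v\<in>elts t. \<not> P v}"
    by (rule std_found[OF assms(1) _ s]) (use \<open>\<not> P u\<close> t in auto)
  then have "P m" using assms(3)[of m] t(2) unfolding transitive_def by blast
  then show False using m by simp
qed

lemma apx_agree:
  assumes g: "apx g" "apx g'" "rel g u w" "rel g' u w'" shows "w = (w'::'a::hst)"
proof -
  have "\<forall>w w'. rel g u w \<longrightarrow> rel g' u w' \<longrightarrow> w = w'"
  proof (rule std_induct[of u "\<lambda>u. \<forall>w w'. rel g u w \<longrightarrow> rel g' u w' \<longrightarrow> w = w'", OF apx_st[OF g(1,3)]])
    fix u assume IH: "\<And>v. st v \<Longrightarrow> v \<in> elts u \<Longrightarrow> \<forall>w w'. rel g v w \<longrightarrow> rel g' v w' \<longrightarrow> w = w'"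
    show "\<forall>w w'. rel g u w \<longrightarrow> rel g' u w' \<longrightarrow> w = w'"
    proof (intro allI impI)
      fix w w' assume w: "rel g u w" "rel g' u w'"
      have "x \<in> elts w \<longleftrightarrow> x \<in> elts w'" for x
        unfolding apx_elts[OF g(1) w(1)] apx_elts[OF g(2) w(2)]
        using IH apx_dom[OF g(1) w(1)] apx_dom[OF g(2) w(2)] by metis
      then show "w = w'" by (intro Extensionality) auto
    qed
  qed (intro ufi)
  then show ?thesis using g by blast
qed

lemma col_fun: "col u w \<Longrightarrow> col u w' \<Longrightarrow> w = (w'::'a::hst)"
  unfolding col_def using apx_agree by blast
lemma col_st: "col u w \<Longrightarrow> st (u::'a::hst)" unfolding col_def using apx_st by blast
lemma col_elts: "col u w \<Longrightarrow> x \<in> elts w \<longleftrightarrow> (\<exists>v\<in>elts u. st v \<and> col v (x::'a::hst))"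
proof -
  assume "col u w"
  then obtain g where g: "apx g" "rel g u w" unfolding col_def by blast
  have "rel g v x \<longleftrightarrow> col v x" if v: "v \<in> elts u" "st v" for v
  proof
    assume "col v x"
    then obtain g' where g': "apx g'" "rel g' v x" unfolding col_def by blast
    obtain w' where w': "rel g v w'" using apx_dom[OF g v(2,1)] by blast
    then show "rel g v x" using apx_agree[OF g(1) g'(1) w' g'(2)] by simp
  qed (use g(1) col_def in blast)
  then show "x \<in> elts w \<longleftrightarrow> (\<exists>v\<in>elts u. st v \<and> col v x)" unfolding apx_elts[OF g] by blast
qed

lemma col_total: assumes "st (u::'a::hst)" shows "\<exists>w. col u w"
proof (rule std_induct[of u "\<lambda>u. \<exists>w. col u w", OF assms])
  fix m :: 'a assume m: "st m" and IH: "\<And>v. st v \<Longrightarrow> v \<in> elts m \<Longrightarrow> \<exists>w. col v w"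
  show "\<exists>w. col m w"
  proof (rule ccontr)
    assume no: "\<not> (\<exists>w. col m w)"
    have "dU (\<lambda>e::nat \<Rightarrow> 'a. apx (e (Suc 0)) \<and> (\<exists>w. rel (e (Suc 0)) (e 0) w))" by (intro ufi)
    from collU[OF this, of m] obtain y where y: "\<forall>a\<in>elts m. (\<exists>g. apx g \<and> (\<exists>w. rel g a w)) \<longrightarrow>
      (\<exists>g\<in>elts y. apx g \<and> (\<exists>w. rel g a w))" by blast
    have "small {g\<in>elts y. apx g}" by (rule small_sepU[OF small_elts]) (intro ufi)
    then have "small (\<Union>g\<in>{g\<in>elts y. apx g}. elts g)" by (rule small_Union)
    then obtain G where "elts G = (\<Union>g\<in>{g\<in>elts y. apx g}. elts g)" by (auto simp: small_def)
    then have G: "p \<in> elts G \<longleftrightarrow> (\<exists>g\<in>elts y. apx g \<and> p \<in> elts g)" for p by auto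
    have rG: "rel G u w \<longleftrightarrow> (\<exists>g\<in>elts y. apx g \<and> rel g u w)" for u w unfolding rel_def G by blast
    have Gcol: "col u w" if "rel G u w" for u w using that rG unfolding col_def by blast
    have Gm: "\<exists>w. rel G v w" if "st v" "v \<in> elts m" for v
      using y IH[OF that] that(2) rG unfolding col_def by blast
    have "small {x. \<exists>v\<in>{v\<in>elts m. st v}. col v x}"
    proof (rule small_imageU)
      show "small {v\<in>elts m. st v}" by (rule small_sepU[OF small_elts]) (intro ufi)
      show "dU (\<lambda>e::nat \<Rightarrow> 'a. col (e 0) (e (Suc 0)))" by (intro ufi)
    qed (rule col_fun)
    then obtain W where W: "elts W = {x. \<exists>v\<in>{v\<in>elts m. st v}. col v x}" by (auto simp: small_def)
    \<comment> \<open>The assumption that \<open>m\<close> has no value yet keeps this pair from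
      clashing with the united approximations.\<close>
    let ?G = "ins (opair m W) G"
    have nm: "\<not> rel G m w" for w using Gcol no by blast
    have "apx ?G" unfolding apx_def
    proof (intro conjI)
      show "\<forall>p\<in>elts ?G. \<exists>u w. p = opair u w \<and> st u"
      proof
        fix p assume "p \<in> elts ?G"
        then consider "p = opair m W" | "p \<in> elts G" by auto
        then show "\<exists>u w. p = opair u w \<and> st u" using m G unfolding apx_def by cases blast+
      qed
      show "\<forall>u w w'. rel ?G u w \<longrightarrow> rel ?G u w' \<longrightarrow> w = w'"
        using nm Gcol col_fun unfolding rel_ins by metis
      show "\<forall>u w. rel ?G u w \<longrightarrow> (\<forall>v\<in>elts u. st v \<longrightarrow> (\<exists>w'. rel ?G v w')) \<and>
          (\<forall>x. (x \<in> elts w) = (\<exists>v\<in>elts u. st v \<and> rel ?G v x))"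
      proof (intro allI impI)
        fix u w assume "rel ?G u w"
        then consider (1) "u = m" "w = W" | (2) "rel G u w" unfolding rel_ins by blast
        then show "(\<forall>v\<in>elts u. st v \<longrightarrow> (\<exists>w'. rel ?G v w')) \<and>
          (\<forall>x. (x \<in> elts w) = (\<exists>v\<in>elts u. st v \<and> rel ?G v x))"
        proof cases
          case 1
          have "m \<notin> elts m" using Gm[OF m] nm by blast
          then have r: "rel ?G v x \<longleftrightarrow> rel G v x" if "v \<in> elts m" for v x using that unfolding rel_ins by blast
          have c: "rel G v x \<longleftrightarrow> col v x" if "st v" "v \<in> elts m" for v x
            using Gm[OF that] Gcol col_fun by metis
          have "x \<in> elts W \<longleftrightarrow> (\<exists>v\<in>elts m. st v \<and> rel ?G v x)" for x
          proof -
            have "x \<in> elts W \<longleftrightarrow> (\<exists>v\<in>elts m. st v \<and> col v x)" unfolding W by blast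
            then show ?thesis using r c by blast
          qed
          moreover have "\<forall>v\<in>elts m. st v \<longrightarrow> (\<exists>w'. rel ?G v w')" using Gm r by blast
          ultimately show ?thesis unfolding 1 by blast
        next
          case 2
          then obtain g where g: "g \<in> elts y" "apx g" "rel g u w" using rG by blast
          have d: "\<exists>w'. rel G v w'" if "st v" "v \<in> elts u" for v using apx_dom[OF g(2,3) that] g rG by blast
          have e: "m \<notin> elts u" using d[OF m] nm by blast
          have "rel G v x \<longleftrightarrow> rel g v x" if "st v" "v \<in> elts u" for v x
            using apx_dom[OF g(2,3) that] g rG apx_agree by metis
          then have "(x \<in> elts w) = (\<exists>v\<in>elts u. st v \<and> rel G v x)" for x using apx_elts[OF g(2,3)] by metis
          then show ?thesis using d e unfolding rel_ins by metis
        qed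
      qed
    qed
    moreover have "rel ?G m W" unfolding rel_ins by blast
    ultimately have "col m W" unfolding col_def by blast
    then show False using no by blast
  qed
qed (intro ufi)

text \<open>By induction both sets have the same standard elements, and for standard sets this is
  equality.\<close>

lemma col_inj: assumes "col u w" "col v w" shows "u = (v::'a::hst)"
proof -
  have "\<forall>v w. col u w \<longrightarrow> col v w \<longrightarrow> u = v"
  proof (rule std_induct[of u "\<lambda>u. \<forall>v w. col u w \<longrightarrow> col v w \<longrightarrow> u = v", OF col_st[OF assms(1)]])
    fix u :: 'a assume u: "st u" and IH: "\<And>v. st v \<Longrightarrow> v \<in> elts u \<Longrightarrow> \<forall>v' w. col v w \<longrightarrow> col v' w \<longrightarrow> v = v'"
    show "\<forall>v w. col u w \<longrightarrow> col v w \<longrightarrow> u = v"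
    proof (intro allI impI)
      fix v w assume w: "col u w" "col v w"
      have "x \<in> elts u \<longleftrightarrow> x \<in> elts v" if x: "st x" for x
      proof
        assume "x \<in> elts u"
        then obtain z where z: "col x z" "z \<in> elts w" using col_elts[OF w(1)] col_total[OF x] x by blast
        then obtain x' where "x' \<in> elts v" "col x' z" using col_elts[OF w(2)] by blast
        then show "x \<in> elts v" using IH[OF x \<open>x \<in> elts u\<close>] z by blast
      next
        assume "x \<in> elts v"
        then obtain z where z: "col x z" "z \<in> elts w" using col_elts[OF w(2)] col_total[OF x] x by blast
        then obtain x' where x': "x' \<in> elts u" "st x'" "col x' z" using col_elts[OF w(1)] by blast
        then show "x \<in> elts u" using IH[OF x'(2,1)] z by blast
      qed
      then show "u = v" by (intro std_ext u col_st[OF w(2)]) (auto simp: st_iff)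
    qed
  qed (intro ufi)
  then show ?thesis using assms by blast
qed

text \<open>The given definition wants a function on all standard elements of a standard transitive
  set. Such a function is an approximation, and conversely \<open>col\<close> restricted to such a
  set is one.\<close>

lemma collapses_iff: "st s \<Longrightarrow> collapses_to s w \<longleftrightarrow> col s (w::'a::hst)"
proof
  assume "collapses_to s w"
  then obtain t f where t: "st t" "transitive t" "s \<in> elts t" and f: "is_function f" "fdom f = elts t \<inter> Standard"
    "\<forall>u\<in>elts t \<inter> Standard. elts (fapp f u) = fapp f ` (elts u \<inter> Standard)" "fapp f s = w"
    unfolding collapses_to_def by blast
  assume s: "st s"
  have r: "rel f u x \<longleftrightarrow> st u \<and> u \<in> elts t \<and> x = fapp f u" for u x
  proof
    assume *: "rel f u x"
    then have "u \<in> fdom f" by (auto simp: fdom_rel)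
    then show "st u \<and> u \<in> elts t \<and> x = fapp f u" using f(2) fapp_eq[OF f(1) *] by (simp add: st_iff)
  next
    assume "st u \<and> u \<in> elts t \<and> x = fapp f u"
    then show "rel f u x" using fapp_rel[OF f(1), of u] f(2) by (simp add: st_iff)
  qed
  have tr: "v \<in> elts t" if "u \<in> elts t" "v \<in> elts u" for u v using t(2) that unfolding transitive_def by blast
  have "apx f" unfolding apx_def
  proof (intro conjI)
    show "\<forall>p\<in>elts f. \<exists>u w. p = opair u w \<and> st u"
    proof
      fix p assume p: "p \<in> elts f"
      then obtain u w where "p = opair u w" using is_functionD(1)[OF f(1)] by blast
      then show "\<exists>u w. p = opair u w \<and> st u" using p r[of u w] unfolding rel_def by blast
    qed
    show "\<forall>u w w'. rel f u w \<longrightarrow> rel f u w' \<longrightarrow> w = w'" using is_functionD(2)[OF f(1)] by blast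
    show "\<forall>u w. rel f u w \<longrightarrow> (\<forall>v\<in>elts u. st v \<longrightarrow> (\<exists>w'. rel f v w')) \<and>
          (\<forall>x. (x \<in> elts w) = (\<exists>v\<in>elts u. st v \<and> rel f v x))"
    proof (intro allI impI)
      fix u w assume "rel f u w"
      then have u: "st u" "u \<in> elts t" "w = fapp f u" unfolding r by auto
      then have "elts w = fapp f ` (elts u \<inter> Standard)" using f(3) by (simp add: st_iff)
      then show "(\<forall>v\<in>elts u. st v \<longrightarrow> (\<exists>w'. rel f v w')) \<and>
          (\<forall>x. (x \<in> elts w) = (\<exists>v\<in>elts u. st v \<and> rel f v x))"
        using tr[OF u(2)] unfolding r by (auto simp: st_iff)
    qed
  qed
  moreover have "rel f s w" unfolding r using s t f by blast
  ultimately show "col s w" unfolding col_def by blast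
next
  assume s: "st s" "col s w"
  obtain t where t: "st t" "transitive t" "s \<in> elts t" using std_transitive_ex s by blast
  have "small {p. \<exists>u\<in>elts t. \<exists>w. col u w \<and> p = opair u w}"
    by (rule small_imageU[OF small_elts]) (intro ufi, auto dest: col_fun)
  then obtain f where f: "elts f = {p. \<exists>u\<in>elts t. \<exists>w. col u w \<and> p = opair u w}" by (auto simp: small_def)
  have r: "rel f u w \<longleftrightarrow> u \<in> elts t \<and> col u w" for u w unfolding rel_def f by auto
  have fn: "is_function f"
  proof (rule is_functionI)
    show "\<exists>x y. p = opair x y" if "p \<in> elts f" for p using that f by auto
  qed (use r col_fun in blast)
  have d: "fdom f = elts t \<inter> Standard" unfolding set_eq_iff fdom_rel r Int_iff st_iff[symmetric]
    using col_st col_total by blast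
  have a: "fapp f u = w" if "u \<in> elts t" "col u w" for u w using fapp_eq[OF fn] r that by blast
  have "elts (fapp f u) = fapp f ` (elts u \<inter> Standard)" if u: "u \<in> elts t" "st u" for u
  proof -
    obtain w where w: "col u w" using col_total u by blast
    have tr: "v \<in> elts t" if "v \<in> elts u" for v using t(2) u that unfolding transitive_def by blast
    have "x \<in> elts w \<longleftrightarrow> x \<in> fapp f ` (elts u \<inter> Standard)" for x
    proof
      assume "x \<in> elts w"
      then obtain v where "v \<in> elts u" "st v" "col v x" using col_elts[OF w] by blast
      then show "x \<in> fapp f ` (elts u \<inter> Standard)" using a tr st_iff by (metis IntI imageI)
    next
      assume "x \<in> fapp f ` (elts u \<inter> Standard)"
      then obtain v where v: "v \<in> elts u" "st v" "x = fapp f v" by (auto simp: st_iff)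
      then have "col v x" using col_total a tr by metis
      then show "x \<in> elts w" using col_elts[OF w] v by blast
    qed
    then show ?thesis using a[OF u(1) w] by auto
  qed
  then show "collapses_to s w" unfolding collapses_to_def using t fn d a[OF t(3) s(2)]
    by (intro exI[of _ t] exI[of _ f]) (auto simp: st_iff)
qed

section \<open>Well-founded sets and the star map\<close>

definition wft :: "'a::in_st \<Rightarrow> bool" where
  "wft t \<longleftrightarrow> transitive t \<and> (\<forall>y. elts y \<noteq> {} \<and> elts y \<subseteq> elts t \<longrightarrow> (\<exists>z\<in>elts y. elts z \<inter> elts y = {}))"

lemma WF_iff: "x \<in> WF \<longleftrightarrow> (\<exists>t. wft t \<and> x \<in> elts t)"
  unfolding WF_def wft_def by blast

lemma wft_def': "wft t \<longleftrightarrow> (\<forall>y\<in>elts t. elts y \<subseteq> elts t) \<and>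
    (\<forall>y. (\<exists>z. z \<in> elts y) \<and> elts y \<subseteq> elts t \<longrightarrow> (\<exists>z\<in>elts y. \<forall>v\<in>elts z. v \<notin> elts y))"
  unfolding wft_def transitive_def by (simp add: disjoint_iff Ball_def ex_in_conv)

lemma uf_wft[ufi]: "uf True (\<lambda>_::unit. UNIV) UNIV (\<lambda>_ e. wft (e (k::nat) :: 'a::hst))"
  unfolding wft_def' by (intro ufi)

lemma uf_WF[ufi]: "uf True (\<lambda>_::unit. UNIV) UNIV (\<lambda>_ e. e (k::nat) \<in> (WF :: 'a::hst set))"
  unfolding WF_iff by (intro ufi)

lemma WF_trans: "x \<in> WF \<Longrightarrow> y \<in> elts x \<Longrightarrow> y \<in> (WF :: 'a::hst set)"
  unfolding WF_iff wft_def transitive_def by blast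

lemma WF_min: assumes "x \<in> WF" "elts x \<noteq> {}" shows "\<exists>m\<in>elts (x::'a::hst). elts m \<inter> elts x = {}"
proof -
  obtain t where t: "wft t" "x \<in> elts t" using assms unfolding WF_iff by blast
  then have "elts x \<subseteq> elts t" unfolding wft_def transitive_def by blast
  then show ?thesis using t assms unfolding wft_def by blast
qed

text \<open>The transitive witnesses for the elements of \<open>x\<close> are united to
  \<open>V\<close>, and \<open>x\<close> is added. A nonempty part of this set is either the
  singleton of \<open>x\<close> or meets some witness \<open>t\<close>, and a minimal element of its
  trace on \<open>t\<close> is minimal outright because \<open>t\<close> is transitive.\<close>

lemma WF_I: assumes "elts (x::'a::hst) \<subseteq> WF" shows "x \<in> WF"
proof -
  have "dU (\<lambda>e::nat \<Rightarrow> 'a. wft (e (Suc 0)) \<and> e 0 \<in> elts (e (Suc 0)))" by (intro ufi)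
  from collU[OF this, of x] obtain y where
    y: "\<forall>a\<in>elts x. (\<exists>t. wft t \<and> a \<in> elts t) \<longrightarrow> (\<exists>t\<in>elts y. wft t \<and> a \<in> elts t)" by blast
  have "small {t\<in>elts y. wft t}" by (rule small_sepU[OF small_elts]) (intro ufi)
  then have "small (\<Union>t\<in>{t\<in>elts y. wft t}. elts t)" by (rule small_Union)
  then obtain V where "elts V = (\<Union>t\<in>{t\<in>elts y. wft t}. elts t)" by (auto simp: small_def)
  then have V: "v \<in> elts V \<longleftrightarrow> (\<exists>t\<in>elts y. wft t \<and> v \<in> elts t)" for v by auto
  have xV: "elts x \<subseteq> elts V"
  proof
    fix a assume a: "a \<in> elts x"
    then have "a \<in> WF" using assms by blast
    then show "a \<in> elts V" using y a unfolding V WF_iff by blast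
  qed
  have Vtr: "elts v \<subseteq> elts V" if v: "v \<in> elts V" for v
  proof
    fix a assume a: "a \<in> elts v"
    obtain t where t: "t \<in> elts y" "wft t" "v \<in> elts t" using v unfolding V by blast
    then have "elts v \<subseteq> elts t" unfolding wft_def transitive_def by blast
    then show "a \<in> elts V" unfolding V using t a by blast
  qed
  have "wft (ins x V)" unfolding wft_def
  proof (intro conjI allI impI)
    show "transitive (ins x V)" unfolding transitive_def using xV Vtr by auto
  next
    fix z assume z: "elts z \<noteq> {} \<and> elts z \<subseteq> elts (ins x V)"
    show "\<exists>m\<in>elts z. elts m \<inter> elts z = {}"
    proof (cases "elts z \<inter> elts V = {}")
      case True
      then have zx: "elts z = {x}" using z by auto
      have "x \<notin> elts x" using xV True zx by blast
      then show ?thesis using zx by auto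
    next
      case False
      then obtain a t where a: "a \<in> elts z" "t \<in> elts y" "wft t" "a \<in> elts t" unfolding V by (auto simp: V)
      have "small {v\<in>elts z. v \<in> elts t}" by (rule small_sepU[OF small_elts]) (intro ufi)
      then obtain z' where z': "elts z' = {v\<in>elts z. v \<in> elts t}" by (auto simp: small_def)
      then have "elts z' \<noteq> {}" "elts z' \<subseteq> elts t" using a by auto
      then obtain m where m: "m \<in> elts z'" "elts m \<inter> elts z' = {}" using a(3) unfolding wft_def by blast
      moreover have "elts m \<subseteq> elts t" using a(3) m(1) z' unfolding wft_def transitive_def by blast
      ultimately show ?thesis unfolding z' by blast
    qed
  qed
  then show ?thesis unfolding WF_iff by (intro exI[of _ "ins x V"]) auto
qed

lemma tpc_WF: "tpc (\<lambda>_. WF :: 'a::hst set)"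
  unfolding tpc_def
proof (intro conjI allI ballI)
  show "elts x \<subseteq> WF" if "x \<in> WF" for x :: 'a using WF_trans[OF that] by blast
  show "upair x y \<in> WF" "ins x y \<in> WF" "un x y \<in> WF" if "x \<in> WF" "y \<in> WF" for x y :: 'a
    by (rule WF_I; use that WF_trans[OF that(1)] WF_trans[OF that(2)] in auto)+
qed

lemma omega_WF: "(omega :: 'a::hst) \<in> WF"
proof (rule WF_I, rule subsetI)
  fix n :: 'a assume n: "n \<in> elts omega"
  show "n \<in> WF"
  proof (rule U.ind[of n "\<lambda>n. n \<in> WF", OF n])
    show "sc m \<in> WF" if "m \<in> WF" for m :: 'a using that tpc_ins[OF tpc_WF] unfolding sc_def by blast
  qed ((intro ufi), rule WF_I, simp)
qed

text \<open>The collapse of a standard transitive set is a witness: a minimal standard preimage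
  collapses to a minimal element, by \<open>std_found\<close>.\<close>

lemma col_WF: assumes "col u w" shows "(w::'a::hst) \<in> WF"
proof -
  obtain t where t: "st t" "transitive t" "u \<in> elts t" using std_transitive_ex[OF col_st[OF assms]] by blast
  have "small {x. \<exists>v\<in>elts t. col v x}"
  proof (rule small_imageU[OF small_elts])
    show "dU (\<lambda>e::nat \<Rightarrow> 'a. col (e 0) (e (Suc 0)))" by (intro ufi)
  qed (rule col_fun)
  then obtain T where T: "elts T = {x. \<exists>v\<in>elts t. col v x}" by (auto simp: small_def)
  have "wft T" unfolding wft_def
  proof (intro conjI allI impI)
    show "transitive T" unfolding transitive_def
    proof (intro ballI subsetI)
      fix y x assume "y \<in> elts T" "x \<in> elts y"
      then obtain v v' where "v \<in> elts t" "v' \<in> elts v" "col v' x" using col_elts T by blast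
      then show "x \<in> elts T" using t(2) unfolding T transitive_def by blast
    qed
  next
    fix y assume y: "elts y \<noteq> {} \<and> elts y \<subseteq> elts T"
    then obtain x0 v0 where x0: "x0 \<in> elts y" "v0 \<in> elts t" "col v0 x0" unfolding T by blast
    have s: "small {v\<in>elts t. \<exists>x\<in>elts y. col v x}" by (rule small_sepU[OF small_elts]) (intro ufi)
    obtain m where m: "st m" "m \<in> {v\<in>elts t. \<exists>x\<in>elts y. col v x}"
      "\<And>v. st v \<Longrightarrow> v \<in> elts m \<Longrightarrow> v \<notin> {v\<in>elts t. \<exists>x\<in>elts y. col v x}"
      by (rule std_found[OF col_st[OF x0(3)] _ s]) (use x0 in auto)
    then obtain x where x: "x \<in> elts y" "col m x" by blast
    have "z \<notin> elts y" if zx: "z \<in> elts x" for z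
    proof -
      obtain v where v: "v \<in> elts m" "st v" "col v z" using col_elts[OF x(2), of z] zx by blast
      then have "v \<in> elts t" using t(2) m(2) unfolding transitive_def by blast
      then show ?thesis using m(3)[OF v(2,1)] v by blast
    qed
    then show "\<exists>z\<in>elts y. elts z \<inter> elts y = {}" using x by blast
  qed
  moreover have "w \<in> elts T" unfolding T using t assms by blast
  ultimately show ?thesis unfolding WF_iff by blast
qed

text \<open>At a membership-minimal failure \<open>z\<close> all elements have preimages. These are
  collected, and Standardization forms the standard set having exactly them as standard elements; it
  collapses to \<open>z\<close>.\<close>

lemma col_surj: assumes "(w::'a::hst) \<in> WF" shows "\<exists>u. col u w"
proof (rule ccontr)
  assume bad: "\<not> (\<exists>u. col u w)"
  obtain t where t: "wft t" "w \<in> elts t" using assms unfolding WF_iff by blast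
  have "small {v\<in>elts t. \<not> (\<exists>u. col u v)}" by (rule small_sepU[OF small_elts]) (intro ufi)
  then obtain B where B: "elts B = {v\<in>elts t. \<not> (\<exists>u. col u v)}" by (auto simp: small_def)
  have "elts B \<noteq> {}" "elts B \<subseteq> elts t" using B bad t by auto
  then obtain z where z: "z \<in> elts B" "elts z \<inter> elts B = {}" using t(1) unfolding wft_def by blast
  have good: "\<exists>u. col u a" if "a \<in> elts z" for a
    using z that t(1) B unfolding wft_def transitive_def by blast
  have "dU (\<lambda>e::nat \<Rightarrow> 'a. col (e (Suc 0)) (e 0))" by (intro ufi)
  from collU[OF this, of z] obtain y where y: "\<forall>a\<in>elts z. (\<exists>u. col u a) \<longrightarrow> (\<exists>u\<in>elts y. col u a)" by blast
  have "small {u\<in>elts y. \<exists>a\<in>elts z. col u a}" by (rule small_sepU[OF small_elts]) (intro ufi)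
  then obtain y' where y': "elts y' = {u\<in>elts y. \<exists>a\<in>elts z. col u a}" by (auto simp: small_def)
  obtain s where s: "st s" "elts s \<inter> Standard = elts y' \<inter> Standard" using Standardization by blast
  obtain x where x: "col s x" using col_total s by blast
  have "v \<in> elts s \<and> st v \<longleftrightarrow> v \<in> elts y \<and> (\<exists>a\<in>elts z. col v a)" for v
    using s(2) y' col_st unfolding set_eq_iff Int_iff st_iff[symmetric] by blast
  then have v: "v \<in> elts s \<and> st v \<longleftrightarrow> v \<in> elts y \<and> (\<exists>a\<in>elts z. col v a)" for v .
  have "a \<in> elts x \<longleftrightarrow> a \<in> elts z" for a
  proof
    assume "a \<in> elts x"
    then obtain v' where v': "v' \<in> elts s" "st v'" "col v' a" unfolding col_elts[OF x] by blast
    then obtain a' where "a' \<in> elts z" "col v' a'" using v[of v'] by blast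
    then show "a \<in> elts z" using v'(3) col_fun by metis
  next
    assume a: "a \<in> elts z"
    then obtain u where u: "u \<in> elts y" "col u a" using y good[OF a] by blast
    then have "u \<in> elts s" "st u" using v[of u] a by blast+
    then show "a \<in> elts x" unfolding col_elts[OF x] using u by blast
  qed
  then have "x = z" by (intro Extensionality) auto
  then show False using x z B by blast
qed

section \<open>The star map and transfer along it\<close>

lemma star_props: assumes "(w::'a::hst) \<in> WF" shows "st (star w) \<and> col (star w) w"
proof -
  obtain u where u: "col u w" using col_surj assms by blast
  have "star w = u" unfolding star_def
  proof (rule the_equality)
    show "st u \<and> collapses_to u w" using u col_st[OF u] collapses_iff by blast
    show "s = u" if "st s \<and> collapses_to s w" for s using that u col_inj collapses_iff by blast
  qed
  then show ?thesis using u col_st by blast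
qed

lemma star_st: "(w::'a::hst) \<in> WF \<Longrightarrow> st (star w)" using star_props by blast
lemma star_col: "(w::'a::hst) \<in> WF \<Longrightarrow> col (star w) w" using star_props by blast
lemma star_eq: "col u w \<Longrightarrow> star w = (u::'a::hst)" using star_col col_WF col_inj by metis
lemma star_int: "(w::'a::hst) \<in> WF \<Longrightarrow> star w \<in> Internal" using star_st std_internal by blast

lemma star_inj: "u \<in> WF \<Longrightarrow> w \<in> WF \<Longrightarrow> star u = star w \<longleftrightarrow> u = (w::'a::hst)"
  using star_col col_fun by metis

lemma star_mem: "u \<in> WF \<Longrightarrow> w \<in> WF \<Longrightarrow> star u \<in> elts (star w) \<longleftrightarrow> u \<in> elts (w::'a::hst)"
  using col_elts[OF star_col, of w u] star_st[of u] star_col[of u] star_eq by metis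

lemma star_surj: "st s \<Longrightarrow> \<exists>w\<in>WF. star w = (s::'a::hst)"
  using col_total col_WF star_eq by metis

lemma sat_WF_Standard:
  "in_formula p \<Longrightarrow> range e \<subseteq> WF \<Longrightarrow> sat WF p e = sat Standard p (star \<circ> (e :: nat \<Rightarrow> 'a::hst))"
proof (induction p arbitrary: e)
  case (Mem i j)
  then show ?case using star_mem[of "e i" "e j"] by (simp add: image_subset_iff)
next
  case (Eq i j)
  then show ?case using star_inj[of "e i" "e j"] by (simp add: image_subset_iff)
next
  case (All i p)
  have u: "star \<circ> e(i := a) = (star \<circ> e)(i := star a)" for a by auto
  have "sat WF p (e(i := a)) = sat Standard p ((star \<circ> e)(i := star a))" if "a \<in> WF" for a
  proof -
    have "range (e(i := a)) \<subseteq> WF" using All.prems(2) that by (auto simp: image_subset_iff)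
    moreover have "in_formula p" using All.prems(1) by simp
    ultimately show ?thesis using All.IH[of "e(i := a)"] unfolding u by blast
  qed
  then have "(\<forall>a\<in>WF. sat WF p (e(i := a))) \<longleftrightarrow> (\<forall>a\<in>WF. sat Standard p ((star \<circ> e)(i := star a)))" by blast
  also have "\<dots> \<longleftrightarrow> (\<forall>a\<in>Standard. sat Standard p ((star \<circ> e)(i := a)))"
    using star_surj star_st unfolding st_iff by metis
  finally show ?case by (simp only: sat.simps)
next
  case (Conj p q)
  then show ?case by (simp only: in_formula.simps sat.simps)
qed auto

lemma sat_WF_Internal:
  assumes "in_formula p" "range e \<subseteq> WF"
  shows "sat WF p e = sat Internal p (star \<circ> (e :: nat \<Rightarrow> 'a::hst))"
proof -
  have "range (star \<circ> e) \<subseteq> Standard" using assms(2) star_st by (auto simp: st_iff image_subset_iff)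
  from Transfer[OF assms(1) this] sat_WF_Standard[OF assms] show ?thesis by simp
qed

definition WI :: "bool \<Rightarrow> 'a::in_st set" where "WI i = (if i then Internal else WF)"
definition CW :: "(bool \<Rightarrow> 'a::in_st) set" where "CW = {\<lambda>i. if i then star w else w | w. w \<in> WF}"

lemma consts_ok_CW[ufi]: "consts_ok WI (CW :: (bool \<Rightarrow> 'a::hst) set)"
  using omega_WF star_int by (auto simp: consts_ok_def CW_def WI_def)

lemma star_transfer:
  assumes "uf False WI CW P" "range (e :: nat \<Rightarrow> 'a::hst) \<subseteq> WF"
  shows "P False e \<longleftrightarrow> P True (star \<circ> e)"
proof -
  obtain p c where p: "in_formula p" "range c \<subseteq> CW"
    "\<And>i e. range e \<subseteq> WI i \<Longrightarrow> P i e = sat (WI i) p (mix e (\<lambda>n. c n i))"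
    using assms(1) unfolding uf_def by blast
  have "c n \<in> CW" for n using p(2) by auto
  then have c: "c n True = star (c n False)" "c n False \<in> WF" for n
    by (auto simp: CW_def dest!: spec[of _ n]) metis+
  have "star \<circ> mix e (\<lambda>n. c n False) = mix (star \<circ> e) (\<lambda>n. c n True)"
    by (auto simp: mix_def c fun_eq_iff)
  moreover have "range (mix e (\<lambda>n. c n False)) \<subseteq> WF" using c(2) assms(2) by (auto simp: mix_def)
  moreover have "range (star \<circ> e) \<subseteq> Internal" using assms(2) star_int by (auto simp: image_subset_iff)
  ultimately show ?thesis
    using sat_WF_Internal[OF p(1), of "mix e (\<lambda>n. c n False)"] p(3)[of e False] p(3)[of "star \<circ> e" True] assms(2)
    by (simp add: WI_def)
qed

section \<open>Closure properties of the internal and the well-founded universe\<close>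

text \<open>A block of \<open>k\<close> quantifiers, needed to close a formula over all the
  variables that it mentions.\<close>

lemma forall_formulas:
  "\<exists>q. in_formula q = in_formula p \<and> (\<forall>(D::'a::in_st set) e. sat D q e \<longleftrightarrow>
     (\<forall>f. (\<forall>n<k. f n \<in> D) \<longrightarrow> sat D p (\<lambda>n. if n < k then f n else e (n - k))))"
proof (induction k)
  case 0
  show ?case by (rule exI[of _ p]) simp
next
  case (Suc k)
  then obtain q where q: "in_formula q = in_formula p" "\<And>(D::'a set) e. sat D q e \<longleftrightarrow>
     (\<forall>f. (\<forall>n<k. f n \<in> D) \<longrightarrow> sat D p (\<lambda>n. if n < k then f n else e (n - k)))" by blast
  obtain r where r: "in_formula r = in_formula q"
    "\<And>(D::'a set) e. sat D r e \<longleftrightarrow> (\<forall>x\<in>D. sat D q (case_nat x e))" using forall_formula[of q] by blast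
  have eq: "(\<lambda>n. if n < k then f n else case_nat x e (n - k)) =
      (\<lambda>n. if n < Suc k then (f(k := x)) n else e (n - Suc k))" for f x and e :: "nat \<Rightarrow> 'a"
  proof (rule ext)
    fix n
    consider "n < k" | "n = k" | m where "n = Suc (k + m)" by (metis less_imp_Suc_add linorder_neqE_nat)
    then show "(if n < k then f n else case_nat x e (n - k)) = (if n < Suc k then (f(k := x)) n else e (n - Suc k))"
    proof cases
      case 3 then show ?thesis by (simp add: Suc_diff_le)
    qed auto
  qed
  have "sat D r e \<longleftrightarrow> (\<forall>f. (\<forall>n<Suc k. f n \<in> D) \<longrightarrow> sat D p (\<lambda>n. if n < Suc k then f n else e (n - Suc k)))"
    for D :: "'a set" and e
  proof
    assume s: "sat D r e"
    show "\<forall>f. (\<forall>n<Suc k. f n \<in> D) \<longrightarrow> sat D p (\<lambda>n. if n < Suc k then f n else e (n - Suc k))"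
    proof (intro allI impI)
      fix f :: "nat \<Rightarrow> 'a" assume f: "\<forall>n<Suc k. f n \<in> D"
      have "sat D p (\<lambda>n. if n < k then f n else case_nat (f k) e (n - k))"
        using s f unfolding r(2) q(2) by simp
      then show "sat D p (\<lambda>n. if n < Suc k then f n else e (n - Suc k))" unfolding eq by (simp only: fun_upd_triv)
    qed
  next
    assume s: "\<forall>f. (\<forall>n<Suc k. f n \<in> D) \<longrightarrow> sat D p (\<lambda>n. if n < Suc k then f n else e (n - Suc k))"
    show "sat D r e" unfolding r(2) q(2) eq
    proof (intro ballI allI impI)
      fix x f assume "x \<in> D" "\<forall>n<k. f n \<in> D"
      then have "\<forall>n<Suc k. (f(k := x)) n \<in> D" by auto
      then show "sat D p (\<lambda>n. if n < Suc k then (f(k := x)) n else e (n - Suc k))" using s by blast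
    qed
  qed
  then show ?case using q(1) r(1) by blast
qed

text \<open>Transfer admits standard parameters only. Internal values are reached by quantifying
  over the finitely many variables of the formula, transferring the closed statement and
  instantiating it.\<close>

lemma transfer_close:
  assumes "uf False SI CS P" "\<And>e. range e \<subseteq> Standard \<Longrightarrow> P False e" "range e' \<subseteq> Internal"
  shows "P True (e' :: nat \<Rightarrow> 'a::hst)"
proof -
  obtain p c where p: "in_formula p" "range c \<subseteq> CS"
    "\<And>i e. range e \<subseteq> SI i \<Longrightarrow> P i e = sat (SI i) p (mix e (\<lambda>n. c n i))"
    using assms(1) unfolding uf_def by blast
  have "c n \<in> CS" for n using p(2) by auto
  then have cc: "c n True = c n False" "st (c n False)" for n by (auto simp: CS_def) (metis, metis)
  define d where "d n = c n False" for n
  have dd: "(\<lambda>n. c n False) = d" by (auto simp: d_def)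
  obtain k where k: "\<forall>v\<in>vars p. v < k" using finite_vars finite_nat_set_iff_bounded by blast
  define \<rho> where "\<rho> v = (if even v then v div 2 else k + v div 2)" for v :: nat
  obtain p' where p': "in_formula p' = in_formula p" "\<And>(D::'a set) e. sat D p' e = sat D p (\<lambda>n. e (\<rho> n))"
    using renaming[of p \<rho>] by blast
  obtain q where q: "in_formula q = in_formula p'" "\<And>(D::'a set) e. sat D q e \<longleftrightarrow>
     (\<forall>f. (\<forall>n<k. f n \<in> D) \<longrightarrow> sat D p' (\<lambda>n. if n < k then f n else e (n - k)))"
    using forall_formulas[of p' k] by blast
  have eq: "sat D p' (\<lambda>n. if n < k then f n else d (n - k)) = sat D p (mix f d)" for f and D :: "'a set"
    unfolding p'(2) by (rule sat_cong) (use k in \<open>auto simp: mix_def \<rho>_def\<close>)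
  have S: "sat Standard q d"
    unfolding q(2) eq
  proof (intro allI impI)
    fix f :: "nat \<Rightarrow> 'a" assume f: "\<forall>n<k. f n \<in> Standard"
    define g where "g n = (if n < k then f n else d 0)" for n
    have g: "range g \<subseteq> Standard" using f cc by (auto simp: g_def d_def st_iff)
    have "sat Standard p (mix g d)" using assms(2)[OF g] p(3)[of g False] g by (simp add: SI_def dd)
    moreover have "sat Standard p (mix g d) = sat Standard p (mix f d)"
      by (rule sat_cong) (use k in \<open>auto simp: mix_def g_def\<close>)
    ultimately show "sat Standard p (mix f d)" by simp
  qed
  have "range d \<subseteq> Standard" using cc by (auto simp: d_def st_iff)
  then have "sat Internal q d" using S Transfer[of q d] q(1) p'(1) p(1) by simp
  then have "sat Internal p (mix e' d)" unfolding q(2) eq using assms(3) by (simp add: image_subset_iff)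
  then show ?thesis using p(3)[of e' True] assms(3) by (simp add: SI_def cc dd)
qed

text \<open>The parameters \<open>e\<close> are internal and cannot serve as constants for Transfer,
  so they are left as variables and handled by \<open>transfer_close\<close>.\<close>

lemma int_sep:
  assumes "in_formula p" "range e \<subseteq> Internal" "x \<in> Internal"
  shows "\<exists>y\<in>Internal. elts y = {z\<in>elts (x::'a::hst). sat Internal p (case_nat z e)}"
proof -
  let ?P = "\<lambda>i (e::nat \<Rightarrow> 'a). \<forall>x\<in>SI i. \<exists>y\<in>SI i. \<forall>z\<in>SI i. z \<in> elts y \<longleftrightarrow> z \<in> elts x \<and> sat (SI i) p (case_nat z e)"
  have "uf False SI CS (\<lambda>i (e::nat \<Rightarrow> 'a). sat (SI i) p e)" by (rule uf_atom) (use assms in \<open>auto intro: ufi\<close>)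
  \<comment> \<open>Below the quantifiers for \<open>x\<close>, \<open>y\<close> and
    \<open>z\<close>, index 0 is \<open>z\<close> and the parameters start at index 3.\<close>
  from uf_rename[OF this, where \<rho> = "case_nat 0 (\<lambda>n. Suc (Suc (Suc n)))"]
  have 1: "uf False SI CS (\<lambda>i (e::nat \<Rightarrow> 'a). sat (SI i) p (case_nat (e 0) (\<lambda>n. e (Suc (Suc (Suc n))))))"
    by (rule uf_cong) (auto intro!: arg_cong[where f = "sat _ p"] split: nat.split)
  have "uf False SI CS ?P" by (intro ufi 1)
  then have "?P True e"
  proof (rule transfer_close)
    fix e :: "nat \<Rightarrow> 'a" assume e: "range e \<subseteq> Standard"
    show "?P False e"
    proof
      fix x :: 'a assume "x \<in> SI False"
      then have x: "x \<in> Standard" by (simp add: SI_def)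
      obtain q where q: "in_formula q = in_formula p" "\<And>(D::'a set) e. sat D q e = sat D p (\<lambda>n. e (id n))"
        using renaming[of p id] by blast
      have "range (case_nat x e) \<subseteq> Standard" using x e by (auto split: nat.splits simp: image_subset_iff)
      then obtain y where "y \<in> Standard" "elts y \<inter> Standard = {z\<in>elts x \<inter> Standard. sat Standard p ((case_nat x e)(0 := z))}"
        using ZFC_parts(7) assms(1) x by blast
      moreover have "(case_nat x e)(0 := z) = case_nat z e" for z by (auto split: nat.split)
      ultimately show "\<exists>y\<in>SI False. \<forall>z\<in>SI False. (z \<in> elts y) = (z \<in> elts x \<and> sat (SI False) p (case_nat z e))"
        unfolding SI_def by auto
    qed
  qed (rule assms(2))
  then obtain y where y: "y \<in> Internal" "\<forall>z\<in>Internal. z \<in> elts y \<longleftrightarrow> z \<in> elts x \<and> sat Internal p (case_nat z e)"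
    using assms(3) by (auto simp: SI_def)
  have "z \<in> elts y \<longleftrightarrow> z \<in> elts x \<and> sat Internal p (case_nat z e)" for z
    using y internal_trans[OF y(1), of z] internal_trans[OF assms(3), of z] by blast
  then show ?thesis using y(1) by blast
qed

lemma WI_simps: "WI True = Internal" "WI False = WF" by (simp_all add: WI_def)

text \<open>Pulled back along \<open>star\<close> from Separation for internal sets.\<close>

lemma WF_sep:
  assumes "in_formula p" "range e \<subseteq> WF" "x \<in> WF"
  shows "\<exists>y\<in>WF. elts y = {z\<in>elts (x::'a::hst). sat WF p (case_nat z e)}"
proof -
  let ?P = "\<lambda>i (e::nat \<Rightarrow> 'a). \<forall>x\<in>WI i. \<exists>y\<in>WI i. \<forall>z\<in>WI i. z \<in> elts y \<longleftrightarrow> z \<in> elts x \<and> sat (WI i) p (case_nat z e)"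
  have "uf False WI CW (\<lambda>i (e::nat \<Rightarrow> 'a). sat (WI i) p e)" by (rule uf_atom) (use assms in \<open>auto intro: ufi\<close>)
  from uf_rename[OF this, where \<rho> = "case_nat 0 (\<lambda>n. Suc (Suc (Suc n)))"]
  have 1: "uf False WI CW (\<lambda>i (e::nat \<Rightarrow> 'a). sat (WI i) p (case_nat (e 0) (\<lambda>n. e (Suc (Suc (Suc n))))))"
    by (rule uf_cong) (auto intro!: arg_cong[where f = "sat _ p"] split: nat.split)
  have "uf False WI CW ?P" by (intro ufi 1)
  from star_transfer[OF this assms(2)] have "?P False e \<longleftrightarrow> ?P True (star \<circ> e)" .
  moreover have "?P True (star \<circ> e)" unfolding WI_simps
  proof
    fix x :: 'a assume "x \<in> Internal"
    moreover have "range (star \<circ> e) \<subseteq> Internal" using assms(2) star_int by (auto simp: image_subset_iff)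
    ultimately obtain y where "y \<in> Internal" "elts y = {z\<in>elts x. sat Internal p (case_nat z (star \<circ> e))}"
      using int_sep[OF assms(1)] by blast
    then show "\<exists>y\<in>Internal. \<forall>z\<in>Internal. (z \<in> elts y) = (z \<in> elts x \<and> sat Internal p (case_nat z (star \<circ> e)))"
      by (intro bexI[of _ y]) auto
  qed
  ultimately obtain y where y: "y \<in> WF" "\<forall>z\<in>WF. z \<in> elts y \<longleftrightarrow> z \<in> elts x \<and> sat WF p (case_nat z e)"
    using assms(3) unfolding WI_simps by blast
  have "z \<in> elts y \<longleftrightarrow> z \<in> elts x \<and> sat WF p (case_nat z e)" for z
    using y WF_trans[OF y(1), of z] WF_trans[OF assms(3), of z] by blast
  then show ?thesis using y(1) by blast
qed

text \<open>Passes from formulas to definable predicates. \<open>f\<close> lays out the constants in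
  the odd slots and fills the variable slots with the dummy \<open>x\<close>, as \<open>P\<close>
  reads variable 0 only.\<close>

lemma sep_from_formula:
  assumes "\<And>p e x. in_formula p \<Longrightarrow> range e \<subseteq> D \<Longrightarrow> x \<in> D \<Longrightarrow> \<exists>y\<in>D. elts y = {z\<in>elts x. sat D p (case_nat z e)}"
    and "\<And>x y. x \<in> D \<Longrightarrow> y \<in> elts x \<Longrightarrow> y \<in> D"
    and "x \<in> D" "uf False (\<lambda>_::unit. D) (CD D) (\<lambda>_ e. P (e 0))"
  shows "\<exists>y\<in>D. elts y = {z\<in>elts (x::'a::in_st). P z}"
proof -
  obtain p c where p: "in_formula p" "range c \<subseteq> CD D"
    and p': "\<forall>(i::unit) e. range e \<subseteq> D \<longrightarrow> P (e 0) = sat D p (mix e (\<lambda>n. c n i))"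
    using assms(4) unfolding uf_def by blast
  have cc: "c n () \<in> D" for n using p(2) by (auto simp: CD_def image_subset_iff) metis
  define f where "f n = (if even n then x else c (n div 2) ())" for n
  have "range (\<lambda>n. f (Suc n)) \<subseteq> D" using cc assms(3) by (auto simp: f_def)
  then obtain y where y: "y \<in> D" "elts y = {z\<in>elts x. sat D p (case_nat z (\<lambda>n. f (Suc n)))}"
    using assms(1)[OF p(1) _ assms(3)] by blast
  have "P z = sat D p (case_nat z (\<lambda>n. f (Suc n)))" if "z \<in> elts x" for z
  proof -
    have "z \<in> D" using assms(2,3) that by blast
    then have "range (case_nat z (\<lambda>_. x)) \<subseteq> D" using assms(3) by (auto split: nat.splits)
    moreover have "mix (case_nat z (\<lambda>_. x)) (\<lambda>n. c n ()) = case_nat z (\<lambda>n. f (Suc n))"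
      by (rule ext) (auto simp: mix_def f_def split: nat.split elim!: evenE)
    ultimately show ?thesis using p'[rule_format, of "case_nat z (\<lambda>_. x)" "()"] by simp
  qed
  then show ?thesis using y by blast
qed

section \<open>Pairs, unions, power sets and regularity\<close>

lemma int_transfer_closed:
  fixes P :: "bool \<Rightarrow> bool"
  assumes "uf False SI CS (\<lambda>i (e :: nat \<Rightarrow> 'a::hst). P i)" "P False" shows "P True"
  using transfer[OF assms(1)] std_zero[where 'a = 'a] assms(2) by blast

lemma int_pair: assumes "x \<in> Internal" "y \<in> Internal" shows "upair x y \<in> (Internal :: 'a::hst set)"
proof -
  let ?P = "\<lambda>i. \<forall>x\<in>SI i. \<forall>y\<in>SI i. \<exists>z\<in>SI i. \<forall>u\<in>SI i. u \<in> elts (z::'a) \<longleftrightarrow> u = x \<or> u = y"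
  have up: "uf False SI CS (\<lambda>i (e :: nat \<Rightarrow> 'a::hst). ?P i)" by (intro ufi)
  have "?P False" unfolding SI_def
    proof (simp, intro ballI)
      fix x y :: 'a assume "x \<in> Standard" "y \<in> Standard"
      then have "upair x y \<in> Standard" using std_upair by (simp add: st_iff[symmetric])
      then show "\<exists>z\<in>Standard. \<forall>u\<in>Standard. (u \<in> elts z) = (u = x \<or> u = y)" by (intro bexI[of _ "upair x y"]) auto
    qed
  from int_transfer_closed[OF up this] obtain z where
    z: "z \<in> Internal" "\<forall>u\<in>Internal. u \<in> elts z \<longleftrightarrow> u = x \<or> u = y"
    using assms unfolding SI_def by simp blast
  then have "elts z = {x, y}" using internal_trans[OF z(1)] assms by blast
  then show ?thesis using z by (simp add: upair_def set_of_eqI)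
qed

lemma int_Union: assumes "x \<in> Internal" shows "\<exists>y\<in>Internal. elts (y::'a::hst) = (\<Union>z\<in>elts x. elts z)"
proof -
  let ?P = "\<lambda>i. \<forall>x\<in>SI i. \<exists>y\<in>SI i. \<forall>u\<in>SI i. u \<in> elts (y::'a) \<longleftrightarrow> (\<exists>z\<in>SI i. z \<in> elts x \<and> u \<in> elts z)"
  have u: "uf False SI CS (\<lambda>i (e :: nat \<Rightarrow> 'a::hst). ?P i)" by (intro ufi)
  have "?P False" unfolding SI_def
  proof (simp, intro ballI)
    fix x :: 'a assume "x \<in> Standard"
    then obtain y where "st y" "elts y \<inter> Standard = (\<Union>z\<in>elts x \<inter> Standard. elts z \<inter> Standard)"
      using std_union_ex[of x] unfolding st_iff by blast
    then show "\<exists>y\<in>Standard. \<forall>u\<in>Standard. (u \<in> elts y) = (\<exists>z\<in>Standard. z \<in> elts x \<and> u \<in> elts z)"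
      by (intro bexI[of _ y]) (auto simp: st_iff)
  qed
  from int_transfer_closed[OF u this] obtain y where
    y: "y \<in> Internal" "\<forall>u\<in>Internal. u \<in> elts y \<longleftrightarrow> (\<exists>z\<in>Internal. z \<in> elts x \<and> u \<in> elts z)"
    using assms by (auto simp: SI_def)
  have "u \<in> elts y \<longleftrightarrow> (\<exists>z\<in>elts x. u \<in> elts z)" for u
    using y(2) internal_trans[OF y(1), of u] internal_trans[OF assms] internal_trans[of _ u] by metis
  then show ?thesis using y(1) by blast
qed

lemma tpc_Internal: "tpc (\<lambda>_. Internal :: 'a::hst set)"
  unfolding tpc_def
proof (intro conjI allI ballI)
  show "elts x \<subseteq> Internal" if "x \<in> Internal" for x :: 'a using internal_trans[OF that] by blast
  show "upair x y \<in> Internal" if "x \<in> Internal" "y \<in> Internal" for x y :: 'a using int_pair that .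
  have un: "un x y \<in> Internal" if xy: "x \<in> Internal" "y \<in> Internal" for x y :: 'a
  proof -
    obtain z where z: "z \<in> Internal" "elts z = (\<Union>z\<in>elts (upair x y). elts z)"
      using int_Union[OF int_pair[OF xy]] by blast
    then have "un x y = z" by (intro Extensionality) auto
    then show ?thesis using z by simp
  qed
  then show "un x y \<in> Internal" if "x \<in> Internal" "y \<in> Internal" for x y :: 'a using that .
  show "ins x y \<in> Internal" if "x \<in> Internal" "y \<in> Internal" for x y :: 'a
  proof -
    have "ins x y = un (upair x x) y" by (intro Extensionality) auto
    then show ?thesis using un[OF int_pair[OF that(1) that(1)] that(2)] by simp
  qed
qed

lemma int_pow: assumes "x \<in> Internal" shows "\<exists>y\<in>Internal. elts (y::'a::hst) = {z\<in>Internal. elts z \<subseteq> elts x}"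
proof -
  let ?P = "\<lambda>i. \<forall>x\<in>SI i. \<exists>y\<in>SI i. \<forall>u\<in>SI i. u \<in> elts (y::'a) \<longleftrightarrow> (\<forall>z\<in>SI i. z \<in> elts u \<longrightarrow> z \<in> elts x)"
  have u: "uf False SI CS (\<lambda>i (e :: nat \<Rightarrow> 'a::hst). ?P i)" by (intro ufi)
  have "?P False" unfolding SI_def
  proof (simp, intro ballI)
    fix x :: 'a assume "x \<in> Standard"
    then obtain y where "y \<in> Standard" "elts y \<inter> Standard = {z \<in> Standard. elts z \<inter> Standard \<subseteq> elts x \<inter> Standard}"
      using ZFC_parts(4) by blast
    then show "\<exists>y\<in>Standard. \<forall>u\<in>Standard. (u \<in> elts y) = (\<forall>z\<in>Standard. z \<in> elts u \<longrightarrow> z \<in> elts x)"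
      by (intro bexI[of _ y]) auto
  qed
  from int_transfer_closed[OF u this] obtain y where
    y: "y \<in> Internal" "\<forall>u\<in>Internal. u \<in> elts y \<longleftrightarrow> (\<forall>z\<in>Internal. z \<in> elts u \<longrightarrow> z \<in> elts x)"
    using assms by (auto simp: SI_def)
  have "u \<in> elts y \<longleftrightarrow> u \<in> Internal \<and> elts u \<subseteq> elts x" for u
    using y(2) internal_trans[OF y(1), of u] internal_trans[of u] by blast
  then show ?thesis using y(1) by blast
qed

lemma int_reg: assumes "x \<in> Internal" "elts x \<noteq> {}" shows "\<exists>m\<in>elts (x::'a::hst). elts m \<inter> elts x = {}"
proof -
  let ?P = "\<lambda>i. \<forall>x\<in>SI i. (\<exists>u\<in>SI i. u \<in> elts x) \<longrightarrow> (\<exists>y\<in>SI i. y \<in> elts (x::'a) \<and> (\<forall>u\<in>SI i. u \<in> elts y \<longrightarrow> u \<notin> elts x))"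
  have u: "uf False SI CS (\<lambda>i (e :: nat \<Rightarrow> 'a::hst). ?P i)" by (intro ufi)
  have "?P False" unfolding SI_def
  proof (simp, intro ballI impI)
    fix x :: 'a assume "x \<in> Standard" "\<exists>u\<in>Standard. u \<in> elts x"
    then have "\<exists>y\<in>elts x \<inter> Standard. (elts y \<inter> Standard) \<inter> (elts x \<inter> Standard) = {}"
      by (intro std_reg) (auto simp: st_iff)
    then show "\<exists>y\<in>Standard. y \<in> elts x \<and> (\<forall>u\<in>Standard. u \<in> elts y \<longrightarrow> u \<notin> elts x)" by auto
  qed
  from int_transfer_closed[OF u this] have "(\<exists>u\<in>Internal. u \<in> elts x) \<longrightarrow>
      (\<exists>y\<in>Internal. y \<in> elts x \<and> (\<forall>u\<in>Internal. u \<in> elts y \<longrightarrow> u \<notin> elts x))"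
    using assms(1) by (simp add: SI_def)
  then show ?thesis using assms internal_trans by blast
qed

lemma WF_pow: assumes "x \<in> WF" shows "\<exists>y\<in>WF. elts (y::'a::hst) = {z\<in>WF. elts z \<subseteq> elts x}"
proof -
  let ?P = "\<lambda>i. \<forall>x\<in>WI i. \<exists>y\<in>WI i. \<forall>u\<in>WI i. u \<in> elts (y::'a) \<longleftrightarrow> (\<forall>z\<in>WI i. z \<in> elts u \<longrightarrow> z \<in> elts x)"
  have u: "uf False WI CW (\<lambda>i (e :: nat \<Rightarrow> 'a::hst). ?P i)" by (intro ufi)
  have "?P True" unfolding WI_simps
  proof
    fix x :: 'a assume "x \<in> Internal"
    then obtain y where y: "y \<in> Internal" "elts y = {z\<in>Internal. elts z \<subseteq> elts x}" using int_pow by blast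
    have "elts u \<subseteq> Internal" if "u \<in> Internal" for u :: 'a using internal_trans that by blast
    then show "\<exists>y\<in>Internal. \<forall>u\<in>Internal. (u \<in> elts y) = (\<forall>z\<in>Internal. z \<in> elts u \<longrightarrow> z \<in> elts x)"
      by (intro bexI[OF _ y(1)]) (unfold y(2), blast)
  qed
  then have "?P False" using star_transfer[OF u, of "\<lambda>_. omega"] omega_WF by auto
  then obtain y where
    y: "y \<in> WF" "\<forall>u\<in>WF. u \<in> elts y \<longleftrightarrow> (\<forall>z\<in>WF. z \<in> elts u \<longrightarrow> z \<in> elts x)"
    using assms unfolding WI_simps by blast
  have "u \<in> elts y \<longleftrightarrow> u \<in> WF \<and> elts u \<subseteq> elts x" for u
    using y(2) WF_trans[OF y(1), of u] WF_trans[of u] by blast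
  then show ?thesis using y(1) by blast
qed

lemma tpc_WI[ufi]: "tpc (WI :: bool \<Rightarrow> 'a::hst set)"
  unfolding tpc_def
proof
  fix i :: bool
  show "(\<forall>x\<in>WI i. elts x \<subseteq> (WI i :: 'a set)) \<and> (\<forall>x\<in>WI i. \<forall>y\<in>(WI i :: 'a set). upair x y \<in> WI i \<and> ins x y \<in> WI i \<and> un x y \<in> WI i)"
    using tpc_WF[where 'a = 'a and 'b = bool] tpc_Internal[where 'a = 'a and 'b = bool]
    unfolding tpc_def by (cases i) (simp_all add: WI_def)
qed

lemma CW_I[ufi]: "w \<in> WF \<Longrightarrow> (\<lambda>i. if i then star w else w) \<in> CW" unfolding CW_def by blast

lemma star_transfer0:
  assumes "uf False WI CW (\<lambda>i (e :: nat \<Rightarrow> 'a::hst). P i)" shows "P False \<longleftrightarrow> P True"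
  using star_transfer[OF assms, of "\<lambda>_. omega"] omega_WF by auto

abbreviation sw :: "'a::in_st \<Rightarrow> bool \<Rightarrow> 'a" where "sw w i \<equiv> (if i then star w else w)"

lemma tm_sw[ufi]: "w \<in> WF \<Longrightarrow> tm False WI CW (\<lambda>i e. sw (w::'a::hst) i)"
  using tm_const[OF consts_ok_CW CW_I] by blast

lemma zero_WF[simp, ufi]: "(zero::'a::hst) \<in> WF" by (rule WF_I) simp

lemma star_zero[simp]: "star zero = (zero::'a::hst)"
proof -
  have "uf False WI CW (\<lambda>i (e :: nat \<Rightarrow> 'a). \<forall>x\<in>WI i. x \<notin> elts (sw (zero::'a) i))" by (intro ufi)
  from star_transfer0[OF this] have "\<forall>x\<in>Internal. x \<notin> elts (star (zero::'a))" by (simp add: WI_simps)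
  then have "elts (star (zero::'a)) = {}" using internal_trans[OF star_int[OF zero_WF]] by blast
  then show ?thesis by (simp add: eq_zero_iff)
qed

interpretation W: nat_class False "WF :: 'a::hst set" omega
proof
  fix x :: 'a and P :: "'a \<Rightarrow> bool"
  assume "x \<in> WF" "uf False (\<lambda>_::unit. WF) (CD WF) (\<lambda>_ e. P (e 0))"
  then show "\<exists>y\<in>WF. elts y = {z\<in>elts x. P z}" by (intro sep_from_formula[OF WF_sep WF_trans])
next
  show "\<And>x::'a. zero \<in> elts x \<Longrightarrow> \<forall>n\<in>elts x. sc n \<in> elts x \<Longrightarrow> elts omega \<subseteq> elts x"
    by (rule omega_props(2)) (simp add: is_inductive_iff)
qed (use omega_WF tpc_WF in simp_all)

text \<open>\<open>omega\<close> is the least inductive set in \<open>WF\<close>; its star image is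
  least among the internal inductive sets, which is induction for internal predicates.\<close>

lemma hnat_props:
  shows "zero \<in> elts (hnat::'a::hst)" "n \<in> elts (hnat::'a) \<Longrightarrow> sc n \<in> elts (hnat::'a)"
    "x \<in> Internal \<Longrightarrow> zero \<in> elts x \<Longrightarrow> \<forall>n\<in>elts x. sc n \<in> elts x \<Longrightarrow> elts (hnat::'a) \<subseteq> elts x"
proof -
  have "uf False WI CW (\<lambda>i (e :: nat \<Rightarrow> 'a). sw zero i \<in> elts (sw (omega::'a) i))" by (intro ufi omega_WF)
  from star_transfer0[OF this] show "zero \<in> elts (hnat::'a)" by (simp add: hnat_def)
  have "uf False WI CW (\<lambda>i (e :: nat \<Rightarrow> 'a). \<forall>n\<in>elts (sw (omega::'a) i). sc n \<in> elts (sw omega i))" by (intro ufi omega_WF)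
  from star_transfer0[OF this] show "n \<in> elts (hnat::'a) \<Longrightarrow> sc n \<in> elts (hnat::'a)" by (simp add: hnat_def)
  have "uf False WI CW (\<lambda>i (e :: nat \<Rightarrow> 'a). \<forall>x\<in>WI i. sw (zero::'a) i \<in> elts x \<and> (\<forall>n\<in>elts x. sc n \<in> elts x) \<longrightarrow>
      elts (sw omega i) \<subseteq> elts x)" by (intro ufi omega_WF)
  from star_transfer0[OF this] show "x \<in> Internal \<Longrightarrow> zero \<in> elts x \<Longrightarrow> \<forall>n\<in>elts x. sc n \<in> elts x \<Longrightarrow> elts (hnat::'a) \<subseteq> elts x"
    using W.least_N unfolding hnat_def WI_simps by simp blast
qed

interpretation H: nat_class False "Internal :: 'a::hst set" hnat
proof
  fix x :: 'a and P :: "'a \<Rightarrow> bool"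
  assume "x \<in> Internal" "uf False (\<lambda>_::unit. Internal) (CD Internal) (\<lambda>_ e. P (e 0))"
  then show "\<exists>y\<in>Internal. elts y = {z\<in>elts x. P z}" by (intro sep_from_formula[OF int_sep internal_trans])
next
  show "tpc (\<lambda>_::unit. Internal :: 'a set)" by (rule tpc_Internal)
  show "hnat \<in> (Internal::'a set)" unfolding hnat_def by (rule star_int[OF omega_WF])
qed (rule hnat_props; assumption)+

section \<open>Finite Ramsey theory in a transitive class\<close>

text \<open>A colouring may give a set several colours here. The condition then passes to subsets
  with \<open>c\<close> unchanged, and derived colourings need no restriction to the right
  domain.\<close>

definition tot :: "'a::in_st set \<Rightarrow> 'a \<Rightarrow> 'a \<Rightarrow> 'a \<Rightarrow> 'a \<Rightarrow> bool" where
  "tot D c X n s \<longleftrightarrow> (\<forall>w\<in>D. elts w \<subseteq> elts X \<and> sz D w n \<longrightarrow> (\<exists>i\<in>elts s. rel c w i))"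

definition hom :: "'a::in_st set \<Rightarrow> 'a \<Rightarrow> 'a \<Rightarrow> 'a \<Rightarrow> 'a \<Rightarrow> bool" where
  "hom D c H n s \<longleftrightarrow> (\<exists>i\<in>elts s. \<forall>w\<in>D. elts w \<subseteq> elts H \<and> sz D w n \<longrightarrow> rel c w i)"

definition RP :: "'a::in_st set \<Rightarrow> 'a \<Rightarrow> 'a \<Rightarrow> 'a \<Rightarrow> 'a \<Rightarrow> bool" where
  "RP D l s n k \<longleftrightarrow> (\<forall>X\<in>D. sz D X k \<longrightarrow> (\<forall>c\<in>D. tot D c X n s \<longrightarrow>
     (\<exists>H\<in>D. elts H \<subseteq> elts X \<and> sz D H l \<and> hom D c H n s)))"

definition fcol :: "'a::in_st set \<Rightarrow> 'a \<Rightarrow> 'a \<Rightarrow> 'a \<Rightarrow> 'a \<Rightarrow> bool" where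
  "fcol D c X n s \<longleftrightarrow> (\<forall>p\<in>elts c. \<exists>w\<in>D. \<exists>i\<in>elts s. p = opair w i \<and> elts w \<subseteq> elts X \<and> sz D w n) \<and>
     (\<forall>w\<in>D. elts w \<subseteq> elts X \<and> sz D w n \<longrightarrow> (\<exists>i\<in>elts s. rel c w i \<and> (\<forall>j\<in>elts s. rel c w j \<longrightarrow> j = i)))"

text \<open>Unlike \<open>hom\<close> this names no common colour, so it holds vacuously when there
  is nothing to colour, even for \<open>s\<close> empty. This matches the comparison of values in
  \<open>ramsey_good\<close>.\<close>

definition homf :: "'a::in_st set \<Rightarrow> 'a \<Rightarrow> 'a \<Rightarrow> 'a \<Rightarrow> 'a \<Rightarrow> bool" where
  "homf D c H n s \<longleftrightarrow> (\<forall>w\<in>D. \<forall>v\<in>D. elts w \<subseteq> elts H \<and> sz D w n \<and> elts v \<subseteq> elts H \<and> sz D v n \<longrightarrow>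
     (\<forall>i\<in>elts s. \<forall>j\<in>elts s. rel c w i \<longrightarrow> rel c v j \<longrightarrow> i = j))"

definition good :: "'a::in_st set \<Rightarrow> 'a \<Rightarrow> 'a \<Rightarrow> 'a \<Rightarrow> 'a \<Rightarrow> bool" where
  "good D l s n k \<longleftrightarrow> (\<forall>c\<in>D. fcol D c k n s \<longrightarrow> (\<exists>H\<in>D. elts H \<subseteq> elts k \<and> sz D H l \<and> homf D c H n s))"

text \<open>\<open>h\<close> colours points so that each \<open>n+1\<close>-set owes its colour to
  one of its points. Confining the domain of \<open>h\<close> to \<open>F\<close> allows it to be
  extended at a new point.\<close>

definition prehom :: "'a::in_st set \<Rightarrow> 'a \<Rightarrow> 'a \<Rightarrow> 'a \<Rightarrow> 'a \<Rightarrow> bool" where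
  "prehom D c F n s \<longleftrightarrow> (\<exists>h\<in>D. (\<forall>a\<in>D. \<forall>i\<in>D. rel h a i \<longrightarrow> a \<in> elts F) \<and> (\<forall>a\<in>elts F. \<exists>i\<in>elts s. rel h a i) \<and>
       (\<forall>y\<in>D. elts y \<subseteq> elts F \<and> sz D y (sc n) \<longrightarrow> (\<exists>a\<in>elts y. \<forall>i\<in>elts s. rel h a i \<longrightarrow> rel c y i)))"

lemma uf_prehom[ufi]:
  fixes D :: "'i \<Rightarrow> 'a::hst set"
  assumes "tpc D" "tm b D C t" "tm b D C s" "tm b D C u" "tm b D C v"
  shows "uf b D C (\<lambda>i e. prehom (D i) (t i e) (s i e) (u i e) (v i e))"
proof -
  note c = tm_consts[OF assms(2)]
  show ?thesis by (rule uf_lift4[OF _ assms(2-5)]) (unfold prehom_def, intro ufi assms c)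
qed

lemma uf_tot[ufi]:
  fixes D :: "'i \<Rightarrow> 'a::hst set"
  assumes "tpc D" "tm b D C t" "tm b D C s" "tm b D C u" "tm b D C v"
  shows "uf b D C (\<lambda>i e. tot (D i) (t i e) (s i e) (u i e) (v i e))"
proof -
  note c = tm_consts[OF assms(2)]
  show ?thesis by (rule uf_lift4[OF _ assms(2-5)]) (unfold tot_def, intro ufi assms c)
qed

lemma uf_hom[ufi]:
  fixes D :: "'i \<Rightarrow> 'a::hst set"
  assumes "tpc D" "tm b D C t" "tm b D C s" "tm b D C u" "tm b D C v"
  shows "uf b D C (\<lambda>i e. hom (D i) (t i e) (s i e) (u i e) (v i e))"
proof -
  note c = tm_consts[OF assms(2)]
  show ?thesis by (rule uf_lift4[OF _ assms(2-5)]) (unfold hom_def, intro ufi assms c)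
qed

lemma uf_RP[ufi]:
  fixes D :: "'i \<Rightarrow> 'a::hst set"
  assumes "tpc D" "tm b D C t" "tm b D C s" "tm b D C u" "tm b D C v"
  shows "uf b D C (\<lambda>i e. RP (D i) (t i e) (s i e) (u i e) (v i e))"
proof -
  note c = tm_consts[OF assms(2)]
  show ?thesis by (rule uf_lift4[OF _ assms(2-5)]) (unfold RP_def, intro ufi assms c)
qed

lemma uf_fcol[ufi]:
  fixes D :: "'i \<Rightarrow> 'a::hst set"
  assumes "tpc D" "tm b D C t" "tm b D C s" "tm b D C u" "tm b D C v"
  shows "uf b D C (\<lambda>i e. fcol (D i) (t i e) (s i e) (u i e) (v i e))"
proof -
  note c = tm_consts[OF assms(2)]
  show ?thesis by (rule uf_lift4[OF _ assms(2-5)]) (unfold fcol_def, intro ufi assms c)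
qed

lemma uf_homf[ufi]:
  fixes D :: "'i \<Rightarrow> 'a::hst set"
  assumes "tpc D" "tm b D C t" "tm b D C s" "tm b D C u" "tm b D C v"
  shows "uf b D C (\<lambda>i e. homf (D i) (t i e) (s i e) (u i e) (v i e))"
proof -
  note c = tm_consts[OF assms(2)]
  show ?thesis by (rule uf_lift4[OF _ assms(2-5)]) (unfold homf_def, intro ufi assms c)
qed

lemma uf_good[ufi]:
  fixes D :: "'i \<Rightarrow> 'a::hst set"
  assumes "tpc D" "tm b D C t" "tm b D C s" "tm b D C u" "tm b D C v"
  shows "uf b D C (\<lambda>i e. good (D i) (t i e) (s i e) (u i e) (v i e))"
proof -
  note c = tm_consts[OF assms(2)]
  show ?thesis by (rule uf_lift4[OF _ assms(2-5)]) (unfold good_def, intro ufi assms c)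
qed

text \<open>Power Set turns products and definable relations into elements of \<open>D\<close>.
  Regularity is what makes \<open>is_ordinal\<close>, which only asks for a transitive linear order
  by membership, a well-order on sets of \<open>D\<close>.\<close>

locale nat_pow_class = nat_class +
  assumes pow: "x \<in> D \<Longrightarrow> \<exists>y\<in>D. elts y = {z\<in>D. elts z \<subseteq> elts x}"
    and reg: "x \<in> D \<Longrightarrow> elts x \<noteq> {} \<Longrightarrow> \<exists>m\<in>elts x. elts m \<inter> elts x = {}"
begin

section \<open>Definable relations, and agreement with \<open>card_in\<close>\<close>

lemma prod_ex: assumes "x \<in> D" "y \<in> D" shows "\<exists>P\<in>D. elts P = {p. \<exists>a\<in>elts x. \<exists>c\<in>elts y. p = opair a c}"
proof -
  obtain Q where Q: "Q \<in> D" "elts Q = {z\<in>D. elts z \<subseteq> elts (un x y)}" using pow[OF unD[OF assms]] by blast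
  obtain R where R: "R \<in> D" "elts R = {z\<in>D. elts z \<subseteq> elts Q}" using pow[OF Q(1)] by blast
  obtain P where P: "P \<in> D" "elts P = {p\<in>elts R. \<exists>a\<in>elts x. \<exists>c\<in>elts y. p = opair a c}"
    by (rule sepE[OF R(1), of "\<lambda>p. \<exists>a\<in>elts x. \<exists>c\<in>elts y. p = opair a c"]) (intro ufi assms)+
  have "opair a c \<in> elts R" if ac: "a \<in> elts x" "c \<in> elts y" for a c
  proof -
    have "a \<in> D" "c \<in> D" using ac transD assms by blast+
    then show ?thesis unfolding R(2) Q(2) opair_upair using ac by simp
  qed
  then show ?thesis using P by blast
qed

lemma relsep:
  assumes "x \<in> D" "y \<in> D" "dD (\<lambda>e. R (e (Suc 0)) (e 0))"
  shows "\<exists>f\<in>D. (\<forall>u v. rel f u v \<longleftrightarrow> u \<in> elts x \<and> v \<in> elts y \<and> R u v) \<and>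
    (\<forall>p\<in>elts f. \<exists>u\<in>elts x. \<exists>v\<in>elts y. p = opair u v)"
proof -
  obtain P where P: "P \<in> D" "elts P = {p. \<exists>a\<in>elts x. \<exists>c\<in>elts y. p = opair a c}" using prod_ex assms by blast
  obtain f where f: "f \<in> D" "elts f = {p\<in>elts P. \<exists>a\<in>elts x. \<exists>c\<in>elts y. p = opair a c \<and> R a c}"
    by (rule sepE[OF P(1), of "\<lambda>p. \<exists>a\<in>elts x. \<exists>c\<in>elts y. p = opair a c \<and> R a c"])
      (rule uf_elts_bex uf_conj uf_eq tm_opair tm_var tm_const tpcD consts_okD CD_I assms(1,2) assms(3))+
  have "rel f u v \<longleftrightarrow> u \<in> elts x \<and> v \<in> elts y \<and> R u v" for u v
    unfolding rel_def f(2) P(2) by auto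
  moreover have "\<exists>u\<in>elts x. \<exists>v\<in>elts y. p = opair u v" if "p \<in> elts f" for p
    using that unfolding f(2) by blast
  ultimately show ?thesis using f(1) by blast
qed

text \<open>A definable one-to-one correspondence becomes a set by \<open>relsep\<close>, and
  \<open>sz_bij\<close> then carries the size over.\<close>

lemma sz_img:
  assumes "x \<in> D" "y \<in> D" "dD (\<lambda>e. R (e (Suc 0)) (e 0))" "n \<in> elts N" "sz D x n"
    "\<And>u. u \<in> elts x \<Longrightarrow> \<exists>v\<in>elts y. R u v" "\<And>v. v \<in> elts y \<Longrightarrow> \<exists>u\<in>elts x. R u v"
    "\<And>u v w. u \<in> elts x \<Longrightarrow> v \<in> elts y \<Longrightarrow> w \<in> elts y \<Longrightarrow> R u v \<Longrightarrow> R u w \<Longrightarrow> v = w"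
    "\<And>u v w. u \<in> elts x \<Longrightarrow> v \<in> elts x \<Longrightarrow> w \<in> elts y \<Longrightarrow> R u w \<Longrightarrow> R v w \<Longrightarrow> u = v"
  shows "sz D y n"
proof -
  obtain f where f: "f \<in> D" "\<forall>u v. rel f u v \<longleftrightarrow> u \<in> elts x \<and> v \<in> elts y \<and> R u v"
    "\<forall>p\<in>elts f. \<exists>u\<in>elts x. \<exists>v\<in>elts y. p = opair u v" using relsep[OF assms(1-3)] by blast
  have r: "rel f u v \<longleftrightarrow> u \<in> elts x \<and> v \<in> elts y \<and> R u v" for u v using f(2) by blast
  have "bijr f x y"
  proof (rule bijrI)
    show "\<exists>a\<in>elts x. \<exists>c\<in>elts y. p = opair a c" if "p \<in> elts f" for p using f(3) that by blast
    show "\<exists>v. rel f u v" if "u \<in> elts x" for u using assms(6)[OF that] that unfolding r by blast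
    show "\<exists>u. rel f u v" if "v \<in> elts y" for v using assms(7)[OF that] that unfolding r by blast
    show "v = w" if "rel f u v" "rel f u w" for u v w using that assms(8) unfolding r by blast
    show "u = v" if "rel f u w" "rel f v w" for u v w using that assms(9) unfolding r by blast
  qed
  then show ?thesis using sz_bij[OF assms(4,1,2) f(1) _ assms(5)] by blast
qed

text \<open>The description in \<open>card_in\<close> ranges over all ordinals \<open>c\<close> of
  \<open>D\<close>. Induction on \<open>n\<close> makes \<open>c\<close> comparable with
  \<open>n\<close>; then \<open>c\<close> below \<open>n\<close> contradicts uniqueness of sizes and
  \<open>n\<close> below \<open>c\<close> contradicts the minimality of \<open>c\<close>.\<close>

lemma card_eq:
  assumes "x \<in> D" "n \<in> elts N" "sz D x n" shows "card_in D x = n"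
proof -
  have bij: "(\<exists>f\<in>D. is_bijection f u v) \<longleftrightarrow> sz D u v" for u v unfolding is_bijection_iff sz_def by simp
  have ordN: "is_ordinal k" if "k \<in> elts N" for k
  proof -
    have "transitive k" unfolding transitive_def using N_transitive[OF that] by blast
    then show ?thesis unfolding is_ordinal_def using N_linear N_elts[OF that] by blast
  qed
  show ?thesis unfolding card_in_def bij
  proof (rule the_equality)
    have "\<not> sz D x d" if "d \<in> elts n" for d
      using sz_unique[OF assms(2) N_elts[OF assms(2) that] assms(1,3)] N_irrefl[OF assms(2)] that by blast
    then show "n \<in> D \<and> is_ordinal n \<and> sz D x n \<and> (\<forall>d\<in>elts n. \<not> sz D x d)" using assms ordN by auto
  next
    fix c assume c: "c \<in> D \<and> is_ordinal c \<and> sz D x c \<and> (\<forall>d\<in>elts c. \<not> sz D x d)"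
    then have cD: "c \<in> D" and tr: "\<And>u v. u \<in> elts c \<Longrightarrow> v \<in> elts u \<Longrightarrow> v \<in> elts c"
      and lin: "\<And>u v. u \<in> elts c \<Longrightarrow> v \<in> elts c \<Longrightarrow> u \<in> elts v \<or> u = v \<or> v \<in> elts u"
      unfolding is_ordinal_def transitive_def by blast+
    have "c \<in> elts n \<or> c = n \<or> n \<in> elts c"
    proof (rule ind[of n "\<lambda>n. c \<in> elts n \<or> c = n \<or> n \<in> elts c", OF assms(2)])
      show "c \<in> elts zero \<or> c = zero \<or> zero \<in> elts c"
      proof (cases "elts c = {}")
        case True then show ?thesis by (simp add: eq_zero_iff)
      next
        case False
        then obtain m where m: "m \<in> elts c" "elts m \<inter> elts c = {}" using reg cD by blast
        then have "elts m = {}" using tr by blast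
        then show ?thesis using m by (simp add: eq_zero_iff)
      qed
    next
      fix k assume k: "k \<in> elts N" "c \<in> elts k \<or> c = k \<or> k \<in> elts c"
      show "c \<in> elts (sc k) \<or> c = sc k \<or> sc k \<in> elts c"
      proof (cases "k \<in> elts c")
        case True
        then have sub: "elts (sc k) \<subseteq> elts c" using tr by auto
        show ?thesis
        proof (cases "sc k = c")
          case False
          \<comment> \<open>Regularity picks the least element of the part of \<open>c\<close>
            beyond \<open>sc k\<close>; this element turns out to be \<open>sc k\<close>.\<close>
          obtain z where z: "z \<in> D" "elts z = elts c - elts (sc k)" using diffD[OF cD, of "sc k"] k by auto
          have "elts z \<noteq> {}" using False sub z by (metis Diff_eq_empty_iff elts_eq_iff subset_antisym)
          then obtain m where m: "m \<in> elts z" "elts m \<inter> elts z = {}" using reg z by blast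
          have mc: "m \<in> elts c" "m \<notin> elts (sc k)" using m z by auto
          have skt: "v \<in> elts (sc k)" if "u \<in> elts (sc k)" "v \<in> elts u" for u v
            using N_transitive[OF sc_N[OF k(1)]] that by blast
          have "v \<in> elts m \<longleftrightarrow> v \<in> elts (sc k)" for v
          proof
            assume "v \<in> elts m" then show "v \<in> elts (sc k)" using m z tr[OF mc(1)] by blast
          next
            assume v: "v \<in> elts (sc k)"
            then have "v \<in> elts m \<or> v = m \<or> m \<in> elts v" using lin sub mc by blast
            then show "v \<in> elts m" using mc(2) v skt by blast
          qed
          then have "m = sc k" by (intro Extensionality) blast
          then show ?thesis using mc by simp
        qed simp
      qed (use k in auto)
    qed (intro ufi cD)
    moreover have "c \<notin> elts n"
      using sz_unique[OF assms(2) N_elts[OF assms(2)] assms(1,3)] N_irrefl[OF assms(2)] c by blast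
    moreover have "n \<notin> elts c" using c assms by blast
    ultimately show "c = n" by blast
  qed
qed

text \<open>Subsets of a finite \<open>A\<close> are finite, so the description in
  \<open>card_in\<close> denotes their size.\<close>

lemma card_iff:
  assumes "A \<in> D" "k \<in> elts N" "sz D A k" "n \<in> elts N" "x \<in> D" "elts x \<subseteq> elts A"
  shows "card_in D x = n \<longleftrightarrow> sz D x n"
proof -
  obtain m where m: "m \<in> elts N" "sz D x m" using sz_subset[OF assms(2,1,3,5,6)] by blast
  then show ?thesis using card_eq[OF assms(5) m] sz_unique[OF m(1) assms(4,5) m(2)] by auto
qed

lemma nsub_eq:
  assumes "A \<in> D" "k \<in> elts N" "sz D A k" "n \<in> elts N"
  shows "elts (nsubsets_in D A n) = {x\<in>D. elts x \<subseteq> elts A \<and> sz D x n}" and "nsubsets_in D A n \<in> D"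
proof -
  obtain Q where Q: "Q \<in> D" "elts Q = {z\<in>D. elts z \<subseteq> elts A}" using pow[OF assms(1)] by blast
  obtain y where y: "y \<in> D" "elts y = {z\<in>elts Q. sz D z n}"
    by (rule sepE[OF Q(1), of "\<lambda>z. sz D z n"]) (intro ufi N_D assms)+
  have "elts y = {x\<in>D. elts x \<subseteq> elts A \<and> card_in D x = n}" unfolding y(2) Q(2) using card_iff[OF assms] by blast
  then have "nsubsets_in D A n = y" unfolding nsubsets_in_def by (rule set_of_eqI)
  then show "nsubsets_in D A n \<in> D" "elts (nsubsets_in D A n) = {x\<in>D. elts x \<subseteq> elts A \<and> sz D x n}"
    using y Q(2) by auto
qed

text \<open>Matches the form that definability and transfer can handle with the functions that occur
  in \<open>ramsey_good\<close>.\<close>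

lemma fcol_iff:
  assumes "A \<in> D" "k \<in> elts N" "sz D A k" "n \<in> elts N" "c \<in> D"
  shows "fcol D c A n s \<longleftrightarrow> is_function c \<and> fdom c = elts (nsubsets_in D A n) \<and> frange c \<subseteq> elts s"
proof
  assume *: "fcol D c A n s"
  have p: "\<exists>w\<in>D. \<exists>i\<in>elts s. p = opair w i \<and> elts w \<subseteq> elts A \<and> sz D w n" if "p \<in> elts c" for p
    using * that unfolding fcol_def by blast
  have r: "w \<in> D \<and> i \<in> elts s \<and> elts w \<subseteq> elts A \<and> sz D w n" if "rel c w i" for w i
    using p[of "opair w i"] that unfolding rel_def by auto
  have q: "\<exists>i\<in>elts s. rel c w i \<and> (\<forall>j\<in>elts s. rel c w j \<longrightarrow> j = i)" if "w \<in> D" "elts w \<subseteq> elts A" "sz D w n" for w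
    using * that unfolding fcol_def by blast
  have "is_function c"
  proof (rule is_functionI)
    show "\<exists>x y. p = opair x y" if "p \<in> elts c" for p using p that by blast
    show "y = z" if "rel c x y" "rel c x z" for x y z using q[of x] r[OF that(1)] r[OF that(2)] that by blast
  qed
  moreover have "fdom c = elts (nsubsets_in D A n)"
    unfolding nsub_eq[OF assms(1-4)] set_eq_iff fdom_rel using r q by blast
  moreover have "frange c \<subseteq> elts s" by (auto simp: frange_rel dest: r)
  ultimately show "is_function c \<and> fdom c = elts (nsubsets_in D A n) \<and> frange c \<subseteq> elts s" by blast
next
  assume *: "is_function c \<and> fdom c = elts (nsubsets_in D A n) \<and> frange c \<subseteq> elts s"
  then have f: "is_function c" by blast
  have d: "(\<exists>y. rel c w y) \<longleftrightarrow> w \<in> D \<and> elts w \<subseteq> elts A \<and> sz D w n" for w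
    using * unfolding nsub_eq[OF assms(1-4)] set_eq_iff fdom_rel by blast
  have r: "i \<in> elts s" if "rel c w i" for w i using * frange_rel[of i c] that by blast
  show "fcol D c A n s" unfolding fcol_def
  proof (intro conjI ballI impI)
    fix p assume p: "p \<in> elts c"
    then obtain w i where wi: "p = opair w i" using is_functionD(1)[OF f] by blast
    then have "rel c w i" using p by (simp add: rel_def)
    then show "\<exists>w\<in>D. \<exists>i\<in>elts s. p = opair w i \<and> elts w \<subseteq> elts A \<and> sz D w n" using wi d r by blast
  next
    fix w assume "w \<in> D" "elts w \<subseteq> elts A \<and> sz D w n"
    then obtain i where "rel c w i" using d by blast
    then show "\<exists>i\<in>elts s. rel c w i \<and> (\<forall>j\<in>elts s. rel c w j \<longrightarrow> j = i)"
      using r is_functionD(2)[OF f] by blast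
  qed
qed

text \<open>The bound constructed is the sum of \<open>k0\<close> and \<open>l\<close>, one step for
  each element taken from \<open>Y\<close>. The invariant that it is at least \<open>k0\<close>
  settles the case where \<open>Y\<close> is empty.\<close>

lemma split_finite:
  assumes "l \<in> elts N" "k0 \<in> elts N"
  shows "\<exists>k\<in>elts N. k0 \<in> elts (sc k) \<and> (\<forall>X\<in>D. sz D X k \<longrightarrow> (\<forall>Y\<in>D. elts Y \<subseteq> elts X \<longrightarrow>
     (\<exists>H\<in>D. elts H \<subseteq> elts Y \<and> sz D H l) \<or> (\<exists>H\<in>D. elts H \<subseteq> elts X \<and> (\<forall>z\<in>elts H. z \<notin> elts Y) \<and> sz D H k0)))"
    (is "?P l")
proof -
  have k0D: "k0 \<in> D" using assms by simp
  show ?thesis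
  proof (rule ind[of l ?P, OF assms(1)])
    show "?P zero"
      using assms(2) by (intro bexI[of _ k0] conjI ballI impI disjI1 bexI[of _ zero]) auto
  next
    fix l assume l: "l \<in> elts N" and "?P l"
    then obtain k where k: "k \<in> elts N" "k0 \<in> elts (sc k)" and
      IH: "\<And>X Y. X \<in> D \<Longrightarrow> sz D X k \<Longrightarrow> Y \<in> D \<Longrightarrow> elts Y \<subseteq> elts X \<Longrightarrow>
     (\<exists>H\<in>D. elts H \<subseteq> elts Y \<and> sz D H l) \<or> (\<exists>H\<in>D. elts H \<subseteq> elts X \<and> (\<forall>z\<in>elts H. z \<notin> elts Y) \<and> sz D H k0)" by blast
    have k': "k0 \<in> elts (sc (sc k))" using k(2) by simp
    have "(\<exists>H\<in>D. elts H \<subseteq> elts Y \<and> sz D H (sc l)) \<or> (\<exists>H\<in>D. elts H \<subseteq> elts X \<and> (\<forall>z\<in>elts H. z \<notin> elts Y) \<and> sz D H k0)"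
      if X: "X \<in> D" "sz D X (sc k)" "Y \<in> D" "elts Y \<subseteq> elts X" for X Y
    proof (cases "elts Y = {}")
      case True
      obtain H where "H \<in> D" "elts H \<subseteq> elts X" "sz D H k0" using sz_sub_ex[OF sc_N[OF k(1)] k' X(1,2)] by blast
      then show ?thesis using True by blast
    next
      case False
      then obtain a where a: "a \<in> elts Y" by blast
      have aD: "a \<in> D" using transD X(3) a by blast
      have aX: "a \<in> elts X" using X(4) a by blast
      note eX = elts_rem[OF X(1) aD] and eY = elts_rem[OF X(3) aD]
      consider H where "H \<in> D" "elts H \<subseteq> elts (rem Y a)" "sz D H l" |
        H where "H \<in> D" "elts H \<subseteq> elts (rem X a)" "\<forall>z\<in>elts H. z \<notin> elts (rem Y a)" "sz D H k0"
        using IH[OF remD(1)[OF X(1) aD] sz_rem[OF X(2,1) aX k(1)] remD(1)[OF X(3) aD]] eX eY X(4) by blast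
      then show ?thesis
      proof cases
        case 1
        then have "sz D (ins a H) (sc l)" using eY aD l by (intro sz_ins) auto
        moreover have "elts (ins a H) \<subseteq> elts Y" using 1 eY a by auto
        ultimately show ?thesis using 1(1) aD insD by blast
      next
        case 2
        then show ?thesis unfolding eX eY by blast
      qed
    qed
    then show "?P (sc l)" using k(1) k' by (intro bexI[of _ "sc k"] conjI ballI impI) simp_all
  qed (intro ufi k0D)
qed

text \<open>Induction on the number of colours: either \<open>l\<close> elements have the last
  colour, or enough elements avoid it and use only the previous colours.\<close>

lemma pigeonhole:
  assumes "s \<in> elts N" "l \<in> elts N"
  shows "\<exists>k\<in>elts N. \<forall>X\<in>D. sz D X k \<longrightarrow> (\<forall>h\<in>D. (\<forall>a\<in>elts X. \<exists>i\<in>elts s. rel h a i) \<longrightarrow>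
     (\<exists>i\<in>elts s. \<exists>H\<in>D. elts H \<subseteq> elts X \<and> sz D H l \<and> (\<forall>a\<in>elts H. rel h a i)))"
    (is "?P s")
proof -
  have lD: "l \<in> D" using assms by simp
  show ?thesis
  proof (rule ind[of s ?P, OF assms(1)])
    \<comment> \<open>Without colours no nonempty set can be coloured, so the bound 1 works.\<close>
    have "False" if X: "sz D X (sc zero)" "\<forall>a\<in>elts X. \<exists>i\<in>elts zero. rel h a i" for X h
      using sz_sc_ex[OF X(1)] X(2) by simp
    then show "?P zero" by (intro bexI[of _ "sc zero"]) (blast, simp)
  next
    fix s assume s: "s \<in> elts N" and "?P s"
    then obtain k0 where k0: "k0 \<in> elts N" and IH: "\<And>X h. X \<in> D \<Longrightarrow> sz D X k0 \<Longrightarrow> h \<in> D \<Longrightarrow>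
       (\<forall>a\<in>elts X. \<exists>i\<in>elts s. rel h a i) \<Longrightarrow>
     (\<exists>i\<in>elts s. \<exists>H\<in>D. elts H \<subseteq> elts X \<and> sz D H l \<and> (\<forall>a\<in>elts H. rel h a i))" by blast
    obtain k where k: "k \<in> elts N" and sp: "\<And>X Y. X \<in> D \<Longrightarrow> sz D X k \<Longrightarrow> Y \<in> D \<Longrightarrow> elts Y \<subseteq> elts X \<Longrightarrow>
     (\<exists>H\<in>D. elts H \<subseteq> elts Y \<and> sz D H l) \<or> (\<exists>H\<in>D. elts H \<subseteq> elts X \<and> (\<forall>z\<in>elts H. z \<notin> elts Y) \<and> sz D H k0)"
      using split_finite[OF assms(2) k0] by blast
    have "\<exists>i\<in>elts (sc s). \<exists>H\<in>D. elts H \<subseteq> elts X \<and> sz D H l \<and> (\<forall>a\<in>elts H. rel h a i)"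
      if X: "X \<in> D" "sz D X k" "h \<in> D" "\<forall>a\<in>elts X. \<exists>i\<in>elts (sc s). rel h a i" for X h
    proof -
      obtain Y where Y: "Y \<in> D" "elts Y = {a\<in>elts X. rel h a s}"
        by (rule sepE[OF X(1), of "\<lambda>a. rel h a s"]) (intro ufi X N_D s)+
      consider H where "H \<in> D" "elts H \<subseteq> elts Y" "sz D H l" |
        H where "H \<in> D" "elts H \<subseteq> elts X" "\<forall>z\<in>elts H. z \<notin> elts Y" "sz D H k0"
        using sp[OF X(1,2) Y(1)] Y(2) by blast
      then show ?thesis
      proof cases
        case 1
        then show ?thesis unfolding Y(2) elts_sc by blast
      next
        case 2
        have "\<exists>i\<in>elts s. rel h a i" if a: "a \<in> elts H" for a
        proof -
          have "\<not> rel h a s" "a \<in> elts X" using a 2 Y(2) by blast+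
          then show ?thesis using X(4) unfolding elts_sc by blast
        qed
        then obtain i H' where "i \<in> elts s" "H' \<in> D" "elts H' \<subseteq> elts H" "sz D H' l" "\<forall>a\<in>elts H'. rel h a i"
          using IH[OF 2(1,4) X(3)] by blast
        then show ?thesis using 2(2) unfolding elts_sc by blast
      qed
    qed
    then show "?P (sc s)" using k by blast
  qed (intro ufi lD)
qed

text \<open>The Erdos-Rado argument, without an ordering: instead of the first element of an
  \<open>n+1\<close>-set, some element of it determines the colour.\<close>

lemma prehomogeneous:
  assumes "n \<in> elts N" "s \<in> elts N" "\<And>l. l \<in> elts N \<Longrightarrow> \<exists>k\<in>elts N. RP D l s n k" "m \<in> elts N"
  shows "\<exists>k\<in>elts N. \<forall>X\<in>D. sz D X k \<longrightarrow> (\<forall>c\<in>D. tot D c X (sc n) s \<longrightarrow> (\<exists>F\<in>D. elts F \<subseteq> elts X \<and> sz D F m \<and> prehom D c F n s))"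
    (is "?P m")
proof -
  have nD: "n \<in> D" "s \<in> D" using assms by simp_all
  show ?thesis
  proof (rule ind[of m ?P, OF assms(4)])
    have "y \<notin> D" if "elts y \<subseteq> elts zero" "sz D y (sc n)" for y using sz_sc_ex[OF that(2)] that(1) by auto
    moreover have "\<not> rel zero a i" for a i :: 'a by (simp add: rel_def)
    ultimately show "?P zero"
      unfolding prehom_def by (intro bexI[of _ zero] ballI impI conjI) (auto simp: sz_zero_iff)
  next
    fix m assume m: "m \<in> elts N" and "?P m"
    then obtain km where km: "km \<in> elts N" and IH: "\<And>X c. X \<in> D \<Longrightarrow> sz D X km \<Longrightarrow> c \<in> D \<Longrightarrow> tot D c X (sc n) s \<Longrightarrow>
      (\<exists>F\<in>D. elts F \<subseteq> elts X \<and> sz D F m \<and> prehom D c F n s)" by blast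
    \<comment> \<open>\<open>km\<close> elements are needed to carry out \<open>m\<close> further
      selections; \<open>K\<close> guarantees that many in a homogeneous set for the colouring
      induced by the point about to be selected.\<close>
    obtain K where K: "K \<in> elts N" "RP D km s n K" using assms(3)[OF km] by blast
    have "\<exists>F\<in>D. elts F \<subseteq> elts X \<and> sz D F (sc m) \<and>
     prehom D c F n s"
      if X: "X \<in> D" "sz D X (sc K)" "c \<in> D" "tot D c X (sc n) s" for X c
    proof -
      obtain a where a: "a \<in> elts X" using sz_sc_ex[OF X(2)] by blast
      have aD: "a \<in> D" using transD X(1) a by blast
      define X' where "X' = rem X a"
      have X': "X' \<in> D" "elts X' = elts X - {a}" "sz D X' K"
        unfolding X'_def using remD(1)[OF X(1) aD] elts_rem[OF X(1) aD] sz_rem[OF X(2,1) a K(1)] by blast+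
      obtain Q where Q: "Q \<in> D" "elts Q = {z\<in>D. elts z \<subseteq> elts X'}" using pow[OF X'(1)] by blast
      \<comment> \<open>The induced colouring of \<open>n\<close>-sets: the colour of
        \<open>w\<close> is that of \<open>w\<close> together with the selected point
        \<open>a\<close>.\<close>
      have "dD (\<lambda>e. rel c (ins a (e (Suc 0))) (e 0))" by (intro ufi X aD)
      from relsep[OF Q(1) nD(2) this] obtain ca where ca: "ca \<in> D"
        "\<And>w i. rel ca w i \<longleftrightarrow> w \<in> elts Q \<and> i \<in> elts s \<and> rel c (ins a w) i" by blast
      have "tot D ca X' n s" unfolding tot_def
      proof (intro ballI impI)
        fix w assume w: "w \<in> D" "elts w \<subseteq> elts X' \<and> sz D w n"
        then have "sz D (ins a w) (sc n)" using X'(2) aD assms(1) by (intro sz_ins) auto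
        moreover have "elts (ins a w) \<subseteq> elts X" "ins a w \<in> D" using w a X'(2) aD by auto
        ultimately obtain i where "i \<in> elts s" "rel c (ins a w) i" using X(4) unfolding tot_def by blast
        then show "\<exists>i\<in>elts s. rel ca w i" using ca(2) w Q(2) by blast
      qed
      then obtain H where H: "H \<in> D" "elts H \<subseteq> elts X'" "sz D H km" "hom D ca H n s"
        using K(2) X'(1,3) ca(1) unfolding RP_def by blast
      obtain i where i: "i \<in> elts s" "\<And>w. w \<in> D \<Longrightarrow> elts w \<subseteq> elts H \<Longrightarrow> sz D w n \<Longrightarrow> rel ca w i"
        using H(4) unfolding hom_def by blast
      have "tot D c H (sc n) s" using X(4) H(2) X'(2) unfolding tot_def by blast
      then obtain F h where F: "F \<in> D" "elts F \<subseteq> elts H" "sz D F m" "h \<in> D"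
        and h: "\<forall>a\<in>D. \<forall>i\<in>D. rel h a i \<longrightarrow> a \<in> elts F" "\<forall>a\<in>elts F. \<exists>i\<in>elts s. rel h a i"
         "\<forall>y\<in>D. elts y \<subseteq> elts F \<and> sz D y (sc n) \<longrightarrow> (\<exists>a\<in>elts y. \<forall>i\<in>elts s. rel h a i \<longrightarrow> rel c y i)"
        using IH[OF H(1,3) X(3)] unfolding prehom_def by blast
      have aF: "a \<notin> elts F" using F(2) H(2) X'(2) by blast
      have iD: "i \<in> D" using i(1) transD nD(2) by blast
      define F' where "F' = ins a F"
      define h' where "h' = ins (opair a i) h"
      have F': "F' \<in> D" "elts F' = insert a (elts F)" "sz D F' (sc m)"
        unfolding F'_def using F aD sz_ins[OF F(3) aD aF m] by auto
      have h': "h' \<in> D" "\<And>u v. rel h' u v \<longleftrightarrow> u = a \<and> v = i \<or> rel h u v"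
        unfolding h'_def using F(4) aD iD by (simp_all add: rel_ins)
      \<comment> \<open>So the pair added for \<open>a\<close> is the only value of
        \<open>h'\<close> there, and every \<open>n+1\<close>-set containing \<open>a\<close> has
        colour \<open>i\<close>.\<close>
      have nh: "\<not> rel h a v" for v using h(1) aF relD[OF F(4)] by blast
      have "\<exists>b\<in>elts y. \<forall>j\<in>elts s. rel h' b j \<longrightarrow> rel c y j"
        if y: "y \<in> D" "elts y \<subseteq> elts F'" "sz D y (sc n)" for y
      proof (cases "a \<in> elts y")
        case True
        have w: "rem y a \<in> D" "elts (rem y a) \<subseteq> elts H" "sz D (rem y a) n"
          using remD(1)[OF y(1) aD] elts_rem[OF y(1) aD] sz_rem[OF y(3,1) True assms(1)] y(2) F'(2) F(2) by auto
        then have "rel c y i" using i(2)[OF w] ca(2) ins_rem[OF y(1) True] by simp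
        moreover have "j = i" if "rel h' a j" for j using that h'(2) nh by blast
        ultimately show ?thesis by (intro bexI[OF _ True]) blast
      next
        case False
        have "elts y \<subseteq> elts F"
        proof
          fix z assume z: "z \<in> elts y"
          then have "z \<in> elts F'" using y(2) by (rule rev_subsetD)
          moreover have "z \<noteq> a" using z False by metis
          ultimately show "z \<in> elts F" unfolding F'(2) by simp
        qed
        then obtain b where b: "b \<in> elts y" "\<forall>i\<in>elts s. rel h b i \<longrightarrow> rel c y i" using h(3) y by blast
        have "b \<noteq> a" using b(1) False by metis
        then have "rel h b j" if "rel h' b j" for j using that h'(2) by metis
        then show ?thesis using b(2) by (intro bexI[OF _ b(1)]) blast
      qed
      moreover have "\<forall>u\<in>D. \<forall>v\<in>D. rel h' u v \<longrightarrow> u \<in> elts F'" using h'(2) h(1) F'(2) by blast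
      moreover have "\<forall>u\<in>elts F'. \<exists>v\<in>elts s. rel h' u v" using h'(2) h(2) F'(2) i(1) by blast
      moreover have "elts F' \<subseteq> elts X"
      proof -
        have "elts F \<subseteq> elts X" using F(2) H(2) unfolding X'(2) by blast
        then show ?thesis unfolding F'(2) using a by simp
      qed
      ultimately show ?thesis using F'(1,3) h'(1) unfolding prehom_def by blast
    qed
    then show "?P (sc m)" using K(1) by (intro bexI[of _ "sc K"]) simp_all
  qed (intro ufi nD)
qed

text \<open>For 0-sets only the empty set is coloured. For the step, a prehomogeneous set reduces
  the colours of \<open>n+1\<close>-sets to colours of points, and the pigeonhole principle makes
  these constant.\<close>

lemma ramsey:
  assumes "n \<in> elts N" "s \<in> elts N"
  shows "\<forall>l\<in>elts N. \<exists>k\<in>elts N. RP D l s n k" (is "?P n")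
proof -
  have sD: "s \<in> D" using assms by simp
  show ?thesis
  proof (rule ind[of n ?P, OF assms(1)])
    have "RP D l s zero l" if l: "l \<in> elts N" for l unfolding RP_def
    proof (intro ballI impI)
      fix X c assume X: "X \<in> D" "sz D X l" "c \<in> D" "tot D c X zero s"
      then obtain i where "i \<in> elts s" "rel c zero i" unfolding tot_def using zeroD by fastforce
      then have "hom D c X zero s" unfolding hom_def sz_zero_iff by blast
      then show "\<exists>H\<in>D. elts H \<subseteq> elts X \<and> sz D H l \<and> hom D c H zero s" using X by blast
    qed
    then show "?P zero" by blast
  next
    fix n assume n: "n \<in> elts N" and IH: "?P n"
    show "?P (sc n)"
    proof
      fix l assume l: "l \<in> elts N"
      obtain m where m: "m \<in> elts N" and ph: "\<And>X h. X \<in> D \<Longrightarrow> sz D X m \<Longrightarrow> h \<in> D \<Longrightarrow> (\<forall>a\<in>elts X. \<exists>i\<in>elts s. rel h a i) \<Longrightarrow>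
        (\<exists>i\<in>elts s. \<exists>H\<in>D. elts H \<subseteq> elts X \<and> sz D H l \<and> (\<forall>a\<in>elts H. rel h a i))"
        using pigeonhole[OF assms(2) l] by blast
      obtain k where k: "k \<in> elts N" and pre: "\<And>X c. X \<in> D \<Longrightarrow> sz D X k \<Longrightarrow> c \<in> D \<Longrightarrow> tot D c X (sc n) s \<Longrightarrow>
        (\<exists>F\<in>D. elts F \<subseteq> elts X \<and> sz D F m \<and> prehom D c F n s)"
        using prehomogeneous[OF n assms(2) IH[rule_format] m] by blast
      have "RP D l s (sc n) k" unfolding RP_def
      proof (intro ballI impI)
        fix X c assume X: "X \<in> D" "sz D X k" "c \<in> D" "tot D c X (sc n) s"
        obtain F h where F: "F \<in> D" "elts F \<subseteq> elts X" "sz D F m" "h \<in> D"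
         and h: "\<forall>a\<in>elts F. \<exists>i\<in>elts s. rel h a i"
         "\<And>y. y \<in> D \<Longrightarrow> elts y \<subseteq> elts F \<and> sz D y (sc n) \<Longrightarrow> (\<exists>a\<in>elts y. \<forall>i\<in>elts s. rel h a i \<longrightarrow> rel c y i)"
          using pre[OF X] unfolding prehom_def by blast
        obtain i H where H: "i \<in> elts s" "H \<in> D" "elts H \<subseteq> elts F" "sz D H l" "\<forall>a\<in>elts H. rel h a i"
          using ph[OF F(1,3,4) h(1)] by blast
        have "rel c y i" if y: "y \<in> D" "elts y \<subseteq> elts H \<and> sz D y (sc n)" for y
        proof -
          obtain b where "b \<in> elts y" "\<forall>i\<in>elts s. rel h b i \<longrightarrow> rel c y i" using h(2)[OF y(1)] y(2) H(3) by blast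
          then show ?thesis using H(1,5) y(2) by blast
        qed
        then have "hom D c H (sc n) s" unfolding hom_def using H(1) by blast
        then show "\<exists>H\<in>D. elts H \<subseteq> elts X \<and> sz D H l \<and> hom D c H (sc n) s" using H F(2) by blast
      qed
      then show "\<exists>k\<in>elts N. RP D l s (sc n) k" using k by blast
    qed
  qed (intro ufi sD)
qed

lemma good_ex:
  assumes "n \<in> elts N" "s \<in> elts N" "l \<in> elts N" shows "\<exists>k\<in>elts N. good D l s n k"
proof -
  \<comment> \<open>\<open>hom\<close> must name a colour, so no colours are replaced by one. If
    \<open>s\<close> is empty, \<open>fcol\<close> leaves no \<open>n\<close>-subsets at all, and
    both \<open>tot\<close> and \<open>homf\<close> hold vacuously.\<close>
  define s' where "s' = (if s = zero then sc zero else s)"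
  have s': "s' \<in> elts N" "elts s \<subseteq> elts s'" "elts s = {} \<or> s' = s"
    using assms by (auto simp: s'_def)
  obtain k where k: "k \<in> elts N" "RP D l s' n k" using ramsey[OF assms(1) s'(1)] assms(3) by blast
  have "good D l s n k" unfolding good_def
  proof (intro ballI impI)
    fix c assume c: "c \<in> D" "fcol D c k n s"
    then have "tot D c k n s'" using s'(2) unfolding fcol_def tot_def by blast
    then obtain H where H: "H \<in> D" "elts H \<subseteq> elts k" "sz D H l" "hom D c H n s'"
      using k c(1) sz_self[OF k(1)] unfolding RP_def by (meson N_D)
    obtain i where i: "i \<in> elts s'" "\<And>w. w \<in> D \<Longrightarrow> elts w \<subseteq> elts H \<Longrightarrow> sz D w n \<Longrightarrow> rel c w i"
      using H(4) unfolding hom_def by blast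
    have u: "\<exists>i\<in>elts s. rel c w i \<and> (\<forall>j\<in>elts s. rel c w j \<longrightarrow> j = i)" if "w \<in> D" "elts w \<subseteq> elts H" "sz D w n" for w
      using c(2) that H(2) unfolding fcol_def by blast
    have "homf D c H n s" unfolding homf_def
    proof (intro ballI impI)
      fix w v i' j assume w: "w \<in> D" "v \<in> D" "elts w \<subseteq> elts H \<and> sz D w n \<and> elts v \<subseteq> elts H \<and> sz D v n"
        "i' \<in> elts s" "j \<in> elts s" "rel c w i'" "rel c v j"
      have "s' = s" using s'(3) w by blast
      then have i_s: "i \<in> elts s" using i(1) by simp
      have "i' = i" using u[of w] i(2)[of w] w i_s by blast
      moreover have "j = i" using u[of v] i(2)[of v] w i_s by blast
      ultimately show "i' = j" by simp
    qed
    then show "\<exists>H\<in>D. elts H \<subseteq> elts k \<and> sz D H l \<and> homf D c H n s" using H by blast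
  qed
  then show ?thesis using k by blast
qed

text \<open>\<open>good\<close> speaks of colourings of the number \<open>k\<close> itself. A
  bijection carries the colouring of \<open>X\<close> to \<open>k\<close> and the homogeneous set
  back.\<close>

lemma good_transport:
  assumes "good D l s n k" "k \<in> elts N" "l \<in> elts N" "n \<in> elts N" "s \<in> D" "X \<in> D" "sz D X k" "c \<in> D" "fcol D c X n s"
  shows "\<exists>H\<in>D. elts H \<subseteq> elts X \<and> sz D H l \<and> homf D c H n s"
proof -
  obtain g0 where g0: "g0 \<in> D" "bijr g0 X k" using assms(7) unfolding sz_def by blast
  note B = bijrD[OF g0(2)]
  \<comment> \<open>\<open>v\<close> is the preimage of \<open>w\<close> under the bijection
    \<open>g0\<close> from \<open>X\<close> to \<open>k\<close>. Quantifying over \<open>D\<close>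
    keeps this definable; \<open>im_iff\<close> removes the bound.\<close>
  define im where "im w v \<longleftrightarrow> (\<forall>u\<in>D. u \<in> elts v \<longleftrightarrow> (\<exists>a\<in>elts w. rel g0 u a))" for w v
  have im_iff: "im w v \<longleftrightarrow> (\<forall>u. u \<in> elts v \<longleftrightarrow> (\<exists>a\<in>elts w. rel g0 u a))" if "v \<in> D" for w v
    unfolding im_def using relD[OF g0(1)] transD[OF that] by blast
  have im_ex: "\<exists>v\<in>D. im w v" if w: "w \<in> D" for w
  proof -
    obtain v where v: "v \<in> D" "elts v = {u\<in>elts X. \<exists>a\<in>elts w. rel g0 u a}"
      by (rule sepE[OF assms(6), of "\<lambda>u. \<exists>a\<in>elts w. rel g0 u a"]) (intro ufi w g0)+
    then have "im w v" unfolding im_iff[OF v(1)] using B(2) by blast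
    then show ?thesis using v by blast
  qed
  have im_un: "v = v'" if "im w v" "im w v'" "v \<in> D" "v' \<in> D" for w v v'
    using that im_iff by (intro Extensionality) auto
  have im_sub: "elts v \<subseteq> elts X" if "im w v" "v \<in> D" for w v using that im_iff B(2) by blast
  have im_sz: "sz D v m" if w: "im w v" "v \<in> D" "w \<in> D" "elts w \<subseteq> elts k" "sz D w m" "m \<in> elts N" for w v m
  proof (rule sz_img[of w v "\<lambda>a u. rel g0 u a", OF w(3,2) _ w(6,5)])
    show "dD (\<lambda>e. rel g0 (e 0) (e (Suc 0)))" by (intro ufi g0)
    show "\<exists>u\<in>elts v. rel g0 u a" if a: "a \<in> elts w" for a
    proof -
      obtain u where "rel g0 u a" using B(5) w(4) a by blast
      then show ?thesis using w(1) a unfolding im_iff[OF w(2)] by blast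
    qed
    show "\<exists>a\<in>elts w. rel g0 u a" if "u \<in> elts v" for u using w(1) that unfolding im_iff[OF w(2)] by blast
  qed (use B in blast)+
  have kD: "k \<in> D" using assms by simp
  obtain Q where Q: "Q \<in> D" "elts Q = {z\<in>D. elts z \<subseteq> elts k}" using pow[OF kD] by blast
  have "dD (\<lambda>e. sz D (e (Suc 0)) n \<and> (\<exists>v\<in>D. im (e (Suc 0)) v \<and> rel c v (e 0)))"
    unfolding im_def by (intro ufi g0 assms N_D)
  from relsep[OF Q(1) assms(5) this] obtain c' where c': "c' \<in> D"
    "\<And>w i. rel c' w i \<longleftrightarrow> w \<in> elts Q \<and> i \<in> elts s \<and> sz D w n \<and> (\<exists>v\<in>D. im w v \<and> rel c v i)"
    "\<And>p. p \<in> elts c' \<Longrightarrow> \<exists>w\<in>elts Q. \<exists>i\<in>elts s. p = opair w i" by blast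
  have r: "rel c' w i \<longleftrightarrow> rel c v i" if v: "w \<in> D" "elts w \<subseteq> elts k" "sz D w n" "v \<in> D" "im w v" "i \<in> elts s" for w v i
    using c'(2) im_un v Q(2) by blast
  have cu: "\<exists>i\<in>elts s. rel c w i \<and> (\<forall>j\<in>elts s. rel c w j \<longrightarrow> j = i)" if "w \<in> D" "elts w \<subseteq> elts X" "sz D w n" for w
    using assms(9) that unfolding fcol_def by blast
  have "fcol D c' k n s" unfolding fcol_def
  proof (intro conjI ballI impI)
    fix p assume p: "p \<in> elts c'"
    then obtain w i where wi: "w \<in> elts Q" "i \<in> elts s" "p = opair w i" using c'(3) by blast
    then have "rel c' w i" using p by (simp add: rel_def)
    then show "\<exists>w\<in>D. \<exists>i\<in>elts s. p = opair w i \<and> elts w \<subseteq> elts k \<and> sz D w n" using wi c'(2) Q(2) by blast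
  next
    fix w assume w: "w \<in> D" "elts w \<subseteq> elts k \<and> sz D w n"
    obtain v where v: "v \<in> D" "im w v" using im_ex[OF w(1)] by blast
    obtain i where "i \<in> elts s" "rel c v i" "\<forall>j\<in>elts s. rel c v j \<longrightarrow> j = i"
      using cu[OF v(1) im_sub[OF v(2,1)] im_sz[OF v(2,1) w(1) _ _ assms(4)]] w(2) by blast
    then show "\<exists>i\<in>elts s. rel c' w i \<and> (\<forall>j\<in>elts s. rel c' w j \<longrightarrow> j = i)"
      using r[OF w(1) _ _ v] w(2) by blast
  qed
  then obtain H where H: "H \<in> D" "elts H \<subseteq> elts k" "sz D H l" "homf D c' H n s"
    using assms(1) c'(1) unfolding good_def by blast
  obtain G where G: "G \<in> D" "im H G" using im_ex[OF H(1)] by blast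
  \<comment> \<open>Every \<open>n\<close>-subset of the returned set \<open>G\<close> is the
    preimage of an \<open>n\<close>-subset of \<open>H\<close>, so homogeneity can be tested on the
    side of \<open>k\<close>.\<close>
  have bk: "\<exists>w'\<in>D. elts w' \<subseteq> elts H \<and> sz D w' n \<and> im w' w" if w: "w \<in> D" "elts w \<subseteq> elts G" "sz D w n" for w
  proof -
    obtain w' where w': "w' \<in> D" "elts w' = {a\<in>elts H. \<exists>u\<in>elts w. rel g0 u a}"
      by (rule sepE[OF H(1), of "\<lambda>a. \<exists>u\<in>elts w. rel g0 u a"]) (intro ufi w g0)+
    have i: "im w' w" unfolding im_iff[OF w(1)] w'(2)
    proof (intro allI iffI)
      fix u assume u: "u \<in> elts w"
      then obtain a where "a \<in> elts H" "rel g0 u a" using w(2) G(2) unfolding im_iff[OF G(1)] by blast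
      then show "\<exists>a\<in>{a\<in>elts H. \<exists>u\<in>elts w. rel g0 u a}. rel g0 u a" using u by blast
    next
      fix u assume "\<exists>a\<in>{a\<in>elts H. \<exists>u\<in>elts w. rel g0 u a}. rel g0 u a"
      then obtain a u' where "rel g0 u a" "u' \<in> elts w" "rel g0 u' a" by blast
      then show "u \<in> elts w" using B(7) by blast
    qed
    have sub: "elts w' \<subseteq> elts H" using w'(2) by blast
    have "sz D w' n"
    proof (rule sz_img[of w w' "\<lambda>u a. rel g0 u a", OF w(1) w'(1) _ assms(4) w(3)])
      show "dD (\<lambda>e. rel g0 (e (Suc 0)) (e 0))" by (intro ufi g0)
      show "\<exists>a\<in>elts w'. rel g0 u a" if "u \<in> elts w" for u using i that unfolding im_iff[OF w(1)] by blast
      show "\<exists>u\<in>elts w. rel g0 u a" if "a \<in> elts w'" for a using w'(2) that by blast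
    qed (use B in blast)+
    then show ?thesis using w'(1) sub i by blast
  qed
  have "homf D c G n s" unfolding homf_def
  proof (intro ballI impI)
    fix w v i j assume w: "w \<in> D" "v \<in> D" "elts w \<subseteq> elts G \<and> sz D w n \<and> elts v \<subseteq> elts G \<and> sz D v n"
      "i \<in> elts s" "j \<in> elts s" "rel c w i" "rel c v j"
    obtain w' where w': "w' \<in> D" "elts w' \<subseteq> elts H" "sz D w' n" "im w' w" using bk w by blast
    obtain v' where v': "v' \<in> D" "elts v' \<subseteq> elts H" "sz D v' n" "im v' v" using bk w by blast
    have "rel c' w' i" using r[OF w'(1) _ w'(3) w(1) w'(4) w(4)] w'(2) H(2) w(6) by blast
    moreover have "rel c' v' j" using r[OF v'(1) _ v'(3) w(2) v'(4) w(5)] v'(2) H(2) w(7) by blast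
    ultimately show "i = j" using H(4) w' v' w unfolding homf_def by blast
  qed
  then show ?thesis using G im_sub[OF G(2,1)] im_sz[OF G(2,1) H(1,2,3) assms(3)] by blast
qed

end

interpretation W: nat_pow_class False "WF :: 'a::hst set" omega
  by unfold_locales (use WF_pow WF_min in blast)+

interpretation H: nat_pow_class False "Internal :: 'a::hst set" hnat
  by unfold_locales (use int_pow int_reg in blast)+

section \<open>The Ramsey function and exponentiation on the internal natural numbers\<close>

definition fn2 :: "'a::in_st \<Rightarrow> 'a \<Rightarrow> bool" where
  "fn2 f k \<longleftrightarrow> (\<forall>p\<in>elts f. \<exists>a\<in>elts k. \<exists>i\<in>elts (sc (sc zero)). p = opair a i) \<and>
     (\<forall>a\<in>elts k. \<exists>i\<in>elts (sc (sc zero)). rel f a i \<and> (\<forall>j\<in>elts (sc (sc zero)). rel f a j \<longrightarrow> j = i))"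

lemma fn2_D:
  assumes "fn2 f (k::'a::hst)"
  shows "rel f a i \<Longrightarrow> a \<in> elts k \<and> (i = zero \<or> i = sc zero)"
    and "a \<in> elts k \<Longrightarrow> \<exists>i. rel f a i" and "rel f a i \<Longrightarrow> rel f a j \<Longrightarrow> i = j"
proof -
  have p: "\<exists>a\<in>elts k. \<exists>i\<in>elts (sc (sc zero)). p = opair a i" if "p \<in> elts f" for p
    using assms that unfolding fn2_def by blast
  have q: "\<exists>i\<in>elts (sc (sc zero)). rel f a i \<and> (\<forall>j\<in>elts (sc (sc zero)). rel f a j \<longrightarrow> j = i)" if "a \<in> elts k" for a
    using assms that unfolding fn2_def by blast
  have r: "a \<in> elts k \<and> i \<in> elts (sc (sc zero))" if "rel f a i" for a i
    using p[of "opair a i"] that unfolding rel_def by auto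
  show "rel f a i \<Longrightarrow> a \<in> elts k \<and> (i = zero \<or> i = sc zero)" using r by auto
  show "a \<in> elts k \<Longrightarrow> \<exists>i. rel f a i" using q by blast
  show "rel f a i \<Longrightarrow> rel f a j \<Longrightarrow> i = j" using q[of a] r[of a i] r[of a j] by blast
qed

lemma fn2_I:
  assumes "\<And>p. p \<in> elts f \<Longrightarrow> \<exists>a i. p = opair a i" "\<And>a i. rel f a i \<Longrightarrow> a \<in> elts k \<and> (i = zero \<or> i = sc zero)"
    "\<And>a. a \<in> elts k \<Longrightarrow> \<exists>i. rel f a i" "\<And>a i j. rel f a i \<Longrightarrow> rel f a j \<Longrightarrow> i = j"
  shows "fn2 f (k::'a::hst)"
  unfolding fn2_def
proof (intro conjI ballI)
  fix p assume p: "p \<in> elts f"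
  then obtain a i where ai: "p = opair a i" using assms(1) by blast
  then have "a \<in> elts k" "i \<in> elts (sc (sc zero))" using assms(2)[of a i] p by (auto simp: rel_def)
  then show "\<exists>a\<in>elts k. \<exists>i\<in>elts (sc (sc zero)). p = opair a i" using ai by blast
next
  fix a assume "a \<in> elts k"
  then obtain i where i: "rel f a i" using assms(3) by blast
  then have "i \<in> elts (sc (sc zero))" using assms(2)[OF i] by auto
  then show "\<exists>i\<in>elts (sc (sc zero)). rel f a i \<and> (\<forall>j\<in>elts (sc (sc zero)). rel f a j \<longrightarrow> j = i)"
    using i assms(4) by blast
qed

lemma uf_fn2[ufi]:
  fixes D :: "'i \<Rightarrow> 'a::hst set"
  assumes "tpc D" "tm b D C t" "tm b D C s" "tm b D C (\<lambda>_ _. zero)"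
  shows "uf b D C (\<lambda>i e. fn2 (t i e) (s i e))"
proof -
  note c = tm_consts[OF assms(2)]
  show ?thesis by (rule uf_lift2[OF _ assms(2,3)]) (unfold fn2_def, intro ufi assms c)
qed

section \<open>Finite exponentiation\<close>

context nat_pow_class
begin

lemma Fn_ex: assumes "k \<in> D" shows "\<exists>F\<in>D. elts F = {f\<in>D. fn2 f k}"
proof -
  have 2: "sc (sc zero) \<in> D" by simp
  obtain P where P: "P \<in> D" "elts P = {p. \<exists>a\<in>elts k. \<exists>c\<in>elts (sc (sc zero)). p = opair a c}"
    using prod_ex[OF assms 2] by blast
  obtain Q where Q: "Q \<in> D" "elts Q = {z\<in>D. elts z \<subseteq> elts P}" using pow[OF P(1)] by blast
  obtain F where F: "F \<in> D" "elts F = {f\<in>elts Q. fn2 f k}"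
    by (rule sepE[OF Q(1), of "\<lambda>f. fn2 f k"]) (intro ufi assms)+
  have "elts f \<subseteq> elts P" if "fn2 f k" for f using that unfolding fn2_def P(2) by blast
  then have "elts F = {f\<in>D. fn2 f k}" unfolding F(2) Q(2) by blast
  then show ?thesis using F(1) by blast
qed

text \<open>Adding the pair of \<open>k\<close> and \<open>i\<close> is a bijection from the
  functions on \<open>k\<close> to the functions on \<open>sc k\<close> with value \<open>i\<close>
  at \<open>k\<close>.\<close>

lemma Fn_half:
  assumes "k \<in> elts N" "F \<in> D" "elts F = {f\<in>D. fn2 f k}" "r \<in> elts N" "sz D F r"
    "G \<in> D" "elts G = {f\<in>D. fn2 f (sc k)}" "i = zero \<or> i = sc zero"
  shows "\<exists>H\<in>D. elts H = {f\<in>elts G. rel f k i} \<and> sz D H r"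
proof -
  have kD: "k \<in> D" "i \<in> D" using assms(1,8) by auto
  have kk: "k \<notin> elts k" using N_irrefl assms(1) .
  obtain H where H: "H \<in> D" "elts H = {f\<in>elts G. rel f k i}"
    by (rule sepE[OF assms(6), of "\<lambda>f. rel f k i"]) (intro ufi kD)+
  have "sz D H r"
  proof (rule sz_img[of F H "\<lambda>f g. g = ins (opair k i) f", OF assms(2) H(1) _ assms(4,5)])
    show "dD (\<lambda>e. e 0 = ins (opair k i) (e (Suc 0)))" by (intro ufi kD)
  next
    fix f assume "f \<in> elts F"
    then have f: "f \<in> D" "fn2 f k" using assms(3) by auto
    note fd = fn2_D[OF f(2)]
    let ?g = "ins (opair k i) f"
    have "fn2 ?g (sc k)"
    proof (rule fn2_I)
      fix p assume "p \<in> elts ?g"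
      then show "\<exists>a i. p = opair a i" using f(2) unfolding fn2_def elts_ins by blast
    next
      fix a j assume "rel ?g a j"
      then show "a \<in> elts (sc k) \<and> (j = zero \<or> j = sc zero)" unfolding rel_ins elts_sc using fd(1) assms(8) by blast
    next
      fix a assume "a \<in> elts (sc k)"
      then show "\<exists>i. rel ?g a i" unfolding rel_ins elts_sc using fd(2) by blast
    next
      fix a j l assume "rel ?g a j" "rel ?g a l"
      then show "j = l" unfolding rel_ins using fd(1,3) kk by blast
    qed
    moreover have "?g \<in> D" using f kD by simp
    moreover have "rel ?g k i" unfolding rel_ins by blast
    ultimately show "\<exists>g\<in>elts H. g = ?g" unfolding H(2) assms(7) by blast
  next
    fix g assume "g \<in> elts H"
    then have g: "g \<in> D" "fn2 g (sc k)" "rel g k i" unfolding H(2) assms(7) by blast+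
    note gd = fn2_D[OF g(2)]
    have pD: "opair k i \<in> D" using kD by simp
    note er = elts_rem[OF g(1) pD]
    have rr: "rel (rem g (opair k i)) a j \<longleftrightarrow> rel g a j \<and> a \<noteq> k" for a j
      unfolding rel_def er using gd(3)[of k i j] g(3) by (auto simp: rel_def)
    have "fn2 (rem g (opair k i)) k"
    proof (rule fn2_I)
      fix p assume "p \<in> elts (rem g (opair k i))"
      then show "\<exists>a i. p = opair a i" using g(2) unfolding fn2_def er by blast
    next
      fix a j assume "rel (rem g (opair k i)) a j"
      then show "a \<in> elts k \<and> (j = zero \<or> j = sc zero)" unfolding rr using gd(1)[of a j] by simp
    next
      fix a assume "a \<in> elts k"
      then show "\<exists>j. rel (rem g (opair k i)) a j" unfolding rr using gd(2)[of a] kk by auto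
    next
      fix a j l assume "rel (rem g (opair k i)) a j" "rel (rem g (opair k i)) a l"
      then show "j = l" unfolding rr using gd(3) by blast
    qed
    moreover have "ins (opair k i) (rem g (opair k i)) = g" using ins_rem[OF g(1)] g(3) by (simp add: rel_def)
    ultimately show "\<exists>f\<in>elts F. g = ins (opair k i) f" unfolding assms(3)
      using remD(1)[OF g(1) pD] by (intro bexI[of _ "rem g (opair k i)"]) auto
  next
    fix f g h assume f: "f \<in> elts F" "g \<in> elts F" and h: "h = ins (opair k i) f" "h = ins (opair k i) g"
    have "opair k i \<notin> elts f'" if "f' \<in> elts F" for f'
    proof -
      have "fn2 f' k" using that assms(3) by blast
      then show ?thesis using fn2_D(1)[of f' k k i] kk unfolding rel_def by blast
    qed
    then have "opair k i \<notin> elts f" "opair k i \<notin> elts g" using f by blast+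
    moreover have "insert (opair k i) (elts f) = insert (opair k i) (elts g)" using h elts_ins by metis
    ultimately show "f = g" using insert_ident elts_eq_iff by metis
  qed simp
  then show ?thesis using H by blast
qed

text \<open>The functions on \<open>sc k\<close> split by their value at \<open>k\<close> into two
  copies of those on \<open>k\<close>. Membership is described elementwise instead of by an equation
  of sets to stay within the definability rules.\<close>

lemma Fn_finite: assumes "k \<in> elts N" shows "\<exists>F\<in>D. (\<forall>f\<in>D. f \<in> elts F \<longleftrightarrow> fn2 f k) \<and> (\<exists>r\<in>elts N. sz D F r)"
proof (rule ind[of k "\<lambda>k. \<exists>F\<in>D. (\<forall>f\<in>D. f \<in> elts F \<longleftrightarrow> fn2 f k) \<and> (\<exists>r\<in>elts N. sz D F r)", OF assms])
  have "fn2 f zero \<longleftrightarrow> f = zero" for f :: 'a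
  proof
    assume "fn2 f zero"
    then have "elts f = {}" unfolding fn2_def elts_zero by blast
    then show "f = zero" by (simp add: eq_zero_iff)
  qed (simp add: fn2_def)
  moreover have "sz D (ins zero zero) (sc zero)" by (rule sz_ins) auto
  ultimately show "\<exists>F\<in>D. (\<forall>f\<in>D. f \<in> elts F \<longleftrightarrow> fn2 f zero) \<and> (\<exists>r\<in>elts N. sz D F r)"
    by (intro bexI[of _ "ins zero zero"] conjI bexI[of _ "sc zero"]) auto
next
  fix k assume k: "k \<in> elts N" and "\<exists>F\<in>D. (\<forall>f\<in>D. f \<in> elts F \<longleftrightarrow> fn2 f k) \<and> (\<exists>r\<in>elts N. sz D F r)"
  then obtain F r where F: "F \<in> D" "\<forall>f\<in>D. f \<in> elts F \<longleftrightarrow> fn2 f k" "r \<in> elts N" "sz D F r" by blast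
  then have F': "elts F = {f\<in>D. fn2 f k}" using transD[OF F(1)] by blast
  have skD: "sc k \<in> D" using k by simp
  obtain G where G: "G \<in> D" "elts G = {f\<in>D. fn2 f (sc k)}" using Fn_ex[OF skD] by blast
  obtain H0 where H0: "H0 \<in> D" "elts H0 = {f\<in>elts G. rel f k zero}" "sz D H0 r"
    using Fn_half[OF k F(1) F' F(3,4) G, of zero] by blast
  obtain H1 where H1: "H1 \<in> D" "elts H1 = {f\<in>elts G. rel f k (sc zero)}" "sz D H1 r"
    using Fn_half[OF k F(1) F' F(3,4) G, of "sc zero"] by blast
  have "f \<in> elts H0 \<or> f \<in> elts H1" if f: "f \<in> elts G" for f
  proof -
    have f2: "fn2 f (sc k)" using f G(2) by blast
    obtain i where "rel f k i" using fn2_D(2)[OF f2, of k] by auto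
    then show ?thesis using fn2_D(1)[OF f2] f unfolding H0(2) H1(2) by blast
  qed
  then have "un H0 H1 = G" using H0(2) H1(2) by (intro Extensionality) auto
  then obtain r' where "r' \<in> elts N" "sz D G r'" using sz_un[OF F(3,3) H0(1) H1(1) H0(3) H1(3)] by auto
  moreover have "\<forall>f\<in>D. f \<in> elts G \<longleftrightarrow> fn2 f (sc k)" using G(2) by blast
  ultimately show "\<exists>F\<in>D. (\<forall>f\<in>D. f \<in> elts F \<longleftrightarrow> fn2 f (sc k)) \<and> (\<exists>r\<in>elts N. sz D F r)" using G(1) by blast
qed (intro ufi)

text \<open>If \<open>r\<close> were at most \<open>k\<close>, the enumeration \<open>h\<close> of
  the functions would take values below \<open>k\<close> and could be diagonalized.\<close>

lemma cantor:
  assumes "k \<in> elts N" "F \<in> D" "elts F = {f\<in>D. fn2 f k}" "r \<in> elts N" "sz D F r"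
  shows "k \<in> elts r"
proof (rule ccontr)
  assume "k \<notin> elts r"
  then have sub: "elts r \<subseteq> elts k" using N_linear[OF assms(1,4)] N_le_iff[OF assms(1,4)] by auto
  obtain h where h: "h \<in> D" "bijr h F r" using assms(5) unfolding sz_def by blast
  note B = bijrD[OF h(2)]
  have kD: "k \<in> D" and 2: "sc (sc zero) \<in> D" using assms(1) by simp_all
  \<comment> \<open>The diagonal function: value 1 at \<open>u\<close> exactly if the function with
    index \<open>u\<close> has value 0 at \<open>u\<close>; points that are no index get 0.\<close>
  have "dD (\<lambda>e. e 0 = sc zero \<longleftrightarrow> (\<exists>\<psi>\<in>elts F. rel h \<psi> (e (Suc 0)) \<and> rel \<psi> (e (Suc 0)) zero))"
    by (intro ufi h assms scD zeroD)
  from relsep[OF kD 2 this] obtain \<phi> where \<phi>: "\<phi> \<in> D" "\<forall>p\<in>elts \<phi>. \<exists>u\<in>elts k. \<exists>v\<in>elts (sc (sc zero)). p = opair u v"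
    "\<And>u v. rel \<phi> u v \<longleftrightarrow> u \<in> elts k \<and> v \<in> elts (sc (sc zero)) \<and> (v = sc zero \<longleftrightarrow> (\<exists>\<psi>\<in>elts F. rel h \<psi> u \<and> rel \<psi> u zero))"
    by blast
  have 01: "zero \<noteq> sc (zero::'a)" by simp
  have "fn2 \<phi> k"
  proof (rule fn2_I)
    fix a assume "a \<in> elts k"
    then show "\<exists>i. rel \<phi> a i" unfolding \<phi>(3)
      by (intro exI[of _ "if \<exists>\<psi>\<in>elts F. rel h \<psi> a \<and> rel \<psi> a zero then sc zero else zero"]) auto
  next
    fix a i j assume "rel \<phi> a i" "rel \<phi> a j"
    then show "i = j" unfolding \<phi>(3) elts_sc elts_zero using 01 by blast
  next
    fix a i assume "rel \<phi> a i"
    then show "a \<in> elts k \<and> (i = zero \<or> i = sc zero)" unfolding \<phi>(3) elts_sc elts_zero by blast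
  qed (use \<phi>(2) in blast)
  then have \<phi>F: "\<phi> \<in> elts F" using assms(3) \<phi>(1) by blast
  note f = fn2_D[OF \<open>fn2 \<phi> k\<close>]
  obtain i where i: "rel h \<phi> i" using B(4)[OF \<phi>F] by blast
  then have ik: "i \<in> elts k" using B(3) sub by blast
  obtain v where v: "rel \<phi> i v" using f(2)[OF ik] by blast
  have "(\<exists>\<psi>\<in>elts F. rel h \<psi> i \<and> rel \<psi> i zero) \<longleftrightarrow> rel \<phi> i zero" using B(7) i \<phi>F by blast
  then show False using v \<phi>(3)[of i v] f(1)[OF v] f(3)[OF v] 01 by metis
qed

end

text \<open>Identifies the functions counted by \<open>ipow2\<close> with those of
  \<open>fn2\<close>, so that finiteness and Cantor's inequality apply to the exponential.\<close>

lemma ipow2_props: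
  assumes "\<kappa> \<in> elts (hnat::'a::hst)"
  shows "ipow2 \<kappa> \<in> elts hnat" "\<kappa> \<in> elts (ipow2 \<kappa>)"
    "\<exists>F\<in>Internal. elts F = {f\<in>Internal. fn2 f \<kappa>} \<and> sz Internal F (ipow2 \<kappa>)"
proof -
  obtain F r where F: "F \<in> Internal" "\<forall>f\<in>Internal. f \<in> elts F \<longleftrightarrow> fn2 f \<kappa>" "r \<in> elts hnat" "sz Internal F r"
    using H.Fn_finite[OF assms] by blast
  have F': "elts F = {f\<in>Internal. fn2 f \<kappa>}" using F(2) internal_trans[OF F(1)] by blast
  have one: "set_of {zero} = sc (zero::'a)"
    by (rule set_of_eqI) simp
  have "is_function f \<and> fdom f = elts \<kappa> \<and> frange f \<subseteq> {set_of {}, set_of {set_of {}}} \<longleftrightarrow> fn2 f \<kappa>" for f :: 'a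
    unfolding zero_def[symmetric] one
  proof
    assume *: "is_function f \<and> fdom f = elts \<kappa> \<and> frange f \<subseteq> {zero, sc zero}"
    then have fn: "is_function f" and d: "\<And>a. (\<exists>y. rel f a y) \<longleftrightarrow> a \<in> elts \<kappa>"
      and r: "\<And>i. (\<exists>x. rel f x i) \<Longrightarrow> i = zero \<or> i = sc zero"
      using fdom_rel frange_rel by blast+
    show "fn2 f \<kappa>" by (rule fn2_I) (use is_functionD[OF fn] d r in blast)+
  next
    assume f: "fn2 f \<kappa>"
    note fd = fn2_D[OF f]
    have "is_function f"
    proof (rule is_functionI)
      show "\<exists>x y. p = opair x y" if "p \<in> elts f" for p using f that unfolding fn2_def by blast
    qed (rule fd(3))
    moreover have "fdom f = elts \<kappa>" unfolding set_eq_iff fdom_rel using fd(1,2) by blast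
    moreover have "frange f \<subseteq> {zero, sc zero}" by (auto simp: frange_rel dest: fd(1))
    ultimately show "is_function f \<and> fdom f = elts \<kappa> \<and> frange f \<subseteq> {zero, sc zero}" by blast
  qed
  then have "ipow2 \<kappa> = icard F" unfolding ipow2_def F'[symmetric] by (simp add: F'[symmetric])
  then have r: "ipow2 \<kappa> = r" using H.card_eq[OF F(1,3,4)] by simp
  show "ipow2 \<kappa> \<in> elts hnat" using r F by simp
  show "\<kappa> \<in> elts (ipow2 \<kappa>)" using r H.cantor[OF assms F(1) F' F(3,4)] by simp
  show "\<exists>F\<in>Internal. elts F = {f\<in>Internal. fn2 f \<kappa>} \<and> sz Internal F (ipow2 \<kappa>)" using F F' r by blast
qed

section \<open>The Ramsey function and its star image\<close>

lemma ramsey_good_iff: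
  assumes "l \<in> elts omega" "s \<in> elts omega" "n \<in> elts omega" "k \<in> elts (omega::'a::hst)"
  shows "ramsey_good l s n k \<longleftrightarrow> good WF l s n k"
proof -
  have kW: "k \<in> WF" using assms by simp
  note self = W.sz_self[OF assms(4)]
  have "(\<exists>H\<in>WF. elts H \<subseteq> elts k \<and> card_in WF H = l \<and>
           (\<forall>x\<in>elts (nsubsets_in WF H n). \<forall>y\<in>elts (nsubsets_in WF H n). fapp c x = fapp c y)) \<longleftrightarrow>
       (\<exists>H\<in>WF. elts H \<subseteq> elts k \<and> sz WF H l \<and> homf WF c H n s)" if c: "c \<in> WF" "fcol WF c k n s" for c
  proof (rule bex_cong[OF refl])
    fix H :: 'a assume H: "H \<in> WF"
    have "is_function c" using c W.fcol_iff[OF kW assms(4) self assms(3)] by blast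
    note fn = this
    have cu: "\<exists>i\<in>elts s. rel c w i" if "w \<in> WF" "elts w \<subseteq> elts k" "sz WF w n" for w
      using c(2) that unfolding fcol_def by blast
    show "(elts H \<subseteq> elts k \<and> card_in WF H = l \<and>
           (\<forall>x\<in>elts (nsubsets_in WF H n). \<forall>y\<in>elts (nsubsets_in WF H n). fapp c x = fapp c y)) \<longleftrightarrow>
       (elts H \<subseteq> elts k \<and> sz WF H l \<and> homf WF c H n s)"
    proof (rule conj_cong[OF refl], rule conj_cong)
      assume Hk: "elts H \<subseteq> elts k"
      then show "card_in WF H = l \<longleftrightarrow> sz WF H l" using W.card_iff[OF kW assms(4) self assms(1) H] by blast
      assume sz: "sz WF H l"
      have a: "\<exists>i\<in>elts s. rel c w i \<and> fapp c w = i" if "w \<in> WF" "elts w \<subseteq> elts H" "sz WF w n" for w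
        using cu[of w] that Hk fapp_eq[OF fn] by blast
      show "(\<forall>x\<in>elts (nsubsets_in WF H n). \<forall>y\<in>elts (nsubsets_in WF H n). fapp c x = fapp c y) \<longleftrightarrow> homf WF c H n s"
        unfolding W.nsub_eq(1)[OF H assms(1) sz assms(3)] homf_def
      proof (intro iffI ballI impI)
        fix w v i j assume "\<forall>x\<in>{x \<in> WF. elts x \<subseteq> elts H \<and> sz WF x n}. \<forall>y\<in>{x \<in> WF. elts x \<subseteq> elts H \<and> sz WF x n}. fapp c x = fapp c y"
          "w \<in> WF" "v \<in> WF" "elts w \<subseteq> elts H \<and> sz WF w n \<and> elts v \<subseteq> elts H \<and> sz WF v n"
          and r: "rel c w i" "rel c v j"
        then have "fapp c w = fapp c v" by blast
        then show "i = j" using fapp_eq[OF fn r(1)] fapp_eq[OF fn r(2)] by simp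
      next
        fix x y assume h: "\<forall>w\<in>WF. \<forall>v\<in>WF. elts w \<subseteq> elts H \<and> sz WF w n \<and> elts v \<subseteq> elts H \<and> sz WF v n \<longrightarrow>
             (\<forall>i\<in>elts s. \<forall>j\<in>elts s. rel c w i \<longrightarrow> rel c v j \<longrightarrow> i = j)"
          and x: "x \<in> {x \<in> WF. elts x \<subseteq> elts H \<and> sz WF x n}" and y: "y \<in> {x \<in> WF. elts x \<subseteq> elts H \<and> sz WF x n}"
        obtain i where i: "i \<in> elts s" "rel c x i" "fapp c x = i" using a x by blast
        obtain j where j: "j \<in> elts s" "rel c y j" "fapp c y = j" using a y by blast
        have "i = j" using h x y i(1,2) j(1,2) by blast
        then show "fapp c x = fapp c y" using i j by simp
      qed
    qed
  qed
  note 1 = this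
  show ?thesis unfolding ramsey_good_def good_def
  proof (rule ball_cong[OF refl])
    fix c :: 'a assume c: "c \<in> WF"
    show "(is_function c \<and> fdom c = elts (nsubsets_in WF k n) \<and> frange c \<subseteq> elts s \<longrightarrow>
        (\<exists>H\<in>WF. elts H \<subseteq> elts k \<and> card_in WF H = l \<and>
           (\<forall>x\<in>elts (nsubsets_in WF H n). \<forall>y\<in>elts (nsubsets_in WF H n). fapp c x = fapp c y))) \<longleftrightarrow>
      (fcol WF c k n s \<longrightarrow> (\<exists>H\<in>WF. elts H \<subseteq> elts k \<and> sz WF H l \<and> homf WF c H n s))"
      unfolding W.fcol_iff[OF kW assms(4) self assms(3) c, symmetric] using 1[OF c] by (rule imp_cong[OF refl])
  qed
qed

text \<open>The finite Ramsey theorem in \<open>WF\<close> makes the set of good numbers nonempty,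
  well-foundedness gives a least one, and linearity of the order makes the description
  unique.\<close>

lemma ramsey_num_props:
  assumes "l \<in> elts omega" "s \<in> elts omega" "n \<in> elts (omega::'a::hst)"
  shows "ramsey_num l s n \<in> elts omega" "good WF l s n (ramsey_num l s n)"
    "k \<in> elts omega \<Longrightarrow> good WF l s n k \<Longrightarrow> (\<forall>j\<in>elts k. \<not> good WF l s n j) \<Longrightarrow> ramsey_num l s n = k"
    "j \<in> elts (ramsey_num l s n) \<Longrightarrow> \<not> good WF l s n j"
proof -
  have lsn: "l \<in> WF" "s \<in> WF" "n \<in> WF" using assms by simp_all
  obtain y :: 'a where y: "y \<in> WF" "elts y = {k\<in>elts omega. good WF l s n k}"
    by (rule W.sepE[OF W.N_in, of "\<lambda>k. good WF l s n k"]) (intro ufi lsn)+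
  have "elts y \<noteq> {}" using W.good_ex[OF assms(3,2,1)] y(2) by blast
  then obtain m where m: "m \<in> elts y" "elts m \<inter> elts y = {}" using WF_min[OF y(1)] by blast
  have m': "m \<in> elts omega" "good WF l s n m" "\<forall>j\<in>elts m. \<not> good WF l s n j"
    using m y(2) W.N_elts[of m] by blast+
  have e: "k \<in> elts omega \<and> ramsey_good l s n k \<and> (\<forall>j\<in>elts k. \<not> ramsey_good l s n j) \<longleftrightarrow>
     k \<in> elts omega \<and> good WF l s n k \<and> (\<forall>j\<in>elts k. \<not> good WF l s n j)" for k
    using ramsey_good_iff[OF assms] W.N_elts[of k] by blast
  have u: "k = m" if "k \<in> elts omega" "good WF l s n k" "\<forall>j\<in>elts k. \<not> good WF l s n j" for k
    using W.N_linear[OF that(1) m'(1)] that m' by blast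
  have rn: "ramsey_num l s n = m" unfolding ramsey_num_def e
    by (rule the_equality) (use m' u in blast)+
  show "ramsey_num l s n \<in> elts omega" "good WF l s n (ramsey_num l s n)"
    "j \<in> elts (ramsey_num l s n) \<Longrightarrow> \<not> good WF l s n j" using m' rn by auto
  show "k \<in> elts omega \<Longrightarrow> good WF l s n k \<Longrightarrow> (\<forall>j\<in>elts k. \<not> good WF l s n j) \<Longrightarrow> ramsey_num l s n = k"
    using u rn by simp
qed

text \<open>\<open>star\<close> has meaning on \<open>WF\<close> only, so the graph must be a set
  there. It is separated from a product of copies of \<open>omega\<close> by a formula that speaks
  of the least good number and avoids the description \<open>ramsey_num\<close>.\<close>

lemma ramsey_fun_props:
  shows "(ramsey_fun :: 'a::hst) \<in> WF"
    "rel ramsey_fun p k \<longleftrightarrow> (\<exists>l s n. l \<in> elts omega \<and> s \<in> elts omega \<and> n \<in> elts omega \<and> p = triple l s n \<and> k = ramsey_num l s (n::'a))"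
proof -
  obtain P2 :: 'a where P2: "P2 \<in> WF" "elts P2 = {p. \<exists>a\<in>elts omega. \<exists>c\<in>elts omega. p = opair a c}"
    using W.prod_ex[OF W.N_in W.N_in] by blast
  obtain P3 :: 'a where P3: "P3 \<in> WF" "elts P3 = {p. \<exists>a\<in>elts omega. \<exists>c\<in>elts P2. p = opair a c}"
    using W.prod_ex[OF W.N_in P2(1)] by blast
  have "W.dD (\<lambda>e :: nat \<Rightarrow> 'a. \<exists>l\<in>elts omega. \<exists>s\<in>elts omega. \<exists>n\<in>elts omega. e (Suc 0) = opair l (opair s n) \<and>
     good WF l s n (e 0) \<and> (\<forall>j\<in>elts (e 0). \<not> good WF l s n j))" by (intro ufi)
  from W.relsep[OF P3(1) W.N_in this] obtain F :: 'a where F: "F \<in> WF"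
    "\<forall>u v. rel F u v \<longleftrightarrow> u \<in> elts P3 \<and> v \<in> elts omega \<and> (\<exists>l\<in>elts omega. \<exists>s\<in>elts omega. \<exists>n\<in>elts omega. u = opair l (opair s n) \<and>
     good WF l s n v \<and> (\<forall>j\<in>elts v. \<not> good WF l s n j))"
    "\<forall>p\<in>elts F. \<exists>u\<in>elts P3. \<exists>v\<in>elts omega. p = opair u v" by (elim bexE conjE)
  note F2 = F(2)[rule_format]
  have r: "rel F p k \<longleftrightarrow> (\<exists>l s n. l \<in> elts omega \<and> s \<in> elts omega \<and> n \<in> elts omega \<and> p = triple l s n \<and> k = ramsey_num l s n)" for p k
  proof
    assume "rel F p k"
    then obtain l s n where "k \<in> elts omega" "l \<in> elts omega" "s \<in> elts omega" "n \<in> elts omega" "p = opair l (opair s n)"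
     "good WF l s n k" "\<forall>j\<in>elts k. \<not> good WF l s n j" unfolding F2 by blast
    then show "\<exists>l s n. l \<in> elts omega \<and> s \<in> elts omega \<and> n \<in> elts omega \<and> p = triple l s n \<and> k = ramsey_num l s n"
      unfolding triple_def using ramsey_num_props(3) by metis
  next
    assume "\<exists>l s n. l \<in> elts omega \<and> s \<in> elts omega \<and> n \<in> elts omega \<and> p = triple l s n \<and> k = ramsey_num l s n"
    then obtain l s n where l: "l \<in> elts omega" "s \<in> elts omega" "n \<in> elts omega" "p = triple l s n" "k = ramsey_num l s n" by blast
    have "p \<in> elts P3" using l unfolding P3(2) P2(2) triple_def by blast
    then show "rel F p k" unfolding F2 using l ramsey_num_props[OF l(1-3)] unfolding triple_def by blast
  qed
  have "elts F = {opair (triple l s n) (ramsey_num l s n) | l s n. l \<in> elts omega \<and> s \<in> elts omega \<and> n \<in> elts omega}"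
  proof (intro set_eqI iffI)
    fix p assume p: "p \<in> elts F"
    then obtain u v where uv: "p = opair u v" using F(3) by blast
    then have "rel F u v" using p by (simp add: rel_def)
    then show "p \<in> {opair (triple l s n) (ramsey_num l s n) | l s n. l \<in> elts omega \<and> s \<in> elts omega \<and> n \<in> elts omega}"
      unfolding r uv by blast
  next
    fix p assume "p \<in> {opair (triple l s n) (ramsey_num l s n) | l s n. l \<in> elts omega \<and> s \<in> elts omega \<and> n \<in> elts (omega::'a)}"
    then show "p \<in> elts F" using r unfolding rel_def by blast
  qed
  then have "ramsey_fun = F" unfolding ramsey_fun_def by (rule set_of_eqI[OF sym, OF sym])
  then show "(ramsey_fun :: 'a::hst) \<in> WF"
    "rel ramsey_fun p k \<longleftrightarrow> (\<exists>l s n. l \<in> elts omega \<and> s \<in> elts omega \<and> n \<in> elts omega \<and> p = triple l s n \<and> k = ramsey_num l s (n::'a))"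
    using F(1) r by auto
qed

text \<open>Transfers that each triple has a unique value in the graph and that this value is good.
  The last claim replaces the description \<open>star_ramsey\<close> by the internal set
  \<open>star ramsey_fun\<close> in formulas.\<close>

lemma star_ramsey_props:
  assumes "l \<in> elts hnat" "s \<in> elts hnat" "n \<in> elts (hnat::'a::hst)"
  shows "star_ramsey l s n \<in> elts hnat" "good Internal l s n (star_ramsey l s n)"
    "rel (star ramsey_fun) (opair l (opair s n)) k \<longleftrightarrow> k = star_ramsey l s n"
proof -
  have F: "(ramsey_fun :: 'a) \<in> WF" by (rule ramsey_fun_props)
  let ?P = "\<lambda>i. \<forall>l\<in>elts (sw (omega::'a) i). \<forall>s\<in>elts (sw omega i). \<forall>n\<in>elts (sw omega i). \<exists>k\<in>elts (sw omega i).
     rel (sw ramsey_fun i) (opair l (opair s n)) k \<and> good (WI i) l s n k \<and>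
     (\<forall>k'\<in>WI i. rel (sw ramsey_fun i) (opair l (opair s n)) k' \<longrightarrow> k' = k)"
  have u: "uf False WI CW (\<lambda>i (e :: nat \<Rightarrow> 'a). ?P i)" by (intro ufi omega_WF F)
  have "?P False" unfolding WI_simps if_False
  proof (intro ballI)
    fix l s n :: 'a assume l: "l \<in> elts omega" "s \<in> elts omega" "n \<in> elts omega"
    show "\<exists>k\<in>elts omega. rel ramsey_fun (opair l (opair s n)) k \<and> good WF l s n k \<and>
     (\<forall>k'\<in>WF. rel ramsey_fun (opair l (opair s n)) k' \<longrightarrow> k' = k)"
      unfolding ramsey_fun_props(2) triple_def opair_eq
    proof (intro bexI[of _ "ramsey_num l s n"] conjI ballI impI)
      show "\<exists>la sa na. la \<in> elts omega \<and> sa \<in> elts omega \<and> na \<in> elts omega \<and>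
         (l = la \<and> s = sa \<and> n = na) \<and> ramsey_num l s n = ramsey_num la sa na" using l by blast
      show "ramsey_num l s n \<in> elts omega" "good WF l s n (ramsey_num l s n)" by (rule ramsey_num_props[OF l])+
    next
      fix k' :: 'a assume "\<exists>la sa na. la \<in> elts omega \<and> sa \<in> elts omega \<and> na \<in> elts omega \<and>
         (l = la \<and> s = sa \<and> n = na) \<and> k' = ramsey_num la sa na"
      then show "k' = ramsey_num l s n" by (elim exE conjE) simp
    qed
  qed
  then have "?P True" using star_transfer0[OF u] by blast
  then have "\<forall>l\<in>elts hnat. \<forall>s\<in>elts hnat. \<forall>n\<in>elts (hnat::'a). \<exists>k\<in>elts hnat.
     rel (star ramsey_fun) (opair l (opair s n)) k \<and> good Internal l s n k \<and>
     (\<forall>k'\<in>Internal. rel (star ramsey_fun) (opair l (opair s n)) k' \<longrightarrow> k' = k)"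
    unfolding WI_simps if_True hnat_def .
  then obtain k0 where k0: "k0 \<in> elts hnat" "rel (star ramsey_fun) (opair l (opair s n)) k0" "good Internal l s n k0"
    "\<forall>k'\<in>Internal. rel (star ramsey_fun) (opair l (opair s n)) k' \<longrightarrow> k' = k0" using assms by blast
  have un: "k' = k0" if "rel (star ramsey_fun) (opair l (opair s n)) k'" for k'
    using k0(4) H.relD[OF star_int[OF F] that] that by blast
  have e: "star_ramsey l s n = k0" unfolding star_ramsey_def fapp_def triple_def rel_def[symmetric]
    by (rule the_equality) (use k0(2) un in blast)+
  show "star_ramsey l s n \<in> elts hnat" "good Internal l s n (star_ramsey l s n)" unfolding e by (rule k0)+
  show "rel (star ramsey_fun) (opair l (opair s n)) k \<longleftrightarrow> k = star_ramsey l s n"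
    unfolding e using un[of k] k0(2) by (rule_tac iffI) simp_all
qed

section \<open>Finite sets of natural numbers and colourings\<close>

definition below :: "'a::in_st \<Rightarrow> 'a \<Rightarrow> bool" where
  "below x y \<longleftrightarrow> (\<forall>c\<in>elts x. \<forall>d\<in>elts y. c \<in> elts d)"

lemma uf_below[ufi]:
  fixes D :: "'i \<Rightarrow> 'a::hst set"
  assumes "tpc D" "tm b D C t" "tm b D C s"
  shows "uf b D C (\<lambda>i e. below (t i e) (s i e))"
proof -
  note c = tm_consts[OF assms(2)]
  show ?thesis by (rule uf_lift2[OF _ assms(2,3)]) (unfold below_def, intro ufi assms c)
qed

context nat_pow_class
begin

lemma max_ex:
  assumes "A \<in> D" "elts A \<subseteq> elts N" "u \<in> elts N" "sz D A u" "elts A \<noteq> {}"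
  shows "\<exists>a\<in>elts A. \<forall>c\<in>elts A. c = a \<or> c \<in> elts a"
proof -
  have *: "\<forall>A\<in>D. elts A \<subseteq> elts N \<and> sz D A (sc k) \<longrightarrow> (\<exists>a\<in>elts A. \<forall>c\<in>elts A. c = a \<or> c \<in> elts a)"
    if "k \<in> elts N" for k
  proof (rule ind[of k "\<lambda>k. \<forall>A\<in>D. elts A \<subseteq> elts N \<and> sz D A (sc k) \<longrightarrow> (\<exists>a\<in>elts A. \<forall>c\<in>elts A. c = a \<or> c \<in> elts a)", OF that])
    show "\<forall>A\<in>D. elts A \<subseteq> elts N \<and> sz D A (sc zero) \<longrightarrow> (\<exists>a\<in>elts A. \<forall>c\<in>elts A. c = a \<or> c \<in> elts a)"
    proof (intro ballI impI)
      fix A assume A: "A \<in> D" "elts A \<subseteq> elts N \<and> sz D A (sc zero)"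
      then obtain a where a: "a \<in> elts A" using sz_sc_ex by blast
      have "rem A a = zero" using sz_rem[OF _ A(1) a zero_N] A(2) sz_zero_iff by blast
      then have "elts A - {a} = {}" using elts_rem[OF A(1) transD[OF A(1) a]] by simp
      then show "\<exists>a\<in>elts A. \<forall>c\<in>elts A. c = a \<or> c \<in> elts a" using a by blast
    qed
  next
    fix k assume k: "k \<in> elts N" and IH: "\<forall>A\<in>D. elts A \<subseteq> elts N \<and> sz D A (sc k) \<longrightarrow> (\<exists>a\<in>elts A. \<forall>c\<in>elts A. c = a \<or> c \<in> elts a)"
    show "\<forall>A\<in>D. elts A \<subseteq> elts N \<and> sz D A (sc (sc k)) \<longrightarrow> (\<exists>a\<in>elts A. \<forall>c\<in>elts A. c = a \<or> c \<in> elts a)"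
    proof (intro ballI impI)
      fix A assume A: "A \<in> D" "elts A \<subseteq> elts N \<and> sz D A (sc (sc k))"
      then obtain a where a: "a \<in> elts A" using sz_sc_ex by blast
      have aD: "a \<in> D" using transD[OF A(1) a] .
      note er = elts_rem[OF A(1) aD]
      have "sz D (rem A a) (sc k)" using sz_rem[OF _ A(1) a sc_N[OF k]] A(2) by blast
      moreover have "elts (rem A a) \<subseteq> elts N" using er A(2) by blast
      ultimately obtain m where m: "m \<in> elts (rem A a)" "\<forall>c\<in>elts (rem A a). c = m \<or> c \<in> elts m"
        using IH remD(1)[OF A(1) aD] by blast
      have mA: "m \<in> elts A" using m(1) er by blast
      have aN: "a \<in> elts N" "m \<in> elts N" using a mA A(2) by blast+
      have c: "c = a \<or> c = m \<or> c \<in> elts m" if "c \<in> elts A" for c using m(2) er that by blast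
      consider "a = m \<or> a \<in> elts m" | "m \<in> elts a" using N_linear[OF aN(2,1)] by blast
      then show "\<exists>a\<in>elts A. \<forall>c\<in>elts A. c = a \<or> c \<in> elts a"
      proof cases
        case 1 then show ?thesis using c by (intro bexI[OF _ mA]) metis
      next
        case 2 then show ?thesis using c N_transitive[OF aN(1)] by (intro bexI[OF _ a]) metis
      qed
    qed
  qed (intro ufi)
  show ?thesis
  proof (cases rule: N_cases[OF assms(3)])
    case 1
    then have "A = zero" using assms(4) sz_zero_iff by simp
    then show ?thesis using assms(5) by simp
  next
    case (2 m)
    then show ?thesis using *[OF 2(1)] assms by blast
  qed
qed

text \<open>The order of numbers is membership, so an element disjoint from \<open>A\<close> is its
  least element.\<close>

lemma min_ex:
  assumes "A \<in> D" "elts A \<subseteq> elts N" "elts A \<noteq> {}"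
  shows "\<exists>a\<in>elts A. \<forall>c\<in>elts A. c = a \<or> a \<in> elts c"
proof -
  obtain a where a: "a \<in> elts A" "elts a \<inter> elts A = {}" using reg assms by blast
  have "c = a \<or> a \<in> elts c" if "c \<in> elts A" for c
    using N_linear[of a c] a that assms(2) by blast
  then show ?thesis using a by blast
qed

text \<open>The maximum is moved from \<open>y\<close> to \<open>z\<close> repeatedly,
  \<open>k\<close> times in all.\<close>

lemma top_ex:
  assumes "k \<in> elts N" "A \<in> D" "elts A \<subseteq> elts N" "u \<in> elts N" "sz D A u" "k \<in> elts (sc u)"
  shows "\<exists>y\<in>D. \<exists>z\<in>D. un y z = A \<and> below y z \<and> sz D z k"
proof -
  have uD: "u \<in> D" using assms by simp
  have "k \<in> elts (sc u) \<longrightarrow> (\<exists>y\<in>D. \<exists>z\<in>D. un y z = A \<and> below y z \<and> sz D z k)"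
  proof (rule ind[of k "\<lambda>k. k \<in> elts (sc u) \<longrightarrow> (\<exists>y\<in>D. \<exists>z\<in>D. un y z = A \<and> below y z \<and> sz D z k)", OF assms(1)])
    have "un A zero = A" by (intro Extensionality) simp
    then show "zero \<in> elts (sc u) \<longrightarrow> (\<exists>y\<in>D. \<exists>z\<in>D. un y z = A \<and> below y z \<and> sz D z zero)"
      using assms(2) by (intro impI bexI[of _ A] bexI[of _ zero]) (simp_all add: below_def)
  next
    fix k assume k: "k \<in> elts N" and IH: "k \<in> elts (sc u) \<longrightarrow> (\<exists>y\<in>D. \<exists>z\<in>D. un y z = A \<and> below y z \<and> sz D z k)"
    show "sc k \<in> elts (sc u) \<longrightarrow> (\<exists>y\<in>D. \<exists>z\<in>D. un y z = A \<and> below y z \<and> sz D z (sc k))"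
    proof
      assume sk: "sc k \<in> elts (sc u)"
      have ku: "k \<in> elts u" using sk k assms(4) N_transitive[OF assms(4), of "sc k" k] by auto
      then obtain y z where y: "y \<in> D" "z \<in> D" "un y z = A" "below y z" "sz D z k" using IH by auto
      have eA: "elts A = elts y \<union> elts z" using y(3) elts_un by metis
      have "elts y \<noteq> {}"
      proof
        assume "elts y = {}"
        then have "z = A" using eA by (intro Extensionality) simp
        then have "k = u" using sz_unique[OF k assms(4) y(2,5)] assms(5) by simp
        then show False using ku N_irrefl k by blast
      qed
      moreover obtain j where "j \<in> elts N" "sz D y j" using sz_subset[OF assms(4,2,5) y(1)] eA by blast
      ultimately obtain a where a: "a \<in> elts y" "\<forall>c\<in>elts y. c = a \<or> c \<in> elts a"
        using max_ex[OF y(1)] eA assms(3) by blast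
      have aD: "a \<in> D" using transD[OF y(1) a(1)] .
      note er = elts_rem[OF y(1) aD]
      have aN: "a \<notin> elts a" using N_irrefl a(1) eA assms(3) by blast
      have az: "a \<notin> elts z" using y(4) a(1) aN unfolding below_def by blast
      have "un (rem y a) (ins a z) = A" using er eA a(1) by (intro Extensionality) auto
      moreover have "below (rem y a) (ins a z)" unfolding below_def
      proof (intro ballI)
        fix c d assume c: "c \<in> elts (rem y a)" and d: "d \<in> elts (ins a z)"
        have "c \<in> elts y" "c \<noteq> a" using c er by auto
        then have 1: "c \<in> elts a" using a(2) by blast
        show "c \<in> elts d"
        proof (cases "d = a")
          case False
          then have "d \<in> elts z" using d by simp
          then show ?thesis using y(4) \<open>c \<in> elts y\<close> unfolding below_def by blast
        qed (use 1 in simp)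
      qed
      moreover have "sz D (ins a z) (sc k)" using sz_ins[OF y(5) aD az k] .
      ultimately show "\<exists>y\<in>D. \<exists>z\<in>D. un y z = A \<and> below y z \<and> sz D z (sc k)"
        using remD(1)[OF y(1) aD] insD[OF aD y(2)] by blast
    qed
  qed (intro ufi uD assms)
  then show ?thesis using assms by blast
qed

text \<open>The tests \<open>S w j\<close>, \<open>j\<close> below \<open>u\<close>, are packed into
  one colour: the index under a bijection \<open>h\<close> of the function from \<open>u\<close> to
  2 that records their outcomes. Equal colours then mean equal outcomes.\<close>

lemma color_code:
  assumes u: "u \<in> elts N" and F: "F \<in> D" "elts F = {f\<in>D. fn2 f u}" and r: "r \<in> elts N" "sz D F r"
    and X: "X \<in> D" and n: "n \<in> D" and S: "dD (\<lambda>e. S (e (Suc 0)) (e 0))"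
  shows "\<exists>c\<in>D. fcol D c X n r \<and> (\<forall>w v i j. rel c w i \<longrightarrow> rel c v i \<longrightarrow> j \<in> elts u \<longrightarrow> (S w j \<longleftrightarrow> S v j))"
proof -
  have rD: "r \<in> D" "u \<in> D" using r u by simp_all
  have 01: "zero \<noteq> sc (zero::'a)" by simp
  obtain h where h: "h \<in> D" "bijr h F r" using r(2) unfolding sz_def by blast
  note B = bijrD[OF h(2)]
  obtain Q where Q: "Q \<in> D" "elts Q = {z\<in>D. elts z \<subseteq> elts X}" using pow[OF X] by blast
  have S': "dD (\<lambda>e. S (e (\<rho> (Suc 0))) (e (\<rho> 0)))" for \<rho> using uf_rename[OF S, of \<rho>] .
  have "dD (\<lambda>e. S (e (Suc (Suc (Suc 0)))) (e 0))" using S'[of "case_nat 0 (\<lambda>_. 3)"] by (simp add: eval_nat_numeral)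
  note S3 = this
  have "dD (\<lambda>e. sz D (e (Suc 0)) n \<and> (\<exists>\<phi>\<in>elts F. rel h \<phi> (e 0) \<and> (\<forall>j\<in>elts u. rel \<phi> j (sc zero) \<longleftrightarrow> S (e (Suc 0)) j)))"
    by (intro ufi h F rD n S3)
  from relsep[OF Q(1) rD(1) this] obtain c where c: "c \<in> D"
    "\<forall>w i. rel c w i \<longleftrightarrow> w \<in> elts Q \<and> i \<in> elts r \<and> sz D w n \<and> (\<exists>\<phi>\<in>elts F. rel h \<phi> i \<and> (\<forall>j\<in>elts u. rel \<phi> j (sc zero) \<longleftrightarrow> S w j))"
    "\<forall>p\<in>elts c. \<exists>w\<in>elts Q. \<exists>i\<in>elts r. p = opair w i" by (elim bexE conjE)
  note r = c(2)[rule_format]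
  have fF: "fn2 f u" if "f \<in> elts F" for f using F(2) that by blast
  have ext: "\<phi> = \<psi>" if f: "\<phi> \<in> elts F" "\<psi> \<in> elts F" and s: "\<forall>j\<in>elts u. rel \<phi> j (sc zero) \<longleftrightarrow> rel \<psi> j (sc zero)" for \<phi> \<psi>
  proof -
    note p = fn2_D[OF fF[OF f(1)]] and q = fn2_D[OF fF[OF f(2)]]
    have e: "rel \<phi> a i \<longleftrightarrow> rel \<psi> a i" if a: "a \<in> elts u" for a i
    proof -
      obtain x where x: "rel \<phi> a x" using p(2)[OF a] by blast
      obtain y where y: "rel \<psi> a y" using q(2)[OF a] by blast
      have "x = sc zero \<longleftrightarrow> y = sc zero" using s a x y p(3) q(3) by metis
      then have "x = y" using p(1)[OF x] q(1)[OF y] by metis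
      then show ?thesis using x y p(3) q(3) by metis
    qed
    have "x \<in> elts \<phi> \<longleftrightarrow> x \<in> elts \<psi>" for x
    proof -
      have "\<exists>a i. x = opair a i" if "x \<in> elts \<phi> \<or> x \<in> elts \<psi>"
        using that fF[OF f(1)] fF[OF f(2)] unfolding fn2_def by blast
      then show ?thesis using e p(1) q(1) unfolding rel_def by blast
    qed
    then show ?thesis by (intro Extensionality) blast
  qed
  have "\<exists>\<phi>\<in>elts F. \<forall>j\<in>elts u. rel \<phi> j (sc zero) \<longleftrightarrow> S w j" if w: "w \<in> D" for w
  proof -
    have 2: "sc (sc zero) \<in> D" by simp
    have "dD (\<lambda>e. S (e 0) (e (Suc (Suc 0))))" using S'[of "case_nat 2 (\<lambda>_. 0)"] by (simp add: eval_nat_numeral)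
    then have "dD (\<lambda>e. S w (e (Suc 0)))" by (rule uf_const_abs[OF CD_I[OF w], where P = "\<lambda>_ e x. S x (e (Suc 0))"])
    then have "dD (\<lambda>e. e 0 = sc zero \<longleftrightarrow> S w (e (Suc 0)))" by (intro ufi)
    from relsep[OF rD(2) 2 this] obtain \<phi> where \<phi>: "\<phi> \<in> D"
      "\<forall>x v. rel \<phi> x v \<longleftrightarrow> x \<in> elts u \<and> v \<in> elts (sc (sc zero)) \<and> (v = sc zero \<longleftrightarrow> S w x)"
      "\<forall>p\<in>elts \<phi>. \<exists>x\<in>elts u. \<exists>v\<in>elts (sc (sc zero)). p = opair x v" by (elim bexE conjE)
    note rr = \<phi>(2)[rule_format]
    have "fn2 \<phi> u"
    proof (rule fn2_I)
      fix a assume "a \<in> elts u"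
      then show "\<exists>i. rel \<phi> a i" unfolding rr by (intro exI[of _ "if S w a then sc zero else zero"]) auto
    next
      fix a i j assume "rel \<phi> a i" "rel \<phi> a j"
      then show "i = j" unfolding rr elts_sc elts_zero using 01 by blast
    next
      fix a i assume "rel \<phi> a i"
      then show "a \<in> elts u \<and> (i = zero \<or> i = sc zero)" unfolding rr elts_sc elts_zero by blast
    qed (use \<phi>(3) in blast)
    then have "\<phi> \<in> elts F" using F(2) \<phi>(1) by blast
    moreover have "\<forall>j\<in>elts u. rel \<phi> j (sc zero) \<longleftrightarrow> S w j" unfolding rr by simp
    ultimately show ?thesis by blast
  qed
  note ex = this
  have "fcol D c X n r" unfolding fcol_def
  proof (intro conjI ballI impI)
    fix p assume p: "p \<in> elts c"
    then obtain w i where wi: "w \<in> elts Q" "i \<in> elts r" "p = opair w i" using c(3) by blast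
    then have "rel c w i" using p by (simp add: rel_def)
    then show "\<exists>w\<in>D. \<exists>i\<in>elts r. p = opair w i \<and> elts w \<subseteq> elts X \<and> sz D w n" using wi r Q(2) by blast
  next
    fix w assume w: "w \<in> D" "elts w \<subseteq> elts X \<and> sz D w n"
    then have wQ: "w \<in> elts Q" using Q(2) by blast
    obtain \<phi> where \<phi>: "\<phi> \<in> elts F" "\<forall>j\<in>elts u. rel \<phi> j (sc zero) \<longleftrightarrow> S w j" using ex[OF w(1)] by blast
    obtain i where i: "rel h \<phi> i" using B(4)[OF \<phi>(1)] by blast
    have ir: "i \<in> elts r" using B(3)[OF i] .
    have "rel c w i" unfolding r using wQ ir w(2) \<phi> i by blast
    moreover have "j = i" if j: "rel c w j" for j
    proof -
      obtain \<psi> where \<psi>: "\<psi> \<in> elts F" "rel h \<psi> j" "\<forall>j\<in>elts u. rel \<psi> j (sc zero) \<longleftrightarrow> S w j" using j unfolding r by blast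
      have "\<phi> = \<psi>" by (rule ext[OF \<phi>(1) \<psi>(1)]) (use \<phi>(2) \<psi>(3) in blast)
      then show ?thesis using B(6)[OF i] \<psi>(2) by blast
    qed
    ultimately show "\<exists>i\<in>elts r. rel c w i \<and> (\<forall>j\<in>elts r. rel c w j \<longrightarrow> j = i)" using ir by blast
  qed
  moreover have "S w j \<longleftrightarrow> S v j" if wv: "rel c w i" "rel c v i" "j \<in> elts u" for w v i j
  proof -
    obtain \<phi> where \<phi>: "rel h \<phi> i" "\<forall>j\<in>elts u. rel \<phi> j (sc zero) \<longleftrightarrow> S w j" using wv(1) unfolding r by blast
    obtain \<psi> where \<psi>: "rel h \<psi> i" "\<forall>j\<in>elts u. rel \<psi> j (sc zero) \<longleftrightarrow> S v j" using wv(2) unfolding r by blast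
    have "\<phi> = \<psi>" using B(7)[OF \<phi>(1) \<psi>(1)] .
    then show ?thesis using \<phi>(2) \<psi>(2) wv(3) by blast
  qed
  ultimately show ?thesis using c(1) by blast
qed

end

section \<open>Ramsey cuts\<close>

locale ramsey_cut =
  fixes U :: "'a::hst"
  assumes cut: "is_cut U" and proper: "elts U \<noteq> elts hnat" and omega_U: "elts omega \<subseteq> elts U"
    and closed: "closed_under_star_ramsey U" and expo: "exponential U"
begin

lemma U_N: "u \<in> elts U \<Longrightarrow> u \<in> elts hnat" using cut unfolding is_cut_def by blast
lemma U_down: "u \<in> elts U \<Longrightarrow> y \<in> elts u \<Longrightarrow> y \<in> elts U"
  using cut H.N_elts U_N unfolding is_cut_def by blast
text \<open>From \<open>u\<close> below \<open>ipow2 u\<close> it follows that \<open>sc u\<close>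
  is at most \<open>ipow2 u\<close>, and that is in the cut.\<close>

lemma U_sc: assumes "u \<in> elts U" shows "sc u \<in> elts U"
proof -
  have r: "ipow2 u \<in> elts U" using expo assms unfolding exponential_def by blast
  have "sc u \<in> elts (ipow2 u) \<or> sc u = ipow2 u"
    using H.N_step[OF U_N[OF r] ipow2_props(2)[OF U_N[OF assms]]] .
  then show ?thesis using r U_down by auto
qed
lemma U_zero: "zero \<in> elts U" using omega_U U.zero_N by blast
lemma U_lt: "u \<in> elts U \<Longrightarrow> v \<in> elts hnat \<Longrightarrow> v \<notin> elts U \<Longrightarrow> u \<in> elts v"
  using H.N_linear[of v u] U_N U_down by blast
text \<open>Otherwise the cut would be cut out of \<open>hnat\<close> by \<open>P\<close> and hence
  internal; containing zero and closed under successors, it would be all of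
  \<open>hnat\<close>.\<close>

lemma overspill:
  assumes "H.dD (\<lambda>e. P (e 0))" "\<And>u. u \<in> elts U \<Longrightarrow> P u"
  shows "\<exists>u\<in>elts hnat. u \<notin> elts U \<and> P u"
proof (rule ccontr)
  assume no: "\<not> ?thesis"
  obtain J where J: "J \<in> Internal" "elts J = {u\<in>elts hnat. P u}" by (rule H.sepE[OF H.N_in assms(1)])
  have "elts J = elts U" unfolding J(2) using no assms(2) U_N by blast
  then have "elts hnat \<subseteq> elts U" using H.least_N[OF J(1)] U_zero U_sc by simp
  then show False using proper U_N by blast
qed

text \<open>\<open>r\<close> is 2^u in the guise of the size of \<open>F\<close>. The conclusion
  keeps \<open>F\<close> because \<open>color_code\<close> turns its elements into colours.\<close>

lemma ramsey_overspill:
  assumes A: "A \<in> Internal" "v \<in> elts hnat" "v \<notin> elts U" "sz Internal A v" and n: "n \<in> elts U"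
  shows "\<exists>u\<in>elts hnat. u \<notin> elts U \<and> (\<exists>F\<in>Internal. \<exists>r\<in>elts hnat. elts F = {f\<in>Internal. fn2 f u} \<and> sz Internal F r \<and> u \<in> elts r \<and>
     (\<forall>c\<in>Internal. fcol Internal c A n r \<longrightarrow> (\<exists>H\<in>Internal. elts H \<subseteq> elts A \<and> sz Internal H u \<and> homf Internal c H n r)))"
proof -
  let ?K = "star (ramsey_fun :: 'a)"
  have KI: "?K \<in> Internal" by (rule star_int[OF ramsey_fun_props(1)])
  have nN: "n \<in> elts hnat" using U_N n .
  \<comment> \<open>Says that the Ramsey number for size \<open>u\<close>, 2^u colours and
    \<open>n\<close>-sets is below \<open>v\<close>. It is phrased with the set of functions and the
    graph of the Ramsey function, as \<open>ipow2\<close> and \<open>star_ramsey\<close> are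
    descriptions. On the cut it holds by exponentiality and closure.\<close>
  define P where "P u \<longleftrightarrow> (\<exists>F\<in>Internal. \<exists>r\<in>elts hnat. \<exists>k\<in>elts v. (\<forall>f\<in>Internal. f \<in> elts F \<longleftrightarrow> fn2 f u) \<and> sz Internal F r \<and>
     rel ?K (opair u (opair r n)) k)" for u
  have "\<exists>u\<in>elts hnat. u \<notin> elts U \<and> P u"
  proof (rule overspill)
    show "H.dD (\<lambda>e. P (e 0))" unfolding P_def by (intro ufi KI H.N_D A nN)
  next
    fix u assume u: "u \<in> elts U"
    obtain F where F: "F \<in> Internal" "elts F = {f\<in>Internal. fn2 f u}" "sz Internal F (ipow2 u)"
      using ipow2_props(3)[OF U_N[OF u]] by blast
    have r: "ipow2 u \<in> elts U" using expo u unfolding exponential_def by blast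
    have "star_ramsey u (ipow2 u) n \<in> elts U" using closed u r n unfolding closed_under_star_ramsey_def by blast
    then have "star_ramsey u (ipow2 u) n \<in> elts v" using U_lt A by blast
    moreover have "rel ?K (opair u (opair (ipow2 u) n)) (star_ramsey u (ipow2 u) n)"
      using star_ramsey_props(3)[OF U_N[OF u] U_N[OF r] nN] by blast
    ultimately show "P u" unfolding P_def using F U_N[OF r] by blast
  qed
  then obtain u F r k where u: "u \<in> elts hnat" "u \<notin> elts U" "F \<in> Internal" "r \<in> elts hnat" "k \<in> elts v"
    "\<forall>f\<in>Internal. f \<in> elts F \<longleftrightarrow> fn2 f u" "sz Internal F r" "rel ?K (opair u (opair r n)) k" unfolding P_def by blast
  have F': "elts F = {f\<in>Internal. fn2 f u}" using u(6) internal_trans[OF u(3)] by blast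
  have k: "k = star_ramsey u r n" using star_ramsey_props(3)[OF u(1,4) nN] u(8) by blast
  have kN: "k \<in> elts hnat" using H.N_elts[OF A(2) u(5)] .
  have good: "good Internal u r n k" using star_ramsey_props(2)[OF u(1,4) nN] k by simp
  have kv: "k \<in> elts (sc v)" using u(5) by simp
  \<comment> \<open>\<open>good\<close> concerns sets of size exactly \<open>k\<close>, so
    \<open>A\<close> is cut down to \<open>B\<close> and the colouring is restricted to
    \<open>d\<close>.\<close>
  obtain B where B: "B \<in> Internal" "elts B \<subseteq> elts A" "sz Internal B k" using H.sz_sub_ex[OF A(2) kv A(1,4)] by blast
  have rI: "r \<in> Internal" "n \<in> Internal" using u(4) nN by simp_all
  have "\<exists>H\<in>Internal. elts H \<subseteq> elts A \<and> sz Internal H u \<and> homf Internal c H n r" if c: "c \<in> Internal" "fcol Internal c A n r" for c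
  proof -
    obtain Q where Q: "Q \<in> Internal" "elts Q = {z\<in>Internal. elts z \<subseteq> elts B}" using H.pow[OF B(1)] by blast
    have "H.dD (\<lambda>e. sz Internal (e (Suc 0)) n \<and> rel c (e (Suc 0)) (e 0))" by (intro ufi rI c)
    from H.relsep[OF Q(1) rI(1) this] obtain d where d: "d \<in> Internal"
      "\<forall>w i. rel d w i \<longleftrightarrow> w \<in> elts Q \<and> i \<in> elts r \<and> sz Internal w n \<and> rel c w i"
      "\<forall>p\<in>elts d. \<exists>w\<in>elts Q. \<exists>i\<in>elts r. p = opair w i" by (elim bexE conjE)
    have "fcol Internal d B n r" unfolding fcol_def
    proof (intro conjI ballI impI)
      fix p assume p: "p \<in> elts d"
      then obtain w i where wi: "w \<in> elts Q" "i \<in> elts r" "p = opair w i" using d(3) by blast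
      then have "rel d w i" using p by (simp add: rel_def)
      then show "\<exists>w\<in>Internal. \<exists>i\<in>elts r. p = opair w i \<and> elts w \<subseteq> elts B \<and> sz Internal w n" using wi d(2) Q(2) by blast
    next
      fix w assume w: "w \<in> Internal" "elts w \<subseteq> elts B \<and> sz Internal w n"
      then have "elts w \<subseteq> elts A" using B(2) by blast
      then obtain i where "i \<in> elts r" "rel c w i" "\<forall>j\<in>elts r. rel c w j \<longrightarrow> j = i"
        using c(2) w unfolding fcol_def by blast
      then show "\<exists>i\<in>elts r. rel d w i \<and> (\<forall>j\<in>elts r. rel d w j \<longrightarrow> j = i)" using d(2) w Q(2) by blast
    qed
    then obtain H where H: "H \<in> Internal" "elts H \<subseteq> elts B" "sz Internal H u" "homf Internal d H n r"
      using H.good_transport[OF good kN u(1) nN rI(1) B(1,3) d(1)] by blast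
    have "homf Internal c H n r" unfolding homf_def
    proof (intro ballI impI)
      fix w v i j assume w: "w \<in> Internal" "v \<in> Internal"
        "elts w \<subseteq> elts H \<and> sz Internal w n \<and> elts v \<subseteq> elts H \<and> sz Internal v n" "i \<in> elts r" "j \<in> elts r" "rel c w i" "rel c v j"
      have "w \<in> elts Q" "v \<in> elts Q" using w(1-3) H(2) Q(2) by blast+
      then have "rel d w i" "rel d v j" using d(2) w by blast+
      then show "i = j" using H(4) w unfolding homf_def by blast
    qed
    then show ?thesis using H B(2) by blast
  qed
  moreover have "u \<in> elts r" using H.cantor[OF u(1,3) F' u(4,7)] .
  ultimately show ?thesis using u F' by blast
qed

text \<open>The property \<open>Q\<close> is encoded by tests that do not depend on
  \<open>j\<close>, so the general Ramsey statement with 2^u colours covers it.\<close>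

lemma ramsey_two_colours:
  assumes A: "A \<in> Internal" "v \<in> elts hnat" "v \<notin> elts U" "sz Internal A v" and n: "n \<in> elts U"
    and Q: "H.dD (\<lambda>e. Q (e 0))"
  shows "\<exists>H\<in>Internal. elts H \<subseteq> elts A \<and> (\<exists>u\<in>elts hnat. u \<notin> elts U \<and> sz Internal H u) \<and>
    ((\<forall>w\<in>Internal. elts w \<subseteq> elts H \<longrightarrow> sz Internal w n \<longrightarrow> Q w) \<or> (\<forall>w\<in>Internal. elts w \<subseteq> elts H \<longrightarrow> sz Internal w n \<longrightarrow> \<not> Q w))"
proof -
  have nI: "n \<in> Internal" using U_N[OF n] by simp
  obtain u F r where u: "u \<in> elts hnat" "u \<notin> elts U" "F \<in> Internal" "r \<in> elts hnat" "elts F = {f\<in>Internal. fn2 f u}"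
     "sz Internal F r" and ram: "\<And>c. c \<in> Internal \<Longrightarrow> fcol Internal c A n r \<Longrightarrow>
      (\<exists>H\<in>Internal. elts H \<subseteq> elts A \<and> sz Internal H u \<and> homf Internal c H n r)"
    using ramsey_overspill[OF A n] by blast
  have "H.dD (\<lambda>e. Q (e (Suc 0)))" using uf_rename[OF Q, of "\<lambda>_. Suc 0"] .
  from H.color_code[OF u(1,3,5,4,6) A(1) nI this] obtain c where c: "c \<in> Internal" "fcol Internal c A n r"
    "\<forall>w v i j. rel c w i \<longrightarrow> rel c v i \<longrightarrow> j \<in> elts u \<longrightarrow> (Q w \<longleftrightarrow> Q v)" by (elim bexE conjE)
  obtain H where H: "H \<in> Internal" "elts H \<subseteq> elts A" "sz Internal H u" "homf Internal c H n r" using ram[OF c(1,2)] by blast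
  \<comment> \<open>Decoding needs at least one test; \<open>u\<close> exceeds zero since it lies
    above the cut.\<close>
  have u0: "zero \<in> elts u" using U_lt[OF U_zero u(1,2)] .
  have "Q w \<longleftrightarrow> Q v" if w: "w \<in> Internal" "elts w \<subseteq> elts H" "sz Internal w n" "v \<in> Internal" "elts v \<subseteq> elts H" "sz Internal v n" for w v
  proof -
    have "\<exists>i\<in>elts r. rel c w i" using c(2) w(1,3) subset_trans[OF w(2) H(2)] unfolding fcol_def by blast
    then obtain i where i: "i \<in> elts r" "rel c w i" by blast
    have "\<exists>i\<in>elts r. rel c v i" using c(2) w(4,6) subset_trans[OF w(5) H(2)] unfolding fcol_def by blast
    then obtain j where j: "j \<in> elts r" "rel c v j" by blast
    have "i = j" using H(4) w i j unfolding homf_def by blast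
    then show ?thesis using c(3) i(2) j(2) u0 by blast
  qed
  then have "(\<forall>w\<in>Internal. elts w \<subseteq> elts H \<longrightarrow> sz Internal w n \<longrightarrow> Q w) \<or>
      (\<forall>w\<in>Internal. elts w \<subseteq> elts H \<longrightarrow> sz Internal w n \<longrightarrow> \<not> Q w)" by blast
  then show ?thesis using H(1-3) u(1,2) by blast
qed

lemma sz_sub_U:
  assumes "x \<in> Internal" "y \<in> Internal" "elts y \<subseteq> elts x" "m \<in> elts U" "sz Internal x m" "k \<in> elts hnat" "sz Internal y k"
  shows "k \<in> elts U"
proof -
  obtain j where j: "j \<in> elts hnat" "sz Internal y j" "y = x \<or> j \<in> elts m"
    using H.sz_subset[OF U_N[OF assms(4)] assms(1,5,2,3)] by blast
  have "j = k" using H.sz_unique[OF j(1) assms(6,2) j(2) assms(7)] .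
  show ?thesis
  proof (cases "y = x")
    case True
    then have "k = m" using H.sz_unique[OF assms(6) U_N[OF assms(4)] assms(2,7)] assms(5) by simp
    then show ?thesis using assms by simp
  next
    case False
    then show ?thesis using j(3) \<open>j = k\<close> U_down assms(4) by blast
  qed
qed

text \<open>Closure of the cut under addition comes from the pigeonhole instance of \<open>*K\<close>.\<close>

lemma U_add:
  assumes x: "x \<in> Internal" "m \<in> elts U" "sz Internal x m" and y: "y \<in> Internal" "k \<in> elts U" "sz Internal y k"
    and v: "v \<in> elts hnat" "sz Internal (un x y) v"
  shows "v \<in> elts U"
proof (rule ccontr)
  assume vU: "v \<notin> elts U"
  have one: "sc zero \<in> elts U" using U_sc U_zero by blast
  \<comment> \<open>Singletons are coloured by whether their element is in \<open>x\<close>. A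
    homogeneous set lies inside \<open>x\<close> or inside \<open>y\<close>, and its size outside
    the cut is too large for either.\<close>
  have "H.dD (\<lambda>e. \<exists>a\<in>elts (e 0). a \<in> elts x)" by (intro ufi x)
  from ramsey_two_colours[OF H.unD[OF x(1) y(1)] v(1) vU v(2) one this]
  obtain H u where H: "H \<in> Internal" "elts H \<subseteq> elts (un x y)" "u \<in> elts hnat" "u \<notin> elts U" "sz Internal H u"
    "(\<forall>w\<in>Internal. elts w \<subseteq> elts H \<longrightarrow> sz Internal w (sc zero) \<longrightarrow> (\<exists>a\<in>elts w. a \<in> elts x)) \<or>
     (\<forall>w\<in>Internal. elts w \<subseteq> elts H \<longrightarrow> sz Internal w (sc zero) \<longrightarrow> \<not> (\<exists>a\<in>elts w. a \<in> elts x))" by blast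
  have w: "ins a zero \<in> Internal \<and> sz Internal (ins a zero) (sc zero)" if "a \<in> elts H" for a
  proof -
    have "a \<in> Internal" using that H(1) internal_trans by blast
    then show ?thesis using H.sz_ins[OF H.sz_zero] by simp
  qed
  from H(6) show False
  proof
    assume *: "\<forall>w\<in>Internal. elts w \<subseteq> elts H \<longrightarrow> sz Internal w (sc zero) \<longrightarrow> (\<exists>a\<in>elts w. a \<in> elts x)"
    have "elts H \<subseteq> elts x"
    proof
      fix a assume a: "a \<in> elts H"
      then have "\<exists>b\<in>elts (ins a zero). b \<in> elts x" using *[rule_format, of "ins a zero"] w[OF a] a by simp
      then show "a \<in> elts x" by simp
    qed
    then show False using sz_sub_U[OF x(1) H(1) _ x(2,3) H(3,5)] H(4) by blast
  next
    assume *: "\<forall>w\<in>Internal. elts w \<subseteq> elts H \<longrightarrow> sz Internal w (sc zero) \<longrightarrow> \<not> (\<exists>a\<in>elts w. a \<in> elts x)"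
    have "elts H \<subseteq> elts y"
    proof
      fix a assume a: "a \<in> elts H"
      then have "\<not> (\<exists>b\<in>elts (ins a zero). b \<in> elts x)" using *[rule_format, of "ins a zero"] w[OF a] a by simp
      then have "a \<notin> elts x" by simp
      then show "a \<in> elts y" using a H(2) by auto
    qed
    then show False using sz_sub_U[OF y(1) H(1) _ y(2,3) H(3,5)] H(4) by blast
  qed
qed

end

section \<open>Saturation\<close>

lemma uf_Internal[ufi]: "uf True (\<lambda>_::unit. UNIV) UNIV (\<lambda>_ e. e (k::nat) \<in> (Internal :: 'a::hst set))"
  unfolding Internal_def mem_Collect_eq by (intro ufi)

lemma uf_sz_WF[ufi]: "uf True (\<lambda>_::unit. UNIV) UNIV (\<lambda>_ e. sz (WF :: 'a::hst set) (e (j::nat)) (e (k::nat)))"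
  unfolding sz_def Bex_def by (intro ufi)

text \<open>Standard sets around the elements are collected; Standardization makes the collection
  standard without losing them, and its union is the cover.\<close>

lemma internal_cover:
  assumes "elts x \<subseteq> (Internal :: 'a::hst set)" shows "\<exists>R\<in>Internal. elts x \<subseteq> elts R"
proof -
  have "dU (\<lambda>e::nat \<Rightarrow> 'a. st (e (Suc 0)) \<and> e 0 \<in> elts (e (Suc 0)))" by (intro ufi)
  from collU[OF this, of x] obtain y where
    y: "\<forall>a\<in>elts x. (\<exists>v. st v \<and> a \<in> elts v) \<longrightarrow> (\<exists>v\<in>elts y. st v \<and> a \<in> elts v)" by blast
  obtain y' where y': "st y'" "elts y' \<inter> Standard = elts y \<inter> Standard" using Standardization by blast
  obtain V where V: "st V" "elts V = (\<Union>z\<in>elts y'. elts z)" using std_Union[OF y'(1)] by blast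
  have "elts x \<subseteq> elts V"
  proof
    fix a assume a: "a \<in> elts x"
    then have "\<exists>v. st v \<and> a \<in> elts v" using assms unfolding Internal_def by blast
    then obtain v where v: "v \<in> elts y" "st v" "a \<in> elts v" using y a by blast
    then have "v \<in> elts y'" using y'(2) unfolding st_iff by blast
    then show "a \<in> elts V" unfolding V(2) using v by blast
  qed
  then show ?thesis using std_internal[OF V(1)] by blast
qed

text \<open>For each finite \<open>t\<close> inside \<open>J\<close> consider the internal functions
  on part of \<open>m\<close> that take all values of \<open>F\<close> on \<open>t\<close>. These
  families are internal, nonempty because \<open>m\<close> exceeds all true natural numbers, and
  closed under intersection by uniting the sets \<open>t\<close>. Saturation yields a function in
  all of them.\<close>

lemma saturated_enumeration:
  fixes J F m :: "'a::hst"
  assumes J: "J \<in> WF" and F: "is_function F" "fdom F = elts J" "frange F \<subseteq> Internal"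
    and m: "m \<in> elts hnat" "elts omega \<subseteq> elts m"
  shows "\<exists>G\<in>Internal. (\<forall>i Z Z'. rel G i Z \<longrightarrow> rel G i Z' \<longrightarrow> Z = Z') \<and> (\<forall>i Z. rel G i Z \<longrightarrow> i \<in> elts m) \<and>
     (\<forall>p Z. rel F p Z \<longrightarrow> (\<exists>i. rel G i Z))"
proof -
  have Ffun: "Z = Z'" if "rel F p Z" "rel F p Z'" for p Z Z' using is_functionD(2)[OF F(1) that] .
  have "small {Z. \<exists>p\<in>elts J. rel F p Z}"
  proof (rule small_imageU[OF small_elts])
    show "dU (\<lambda>e. rel F (e 0) (e (Suc 0)))" by (intro ufi)
  qed (rule Ffun)
  then obtain x where x: "elts x = {Z. \<exists>p\<in>elts J. rel F p Z}" by (auto simp: small_def)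
  have "elts x \<subseteq> Internal" unfolding x using F(3) frange_rel by blast
  then obtain R where R: "R \<in> Internal" "elts x \<subseteq> elts R" using internal_cover by blast
  have FR: "Z \<in> elts R" "p \<in> elts J" if "rel F p Z" for p Z
  proof -
    show "p \<in> elts J" using F(2) fdom_rel that by blast
    then show "Z \<in> elts R" using R(2) x that by blast
  qed
  have FJ: "\<exists>Z. rel F p Z" if "p \<in> elts J" for p using F(2) fdom_rel that by blast
  have mI: "m \<in> Internal" using m by simp
  obtain P where P: "P \<in> Internal" "elts P = {p. \<exists>a\<in>elts m. \<exists>c\<in>elts R. p = opair a c}"
    using H.prod_ex[OF mI R(1)] by blast
  obtain S where S: "S \<in> Internal" "elts S = {z\<in>Internal. elts z \<subseteq> elts P}" using H.pow[OF P(1)] by blast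
  \<comment> \<open>Bounding the values by \<open>R\<close> makes the candidate functions an
    internal set, from which the families are separated.\<close>
  obtain Q where Q: "Q \<in> Internal" "elts Q = {G\<in>elts S. \<forall>i\<in>elts m. \<forall>Z\<in>elts R. \<forall>Z'\<in>elts R. rel G i Z \<longrightarrow> rel G i Z' \<longrightarrow> Z = Z'}"
    by (rule H.sepE[OF S(1), of "\<lambda>G. \<forall>i\<in>elts m. \<forall>Z\<in>elts R. \<forall>Z'\<in>elts R. rel G i Z \<longrightarrow> rel G i Z' \<longrightarrow> Z = Z'"]) (intro ufi R mI)+
  have Pm: "i \<in> elts m \<and> Z \<in> elts R" if "G \<in> elts Q" "rel G i Z" for G i Z
  proof -
    have "elts G \<subseteq> elts P" using that(1) Q(2) S(2) by blast
    then have "opair i Z \<in> elts P" using that(2) unfolding rel_def by blast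
    then show ?thesis unfolding P(2) by auto
  qed
  have QF: "Z = Z'" if "G \<in> elts Q" "rel G i Z" "rel G i Z'" for G i Z Z'
    using Pm[OF that(1,2)] Pm[OF that(1,3)] that Q(2) by blast
  have QI: "G \<in> Internal" if "G \<in> elts Q" for G using internal_trans[OF Q(1) that] .
  define hit where "hit G p \<longleftrightarrow> (\<exists>Z. rel F p Z \<and> (\<exists>i. rel G i Z))" for G p
  define isZ where "isZ t Z \<longleftrightarrow> (\<forall>G. G \<in> elts Z \<longleftrightarrow> G \<in> elts Q \<and> (\<forall>p\<in>elts t. hit G p))" for t Z
  have isZ_un: "Z = Z'" if "isZ t Z" "isZ t Z'" for t Z Z' using that unfolding isZ_def by (intro Extensionality) blast
  \<comment> \<open>\<open>F\<close> is external, so it cannot define the families at once; they are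
    shown internal by an external induction on the size of \<open>t\<close>. The witness uses
    indices below \<open>k\<close> only, which leaves index \<open>k\<close> free for the next
    value.\<close>
  have claim: "\<forall>t. t \<in> WF \<and> elts t \<subseteq> elts J \<and> sz WF t k \<longrightarrow> (\<exists>Z. Z \<in> Internal \<and> isZ t Z) \<and>
      (\<exists>G. G \<in> elts Q \<and> (\<forall>p\<in>elts t. hit G p) \<and> (\<forall>i Z. rel G i Z \<longrightarrow> i \<in> elts k))" if "k \<in> elts omega" for k
  proof (rule U.ind[of k "\<lambda>k. \<forall>t. t \<in> WF \<and> elts t \<subseteq> elts J \<and> sz WF t k \<longrightarrow> (\<exists>Z. Z \<in> Internal \<and> isZ t Z) \<and>
      (\<exists>G. G \<in> elts Q \<and> (\<forall>p\<in>elts t. hit G p) \<and> (\<forall>i Z. rel G i Z \<longrightarrow> i \<in> elts k))", OF that])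
    show "dU (\<lambda>e. \<forall>t. t \<in> WF \<and> elts t \<subseteq> elts J \<and> sz WF t (e 0) \<longrightarrow> (\<exists>Z. Z \<in> Internal \<and> isZ t Z) \<and>
      (\<exists>G. G \<in> elts Q \<and> (\<forall>p\<in>elts t. hit G p) \<and> (\<forall>i Z. rel G i Z \<longrightarrow> i \<in> elts (e 0))))"
      unfolding isZ_def hit_def by (intro ufi)
  next
    show "\<forall>t. t \<in> WF \<and> elts t \<subseteq> elts J \<and> sz WF t zero \<longrightarrow> (\<exists>Z. Z \<in> Internal \<and> isZ t Z) \<and>
      (\<exists>G. G \<in> elts Q \<and> (\<forall>p\<in>elts t. hit G p) \<and> (\<forall>i Z. rel G i Z \<longrightarrow> i \<in> elts zero))"
    proof (intro allI impI)
      fix t :: 'a assume "t \<in> WF \<and> elts t \<subseteq> elts J \<and> sz WF t zero"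
      then have t: "t = zero" using W.sz_zero_iff by blast
      have "isZ t Q" unfolding isZ_def t by simp
      moreover have "zero \<in> elts Q" unfolding Q(2) S(2) by (simp add: rel_def)
      ultimately show "(\<exists>Z. Z \<in> Internal \<and> isZ t Z) \<and>
        (\<exists>G. G \<in> elts Q \<and> (\<forall>p\<in>elts t. hit G p) \<and> (\<forall>i Z. rel G i Z \<longrightarrow> i \<in> elts zero))"
        using Q(1) unfolding t by (intro conjI exI[of _ Q] exI[of _ zero]) (simp_all add: rel_def)
    qed
  next
    fix k :: 'a assume k: "k \<in> elts omega" and IH: "\<forall>t. t \<in> WF \<and> elts t \<subseteq> elts J \<and> sz WF t k \<longrightarrow> (\<exists>Z. Z \<in> Internal \<and> isZ t Z) \<and>
      (\<exists>G. G \<in> elts Q \<and> (\<forall>p\<in>elts t. hit G p) \<and> (\<forall>i Z. rel G i Z \<longrightarrow> i \<in> elts k))"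
    show "\<forall>t. t \<in> WF \<and> elts t \<subseteq> elts J \<and> sz WF t (sc k) \<longrightarrow> (\<exists>Z. Z \<in> Internal \<and> isZ t Z) \<and>
      (\<exists>G. G \<in> elts Q \<and> (\<forall>p\<in>elts t. hit G p) \<and> (\<forall>i Z. rel G i Z \<longrightarrow> i \<in> elts (sc k)))"
    proof (intro allI impI)
      fix t :: 'a assume t: "t \<in> WF \<and> elts t \<subseteq> elts J \<and> sz WF t (sc k)"
      then obtain p where p: "p \<in> elts t" using W.sz_sc_ex by blast
      have tW: "t \<in> WF" and pW: "p \<in> WF" using t WF_trans p by blast+
      define t' where "t' = rem t p"
      have t': "t' \<in> WF" "elts t' = elts t - {p}" "sz WF t' k"
        unfolding t'_def using W.remD(1)[OF tW pW] W.elts_rem[OF tW pW] W.sz_rem[OF _ tW p k] t by blast+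
      have tt: "q \<in> elts t \<longleftrightarrow> q = p \<or> q \<in> elts t'" for q using t'(2) p by blast
      have "elts t' \<subseteq> elts J" using t t'(2) by blast
      then have IH': "(\<exists>Z. Z \<in> Internal \<and> isZ t' Z) \<and>
          (\<exists>G. G \<in> elts Q \<and> (\<forall>p\<in>elts t'. hit G p) \<and> (\<forall>i Z. rel G i Z \<longrightarrow> i \<in> elts k))"
        using IH t'(1,3) by blast
      obtain Z' where Z': "Z' \<in> Internal" "isZ t' Z'" using IH' by blast
      obtain G' where G': "G' \<in> elts Q" "\<forall>p\<in>elts t'. hit G' p" "\<forall>i Z. rel G' i Z \<longrightarrow> i \<in> elts k" using IH' by blast
      have "p \<in> elts J" using t p by blast
      then obtain X where X: "rel F p X" using FJ by blast
      have XR: "X \<in> elts R" using FR(1)[OF X] .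
      have XI: "X \<in> Internal" using internal_trans[OF R(1) XR] .
      have hitp: "hit G p \<longleftrightarrow> (\<exists>i. rel G i X)" for G unfolding hit_def using X Ffun by blast
      \<comment> \<open>The one new value \<open>X\<close> is an internal set and may be a parameter
        of internal Separation.\<close>
      obtain Z where Z: "Z \<in> Internal" "elts Z = {G\<in>elts Z'. \<exists>i\<in>elts m. rel G i X}"
        by (rule H.sepE[OF Z'(1), of "\<lambda>G. \<exists>i\<in>elts m. rel G i X"]) (intro ufi mI XI)+
      have "G \<in> elts Z \<longleftrightarrow> G \<in> elts Q \<and> (\<forall>q\<in>elts t. hit G q)" for G
      proof -
        have "G \<in> elts Z \<longleftrightarrow> G \<in> elts Q \<and> (\<forall>q\<in>elts t'. hit G q) \<and> (\<exists>i\<in>elts m. rel G i X)"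
          using Z'(2) unfolding Z(2) isZ_def by blast
        also have "\<dots> \<longleftrightarrow> G \<in> elts Q \<and> (\<forall>q\<in>elts t'. hit G q) \<and> hit G p" unfolding hitp using Pm by blast
        also have "\<dots> \<longleftrightarrow> G \<in> elts Q \<and> (\<forall>q\<in>elts t. hit G q)" unfolding Ball_def tt by auto
        finally show ?thesis .
      qed
      then have ZZ: "isZ t Z" unfolding isZ_def by blast
      let ?G = "ins (opair k X) G'"
      have km: "k \<in> elts m" using k m(2) by blast
      have kk: "k \<notin> elts k" using W.N_irrefl[OF k] .
      have "elts G' \<subseteq> elts P" using G'(1) Q(2) S(2) by blast
      moreover have "opair k X \<in> elts P" unfolding P(2) using km XR by blast
      ultimately have "elts ?G \<subseteq> elts P" by simp
      moreover have "?G \<in> Internal" using QI[OF G'(1)] H.transD[OF mI km] XI by simp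
      ultimately have "?G \<in> elts S" unfolding S(2) by blast
      moreover have "Z = Z'" if z: "rel ?G i Z" "rel ?G i Z'" for i Z Z'
      proof -
        have "\<not> rel G' k Y" for Y using G'(3) kk by blast
        then show ?thesis using z QF[OF G'(1)] unfolding rel_ins by blast
      qed
      ultimately have "?G \<in> elts Q" unfolding Q(2) by blast
      moreover have "hit ?G q" if q: "q \<in> elts t" for q
      proof -
        consider "q = p" | "q \<in> elts t'" using q unfolding tt by blast
        then show ?thesis
        proof cases
          case 1 then show ?thesis using hitp rel_ins by blast
        next
          case 2 then show ?thesis using G'(2) unfolding hit_def rel_ins by blast
        qed
      qed
      moreover have "i \<in> elts (sc k)" if "rel ?G i Y" for i Y using that G'(3) unfolding rel_ins elts_sc by blast
      ultimately show "(\<exists>Z. Z \<in> Internal \<and> isZ t Z) \<and>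
        (\<exists>G. G \<in> elts Q \<and> (\<forall>p\<in>elts t. hit G p) \<and> (\<forall>i Z. rel G i Z \<longrightarrow> i \<in> elts (sc k)))" using Z(1) ZZ by blast
    qed
  qed
  \<comment> \<open>\<open>T\<close> below is the set of all finite subsets of \<open>J\<close>,
    formed inside \<open>WF\<close> so that \<open>star T\<close> is available.\<close>
  obtain S' where S': "S' \<in> WF" "elts S' = {z\<in>WF. elts z \<subseteq> elts J}" using W.pow[OF J] by blast
  obtain T where T: "T \<in> WF" "elts T = {t\<in>elts S'. \<exists>k\<in>elts omega. sz WF t k}"
    by (rule W.sepE[OF S'(1), of "\<lambda>t. \<exists>k\<in>elts omega. sz WF t k"]) (intro ufi)+
  have T': "t \<in> elts T \<longleftrightarrow> t \<in> WF \<and> elts t \<subseteq> elts J \<and> (\<exists>k\<in>elts omega. sz WF t k)" for t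
    unfolding T(2) S'(2) by blast
  have TZ: "\<exists>Z. Z \<in> Internal \<and> isZ t Z \<and> elts Z \<noteq> {}" if "t \<in> elts T" for t
  proof -
    obtain k where k: "k \<in> elts omega" "t \<in> WF \<and> elts t \<subseteq> elts J \<and> sz WF t k" using \<open>t \<in> elts T\<close> T' by blast
    obtain Z where Z: "Z \<in> Internal" "isZ t Z" using claim[OF k(1)] k(2) by blast
    obtain G where "G \<in> elts Q" "\<forall>p\<in>elts t. hit G p" using claim[OF k(1)] k(2) by blast
    then have "G \<in> elts Z" using Z(2) unfolding isZ_def by blast
    then show ?thesis using Z by blast
  qed
  have uisZ: "dU (\<lambda>e. isZ (e j) (e k))" for j k unfolding isZ_def hit_def by (intro ufi)
  have "small {Z. \<exists>t\<in>elts T. isZ t Z}"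
    by (rule small_imageU[where R = isZ, OF small_elts uisZ isZ_un])
  then obtain z where z: "elts z = {Z. \<exists>t\<in>elts T. isZ t Z}" by (auto simp: small_def)
  have zt: "Z \<in> elts z \<longleftrightarrow> (\<exists>t\<in>elts T. isZ t Z)" for Z unfolding z by blast
  \<comment> \<open>Saturation requires indexing by the standard elements of a standard set; those
    of \<open>star T\<close> collapse exactly to the members of \<open>T\<close>.\<close>
  have "small {q. \<exists>s\<in>elts (star T). \<exists>t Z. col s t \<and> isZ t Z \<and> q = opair s Z}"
  proof (rule small_imageU[OF small_elts])
    show "dU (\<lambda>e. \<exists>t Z. col (e 0) t \<and> isZ t Z \<and> e (Suc 0) = opair (e 0) Z)" by (intro ufi uisZ)
  next
    fix s q q' assume "\<exists>t Z. col s t \<and> isZ t Z \<and> q = opair s Z" "\<exists>t Z. col s t \<and> isZ t Z \<and> q' = opair s Z"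
    then show "q = q'" using col_fun isZ_un by metis
  qed
  then obtain f where f: "elts f = {q. \<exists>s\<in>elts (star T). \<exists>t Z. col s t \<and> isZ t Z \<and> q = opair s Z}" by (auto simp: small_def)
  have rf: "rel f s Z \<longleftrightarrow> s \<in> elts (star T) \<and> (\<exists>t. col s t \<and> isZ t Z)" for s Z
    unfolding rel_def f by auto
  have cT: "t \<in> elts T \<longleftrightarrow> (\<exists>s\<in>elts (star T). st s \<and> col s t)" for t using col_elts[OF star_col[OF T(1)]] .
  have "standard_size z" unfolding standard_size_def
  proof (intro exI conjI)
    show "st (star T)" using star_st[OF T(1)] .
    show "is_function f"
    proof (rule is_functionI)
      show "\<exists>x y. p = opair x y" if "p \<in> elts f" for p using that unfolding f by blast
      show "Z = Z'" if z: "rel f s Z" "rel f s Z'" for s Z Z'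
      proof -
        obtain t t' where "col s t" "isZ t Z" "col s t'" "isZ t' Z'" using z unfolding rf by blast
        then show ?thesis using col_fun isZ_un by metis
      qed
    qed
    show "fdom f = elts (star T) \<inter> Standard"
    proof (rule set_eqI)
      fix s
      show "s \<in> fdom f \<longleftrightarrow> s \<in> elts (star T) \<inter> Standard" unfolding fdom_rel rf Int_iff st_iff[symmetric]
      proof
        assume "\<exists>y. s \<in> elts (star T) \<and> (\<exists>t. col s t \<and> isZ t y)"
        then show "s \<in> elts (star T) \<and> st s" using col_st by blast
      next
        assume s: "s \<in> elts (star T) \<and> st s"
        obtain t where t: "col s t" using col_total s by blast
        then have "t \<in> elts T" using cT s by blast
        then show "\<exists>y. s \<in> elts (star T) \<and> (\<exists>t. col s t \<and> isZ t y)" using TZ t s by blast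
      qed
    qed
    show "frange f = elts z"
    proof (rule set_eqI)
      fix Z
      show "Z \<in> frange f \<longleftrightarrow> Z \<in> elts z" unfolding frange_rel rf zt using cT col_st by blast
    qed
  qed
  moreover have zI: "elts z \<subseteq> Internal"
  proof
    fix Z assume "Z \<in> elts z"
    then obtain t where t: "t \<in> elts T" "isZ t Z" unfolding zt by blast
    obtain Z' where "Z' \<in> Internal" "isZ t Z'" using TZ[OF t(1)] by blast
    then show "Z \<in> Internal" using isZ_un[OF t(2)] by metis
  qed
  moreover have "\<forall>x\<in>elts z. elts x \<noteq> {}"
  proof
    fix Z assume "Z \<in> elts z"
    then obtain t where t: "t \<in> elts T" "isZ t Z" unfolding zt by blast
    obtain Z' where "elts Z' \<noteq> {}" "isZ t Z'" using TZ[OF t(1)] by blast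
    then show "elts Z \<noteq> {}" using isZ_un[OF t(2)] by metis
  qed
  moreover have "\<forall>x\<in>elts z. \<forall>y\<in>elts z. \<exists>w\<in>elts z. elts w = elts x \<inter> elts y"
  proof (intro ballI)
    fix Z Y assume "Z \<in> elts z" "Y \<in> elts z"
    then obtain t s where t: "t \<in> elts T" "isZ t Z" and s: "s \<in> elts T" "isZ s Y" unfolding zt by blast
    obtain j where j: "j \<in> elts omega" "t \<in> WF" "elts t \<subseteq> elts J" "sz WF t j" using t(1) unfolding T' by blast
    obtain k where k: "k \<in> elts omega" "s \<in> WF" "elts s \<subseteq> elts J" "sz WF s k" using s(1) unfolding T' by blast
    have "un t s \<in> elts T" unfolding T'
      using W.unD[OF j(2) k(2)] W.sz_un[OF j(1) k(1) j(2) k(2) j(4) k(4)] j(3) k(3) by simp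
    then obtain V where V: "isZ (un t s) V" using TZ by blast
    have "V \<in> elts z" unfolding zt using V \<open>un t s \<in> elts T\<close> by blast
    moreover have "elts V = elts Z \<inter> elts Y"
    proof (rule set_eqI)
      fix G show "G \<in> elts V \<longleftrightarrow> G \<in> elts Z \<inter> elts Y"
        using V t(2) s(2) unfolding isZ_def elts_un by blast
    qed
    ultimately show "\<exists>w\<in>elts z. elts w = elts Z \<inter> elts Y" by blast
  qed
  ultimately obtain G where G: "\<forall>x\<in>elts z. G \<in> elts x" using Saturation by blast
  have GT: "G \<in> elts Q \<and> (\<forall>p\<in>elts t. hit G p)" if t: "t \<in> elts T" for t
  proof -
    obtain Z where Z: "isZ t Z" using TZ[OF t] by blast
    then have "G \<in> elts Z" using G t zt by blast
    then show ?thesis using Z unfolding isZ_def by blast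
  qed
  have "zero \<in> elts T" unfolding T' by (auto intro!: bexI[of _ zero])
  then have GQ: "G \<in> elts Q" using GT by blast
  have "\<exists>i. rel G i Z" if Z: "rel F p Z" for p Z
  proof -
    have pJ: "p \<in> elts J" using FR(2)[OF Z] .
    have pW: "p \<in> WF" using WF_trans[OF J pJ] .
    have "sz WF (ins p zero) (sc zero)" using W.sz_ins[OF W.sz_zero pW] by simp
    then have "ins p zero \<in> elts T" unfolding T' using pW pJ by auto
    then have "hit G p" using GT by auto
    then show ?thesis unfolding hit_def using Ffun[OF Z] by blast
  qed
  then show ?thesis using QI[OF GQ] QF[OF GQ] Pm[OF GQ] by blast
qed

section \<open>Homogeneous sets and independent blocks\<close>

context nat_pow_class
begin

text \<open>The lower parts are initial segments of the same set, hence comparable by inclusion, and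
  having the same finite size they agree.\<close>

lemma below_un_inj:
  assumes "x \<in> D" "y \<in> D" "x' \<in> D" "y' \<in> D" "n \<in> elts N" "sz D x n" "sz D x' n"
    "elts (un x y) \<subseteq> elts N" "below x y" "below x' y'" "un x y = un x' y'"
  shows "x = x' \<and> y = y'"
proof -
  have e: "elts x \<union> elts y = elts x' \<union> elts y'" using assms(11) elts_un by metis
  have sub: "elts x \<union> elts y \<subseteq> elts N" using assms(8) by simp
  have asym: "\<not> (a \<in> elts c \<and> c \<in> elts a)" if "a \<in> elts N" for a c using N_asym that by blast
  have "elts x \<subseteq> elts x' \<or> elts x' \<subseteq> elts x"
  proof (rule ccontr)
    assume "\<not> ?thesis"
    then obtain a c where a: "a \<in> elts x" "a \<notin> elts x'" and c: "c \<in> elts x'" "c \<notin> elts x" by blast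
    have "a \<in> elts y'" "c \<in> elts y" using e a c by blast+
    then have "a \<in> elts c" "c \<in> elts a" using a(1) c(1) assms(9,10) unfolding below_def by blast+
    then show False using asym a(1) sub by blast
  qed
  then have x: "x = x'" using sz_eq_subset[OF assms(5,3,1,7,6)] sz_eq_subset[OF assms(5,1,3,6,7)] by blast
  have d: "elts u \<inter> elts v = {}" if "below u v" "elts u \<union> elts v \<subseteq> elts N" for u v
    using that N_irrefl unfolding below_def by blast
  have "elts y = elts y'"
    using e d[OF assms(9) sub] d[OF assms(10)] sub unfolding x e by blast
  then show ?thesis using x Extensionality by blast
qed

text \<open>The points of \<open>H'\<close> are separators: each interval between two of them holds
  a block, so \<open>sc k\<close> points yield \<open>k\<close> blocks without any division of
  sizes.\<close>

lemma blocks: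
  assumes H: "H \<in> D" "elts H \<subseteq> elts N" and H': "H' \<in> D" "elts H' \<subseteq> elts N" and n: "n \<in> elts N" "n \<noteq> zero"
    and sparse: "\<And>a c. a \<in> elts H' \<Longrightarrow> c \<in> elts H' \<Longrightarrow> a \<in> elts c \<Longrightarrow>
      \<exists>x\<in>D. elts x \<subseteq> elts H \<and> sz D x n \<and> (\<forall>d\<in>elts x. (d = a \<or> a \<in> elts d) \<and> d \<in> elts c)"
    and k: "k \<in> elts N" "sz D H' (sc k)"
  shows "\<exists>Y\<in>D. sz D Y k \<and> (\<forall>x\<in>elts Y. elts x \<subseteq> elts H \<and> sz D x n) \<and>
     (\<forall>x\<in>elts Y. \<forall>y\<in>elts Y. x = y \<or> below x y \<or> below y x)"
proof -
  have nD: "n \<in> D" using n by simp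
  \<comment> \<open>The invariant also asks that every block lie below some point of
    \<open>A\<close>. The next block starts at the greatest point of the old set and is thus above
    all earlier blocks.\<close>
  let ?P = "\<lambda>k. \<forall>A\<in>D. elts A \<subseteq> elts H' \<and> sz D A (sc k) \<longrightarrow> (\<exists>Y\<in>D. sz D Y k \<and>
     (\<forall>x\<in>elts Y. elts x \<subseteq> elts H \<and> sz D x n \<and> (\<exists>c\<in>elts A. \<forall>d\<in>elts x. d \<in> elts c)) \<and>
     (\<forall>x\<in>elts Y. \<forall>y\<in>elts Y. x = y \<or> below x y \<or> below y x))"
  have P: "?P k"
  proof (rule ind[of k ?P, OF k(1)])
    show "?P zero" by (intro ballI impI bexI[of _ zero]) simp_all
  next
    fix k assume k: "k \<in> elts N" and IH: "?P k"
    show "?P (sc k)"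
    proof (intro ballI impI)
      fix A assume A: "A \<in> D" "elts A \<subseteq> elts H' \<and> sz D A (sc (sc k))"
      have AN: "elts A \<subseteq> elts N" using A H'(2) by blast
      have Ane: "elts A \<noteq> {}" using sz_sc_ex A(2) by blast
      have szA: "sz D A (sc (sc k))" "elts A \<subseteq> elts H'" using A(2) by blast+
      obtain a where a: "a \<in> elts A" "\<forall>c\<in>elts A. c = a \<or> c \<in> elts a"
        using max_ex[OF A(1) AN sc_N[OF sc_N[OF k]] szA(1) Ane] by blast
      have aD: "a \<in> D" using transD[OF A(1) a(1)] .
      define B where "B = rem A a"
      have B: "B \<in> D" "elts B = elts A - {a}" "sz D B (sc k)"
        unfolding B_def using remD(1)[OF A(1) aD] elts_rem[OF A(1) aD] sz_rem[OF szA(1) A(1) a(1) sc_N[OF k]] by blast+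
      have BH: "elts B \<subseteq> elts H'" "elts B \<subseteq> elts N" using B(2) szA(2) AN by blast+
      have Bne: "elts B \<noteq> {}" using sz_sc_ex B(3) by blast
      obtain c where c: "c \<in> elts B" "\<forall>d\<in>elts B. d = c \<or> d \<in> elts c"
        using max_ex[OF B(1) BH(2) sc_N[OF k] B(3) Bne] by blast
      have ca: "c \<in> elts a" using a(2) c(1) B(2) by blast
      obtain Y where Y: "Y \<in> D" "sz D Y k"
        "\<forall>x\<in>elts Y. elts x \<subseteq> elts H \<and> sz D x n \<and> (\<exists>c\<in>elts B. \<forall>d\<in>elts x. d \<in> elts c)"
        "\<forall>x\<in>elts Y. \<forall>y\<in>elts Y. x = y \<or> below x y \<or> below y x" using IH B(1,3) BH(1) by blast
      obtain x where x: "x \<in> D" "elts x \<subseteq> elts H" "sz D x n" "\<forall>d\<in>elts x. (d = c \<or> c \<in> elts d) \<and> d \<in> elts a"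
        using sparse[of c a] c(1) BH(1) a(1) szA(2) ca by blast
      have cN: "c \<in> elts N" using c(1) BH(2) by blast
      have Yc: "d \<in> elts c" if y: "y \<in> elts Y" "d \<in> elts y" for y d
      proof -
        obtain c' where "c' \<in> elts B" and "d \<in> elts c'" using Y(3) y by blast
        moreover from this have "c' = c \<or> c' \<in> elts c" using c(2) by blast
        ultimately show ?thesis using N_transitive[OF cN, of c' d] by (elim disjE) simp_all
      qed
      have yx: "below y x" if "y \<in> elts Y" for y unfolding below_def
      proof (intro ballI)
        fix d e assume d: "d \<in> elts y" and e: "e \<in> elts x"
        have "e \<in> elts N" using e x(2) H(2) by blast
        moreover have "e = c \<or> c \<in> elts e" using x(4) e by blast
        ultimately show "d \<in> elts e" using Yc[OF that d] N_transitive by blast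
      qed
      have "x \<notin> elts Y"
      proof
        assume xY: "x \<in> elts Y"
        \<comment> \<open>A nonempty block cannot be below itself, so \<open>x\<close> is new; an
          empty one could already be in \<open>Y\<close>.\<close>
        have "x \<noteq> zero" using x(3) n sz_unique[OF zero_N n(1) zeroD sz_zero] by blast
        then obtain d where d: "d \<in> elts x" using eq_zero_iff by blast
        then have "d \<in> elts d" using yx[OF xY] unfolding below_def by blast
        then show False using N_irrefl d x(2) H(2) by blast
      qed
      then have "sz D (ins x Y) (sc k)" using sz_ins[OF Y(2) x(1) _ k] by blast
      moreover have "\<forall>v\<in>elts (ins x Y). elts v \<subseteq> elts H \<and> sz D v n \<and> (\<exists>c\<in>elts A. \<forall>d\<in>elts v. d \<in> elts c)"
      proof
        fix v assume "v \<in> elts (ins x Y)"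
        then consider "v = x" | "v \<in> elts Y" by auto
        then show "elts v \<subseteq> elts H \<and> sz D v n \<and> (\<exists>c\<in>elts A. \<forall>d\<in>elts v. d \<in> elts c)"
        proof cases
          case 1 then show ?thesis using x a(1) by blast
        next
          case 2 then show ?thesis using Y(3) B(2) by blast
        qed
      qed
      moreover have "\<forall>v\<in>elts (ins x Y). \<forall>y\<in>elts (ins x Y). v = y \<or> below v y \<or> below y v"
        using Y(4) yx by auto
      ultimately show "\<exists>Y\<in>D. sz D Y (sc k) \<and>
         (\<forall>x\<in>elts Y. elts x \<subseteq> elts H \<and> sz D x n \<and> (\<exists>c\<in>elts A. \<forall>d\<in>elts x. d \<in> elts c)) \<and>
         (\<forall>x\<in>elts Y. \<forall>y\<in>elts Y. x = y \<or> below x y \<or> below y x)"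
        using insD[OF x(1) Y(1)] by blast
    qed
  qed (intro ufi H H' nD)
  have "elts H' \<subseteq> elts H' \<and> sz D H' (sc k)" using k(2) by simp
  from mp[OF bspec[OF P H'(1)] this] show ?thesis by (elim bexE conjE) (intro bexI conjI, assumption, blast+)
qed

end

context ramsey_cut
begin

text \<open>\<open>N\<close> stands for twice \<open>n\<close>. That it stays in the cut comes from
  \<open>U_add\<close>, applied to an actual pair of disjoint sets.\<close>

lemma double_size:
  assumes "n \<in> elts U"
  shows "\<exists>N\<in>elts U. \<forall>x\<in>Internal. \<forall>y\<in>Internal. sz Internal x n \<longrightarrow> sz Internal y n \<longrightarrow> elts x \<inter> elts y = {} \<longrightarrow>
    sz Internal (un x y) N"
proof -
  obtain k where k: "k \<in> elts hnat" "\<forall>x\<in>Internal. \<forall>y\<in>Internal. sz Internal x n \<longrightarrow> sz Internal y n \<longrightarrow>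
      elts x \<inter> elts y = {} \<longrightarrow> sz Internal (un x y) k" using H.sz_add[OF U_N[OF assms] U_N[OF assms]] by blast
  show ?thesis
  proof (cases "\<exists>x\<in>Internal. \<exists>y\<in>Internal. sz Internal x n \<and> sz Internal y n \<and> elts x \<inter> elts y = {}")
    case True
    then have "k \<in> elts U" using U_add assms k by blast
    then show ?thesis using k by blast
  next
    \<comment> \<open>Without such a pair the claim is vacuous, and any element of the cut will
      do.\<close>
    case False
    then show ?thesis using U_zero by blast
  qed
qed

text \<open>Whether a pair belongs to \<open>E\<close> depends only on which of the sets
  \<open>X_ab\<close> contain it. Each of these is the value of \<open>G\<close> at some index below
  \<open>u\<close>, and on a homogeneous set the outcome at every such index is constant.\<close>

lemma homogeneous_types:
  assumes \<kappa>: "\<kappa> \<in> elts hnat" "\<kappa> \<notin> elts U" and n: "n \<in> elts U" and E: "Delta_ss_2 E"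
  shows "\<exists>H\<in>Internal. elts H \<subseteq> elts \<kappa> \<and> (\<exists>u\<in>elts hnat. u \<notin> elts U \<and> sz Internal H u) \<and>
    (\<forall>x\<in>Internal. \<forall>y\<in>Internal. \<forall>x'\<in>Internal. \<forall>y'\<in>Internal.
       elts x \<subseteq> elts H \<and> elts y \<subseteq> elts H \<and> elts x' \<subseteq> elts H \<and> elts y' \<subseteq> elts H \<and>
       sz Internal x n \<and> sz Internal y n \<and> sz Internal x' n \<and> sz Internal y' n \<and> below x y \<and> below x' y' \<longrightarrow>
       (opair x y \<in> elts E \<longleftrightarrow> opair x' y' \<in> elts E))"
proof -
  have nN: "n \<in> elts hnat" using U_N[OF n] .
  have \<kappa>I: "\<kappa> \<in> Internal" "n \<in> Internal" using \<kappa> nN by simp_all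
  have \<kappa>N: "elts \<kappa> \<subseteq> elts hnat" using H.N_elts[OF \<kappa>(1)] by blast
  obtain N where N: "N \<in> elts U" and Nsz: "\<And>x y. x \<in> Internal \<Longrightarrow> y \<in> Internal \<Longrightarrow> sz Internal x n \<Longrightarrow> sz Internal y n \<Longrightarrow>
    elts x \<inter> elts y = {} \<Longrightarrow> sz Internal (un x y) N" using double_size[OF n] by blast
  have NI: "N \<in> Internal" using U_N[OF N] by simp
  obtain u F r where u: "u \<in> elts hnat" "u \<notin> elts U" "F \<in> Internal" "r \<in> elts hnat" "elts F = {f\<in>Internal. fn2 f u}"
     "sz Internal F r" and ram: "\<And>c. c \<in> Internal \<Longrightarrow> fcol Internal c \<kappa> N r \<Longrightarrow>
      (\<exists>H\<in>Internal. elts H \<subseteq> elts \<kappa> \<and> sz Internal H u \<and> homf Internal c H N r)"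
    using ramsey_overspill[OF \<kappa>I(1) \<kappa> H.sz_self[OF \<kappa>(1)] N] by blast
  have "\<exists>A B X. internal_family A B X \<and> elts E = (\<Union>a\<in>elts A. \<Inter>b\<in>elts B. elts (fapp X (opair a b)))"
    using E unfolding Delta_ss_2_def by blast
  then obtain A B X where X: "internal_family A B X" "elts E = (\<Union>a\<in>elts A. \<Inter>b\<in>elts B. elts (fapp X (opair a b)))" by blast
  have AB: "A \<in> WF" "B \<in> WF" and fX: "is_function X" and dX: "fdom X = {opair a b | a b. a \<in> elts A \<and> b \<in> elts B}"
    and rX: "frange X \<subseteq> Internal" using X(1) unfolding internal_family_def by blast+
  obtain J where J: "J \<in> WF" "elts J = {p. \<exists>a\<in>elts A. \<exists>c\<in>elts B. p = opair a c}" using W.prod_ex[OF AB] by blast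
  have dJ: "fdom X = elts J" unfolding dX J(2) by blast
  have om: "elts omega \<subseteq> elts u" using omega_U U_lt[OF _ u(1,2)] by blast
  obtain G where G: "G \<in> Internal" "\<forall>i Z Z'. rel G i Z \<longrightarrow> rel G i Z' \<longrightarrow> Z = Z'" "\<forall>i Z. rel G i Z \<longrightarrow> i \<in> elts u"
     "\<forall>p Z. rel X p Z \<longrightarrow> (\<exists>i. rel G i Z)" using saturated_enumeration[OF J(1) fX dJ rX u(1) om] by blast
  \<comment> \<open>Test number \<open>j\<close> on a set of size \<open>N\<close>: split it into
    lower and upper part of size \<open>n\<close> and ask whether the pair is in the set that
    \<open>G\<close> assigns to \<open>j\<close>. Only internal parameters occur.\<close>
  define S where "S w j \<longleftrightarrow> (\<exists>Z\<in>Internal. rel G j Z \<and> (\<exists>x\<in>Internal. \<exists>y\<in>Internal. sz Internal x n \<and> sz Internal y n \<and>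
     below x y \<and> w = un x y \<and> opair x y \<in> elts Z))" for w j
  have S: "H.dD (\<lambda>e. S (e (Suc 0)) (e 0))" unfolding S_def by (intro ufi tm_un G \<kappa>I)
  from H.color_code[OF u(1,3,5,4,6) \<kappa>I(1) NI S] obtain c where c: "c \<in> Internal" "fcol Internal c \<kappa> N r"
    "\<forall>w v i j. rel c w i \<longrightarrow> rel c v i \<longrightarrow> j \<in> elts u \<longrightarrow> (S w j \<longleftrightarrow> S v j)" by (elim bexE conjE)
  obtain H where H: "H \<in> Internal" "elts H \<subseteq> elts \<kappa>" "sz Internal H u" "homf Internal c H N r" using ram[OF c(1,2)] by blast
  have HN: "elts H \<subseteq> elts hnat" using H(2) \<kappa>N by blast
  have same: "S w j \<longleftrightarrow> S v j"
    if w: "w \<in> Internal" "elts w \<subseteq> elts H" "sz Internal w N" "v \<in> Internal" "elts v \<subseteq> elts H" "sz Internal v N" "j \<in> elts u" for w v j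
  proof -
    have "\<exists>i\<in>elts r. rel c w i" using c(2) w(1,3) subset_trans[OF w(2) H(2)] unfolding fcol_def by blast
    then obtain i where i: "i \<in> elts r" "rel c w i" by blast
    have "\<exists>i\<in>elts r. rel c v i" using c(2) w(4,6) subset_trans[OF w(5) H(2)] unfolding fcol_def by blast
    then obtain l where l: "l \<in> elts r" "rel c v l" by blast
    have "i = l" using H(4) w i l unfolding homf_def by blast
    then show ?thesis using c(3) i(2) l(2) w(7) by blast
  qed
  \<comment> \<open>The existential quantifiers in \<open>S\<close> are harmless: the splitting is
    unique by \<open>below_un_inj\<close>, and \<open>G\<close> is single-valued.\<close>
  have S_iff: "S (un x y) j \<longleftrightarrow> opair x y \<in> elts Z"
    if x: "x \<in> Internal" "y \<in> Internal" "elts x \<subseteq> elts H" "elts y \<subseteq> elts H" "sz Internal x n" "sz Internal y n" "below x y"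
      and Z: "rel G j Z" for x y j Z
  proof
    assume "S (un x y) j"
    then obtain Z' x' y' where z: "rel G j Z'" "x' \<in> Internal" "y' \<in> Internal" "sz Internal x' n" "sz Internal y' n"
     "below x' y'" "un x y = un x' y'" "opair x' y' \<in> elts Z'" unfolding S_def by blast
    have sub: "elts (un x y) \<subseteq> elts hnat" using x(3,4) HN unfolding elts_un by blast
    have "x = x' \<and> y = y'" by (rule H.below_un_inj[OF x(1,2) z(2,3) nN x(5) z(4) sub x(7) z(6,7)])
    moreover have "Z = Z'" using G(2) Z z(1) by blast
    ultimately show "opair x y \<in> elts Z" using z(8) by simp
  next
    assume "opair x y \<in> elts Z"
    moreover have "Z \<in> Internal" using H.relD[OF G(1) Z] by blast
    ultimately show "S (un x y) j" unfolding S_def using x Z by blast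
  qed
  have E_iff: "p \<in> elts E \<longleftrightarrow> (\<exists>a\<in>elts A. \<forall>b\<in>elts B. p \<in> elts (fapp X (opair a b)))" for p unfolding X(2) by blast
  have "opair x y \<in> elts E \<longleftrightarrow> opair x' y' \<in> elts E"
    if x: "x \<in> Internal" "y \<in> Internal" "elts x \<subseteq> elts H" "elts y \<subseteq> elts H" "sz Internal x n" "sz Internal y n" "below x y"
     and x': "x' \<in> Internal" "y' \<in> Internal" "elts x' \<subseteq> elts H" "elts y' \<subseteq> elts H" "sz Internal x' n" "sz Internal y' n" "below x' y'"
   for x y x' y'
  proof -
    have disj: "elts x \<inter> elts y = {}" if "below x y" "elts x \<subseteq> elts H" for x y
      using that H.N_irrefl HN unfolding below_def by blast
    have w: "un x y \<in> Internal" "elts (un x y) \<subseteq> elts H" "sz Internal (un x y) N"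
      using H.unD[OF x(1,2)] x(3,4) Nsz[OF x(1,2,5,6) disj[OF x(7,3)]] by simp_all
    have w': "un x' y' \<in> Internal" "elts (un x' y') \<subseteq> elts H" "sz Internal (un x' y') N"
      using H.unD[OF x'(1,2)] x'(3,4) Nsz[OF x'(1,2,5,6) disj[OF x'(7,3)]] by simp_all
    have "opair x y \<in> elts (fapp X (opair a b)) \<longleftrightarrow> opair x' y' \<in> elts (fapp X (opair a b))"
      if ab: "a \<in> elts A" "b \<in> elts B" for a b
    proof -
      have "opair a b \<in> fdom X" unfolding dX using ab by blast
      then have "rel X (opair a b) (fapp X (opair a b))" by (rule fapp_rel[OF fX])
      then obtain j where j: "rel G j (fapp X (opair a b))" using G(4) by blast
      have ju: "j \<in> elts u" using G(3) j by blast
      show ?thesis using S_iff[OF x j] S_iff[OF x' j] same[OF w w' ju] by simp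
    qed
    then show ?thesis unfolding E_iff by blast
  qed
  then show ?thesis using H(1-3) u(1,2) by blast
qed

lemma homogeneous_or_independent:
  assumes \<kappa>: "\<kappa> \<in> elts hnat" "\<kappa> \<notin> elts U" and n: "n \<in> elts U" and E: "Delta_ss_2 E"
    and refl: "\<forall>x\<in>Internal. elts x \<subseteq> elts \<kappa> \<longrightarrow> sz Internal x n \<longrightarrow> opair x x \<in> elts E"
    and sym0: "\<forall>x y. opair x y \<in> elts E \<longrightarrow> opair y x \<in> elts E"
    and trans0: "\<forall>x y z. opair x y \<in> elts E \<longrightarrow> opair y z \<in> elts E \<longrightarrow> opair x z \<in> elts E"
  shows "(\<exists>A\<in>Internal. elts A \<subseteq> elts \<kappa> \<and> (\<exists>u\<in>elts hnat. u \<notin> elts U \<and> sz Internal A u) \<and>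
      (\<forall>x\<in>Internal. \<forall>y\<in>Internal. elts x \<subseteq> elts A \<and> sz Internal x n \<and> elts y \<subseteq> elts A \<and> sz Internal y n \<longrightarrow> opair x y \<in> elts E)) \<or>
    (\<exists>Y\<in>Internal. (\<forall>x\<in>elts Y. elts x \<subseteq> elts \<kappa> \<and> sz Internal x n) \<and>
      (\<exists>u\<in>elts hnat. u \<notin> elts U \<and> sz Internal Y u) \<and> (\<forall>x\<in>elts Y. \<forall>y\<in>elts Y. x \<noteq> y \<longrightarrow> opair x y \<notin> elts E))"
proof -
  note sym = sym0[rule_format] and trans = trans0[rule_format]
  have nN: "n \<in> elts hnat" using U_N[OF n] .
  have nI: "n \<in> Internal" using nN by simp
  have \<kappa>N: "elts \<kappa> \<subseteq> elts hnat" using H.N_elts[OF \<kappa>(1)] by blast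
  obtain H u where H: "H \<in> Internal" "elts H \<subseteq> elts \<kappa>" "u \<in> elts hnat" "u \<notin> elts U" "sz Internal H u" and
    hom0: "\<forall>x\<in>Internal. \<forall>y\<in>Internal. \<forall>x'\<in>Internal. \<forall>y'\<in>Internal.
       elts x \<subseteq> elts H \<and> elts y \<subseteq> elts H \<and> elts x' \<subseteq> elts H \<and> elts y' \<subseteq> elts H \<and>
       sz Internal x n \<and> sz Internal y n \<and> sz Internal x' n \<and> sz Internal y' n \<and> below x y \<and> below x' y' \<longrightarrow>
       (opair x y \<in> elts E \<longleftrightarrow> opair x' y' \<in> elts E)" using homogeneous_types[OF \<kappa> n E] by (elim bexE conjE)
  note hom = hom0[rule_format]
  have HN: "elts H \<subseteq> elts hnat" using H(2) \<kappa>N by blast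
  show ?thesis
  proof (cases "\<exists>x\<in>Internal. \<exists>y\<in>Internal. elts x \<subseteq> elts H \<and> elts y \<subseteq> elts H \<and> sz Internal x n \<and> sz Internal y n \<and>
      below x y \<and> opair x y \<in> elts E")
    case True
    then obtain x0 y0 where x0: "x0 \<in> Internal" "y0 \<in> Internal" "elts x0 \<subseteq> elts H" "elts y0 \<subseteq> elts H"
      "sz Internal x0 n" "sz Internal y0 n" "below x0 y0" "opair x0 y0 \<in> elts E" by blast
    have nu: "n \<in> elts (sc u)" using U_lt[OF n H(3,4)] by simp
    obtain A z where A: "A \<in> Internal" "z \<in> Internal" "un A z = H" "below A z" "sz Internal z n"
      using H.top_ex[OF nN H(1) HN H(3,5) nu] by blast
    have eH: "elts H = elts A \<union> elts z" using A(3) elts_un by metis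
    obtain v where v: "v \<in> elts hnat" "sz Internal A v" using H.sz_subset[OF H(3,1,5) A(1)] eH by blast
    \<comment> \<open>Otherwise the size of \<open>H\<close>, the union of \<open>A\<close> and the
      \<open>n\<close>-set \<open>z\<close>, would be in the cut by \<open>U_add\<close>.\<close>
    have "v \<notin> elts U" using U_add[OF A(1) _ v(2) A(2) n A(5) H(3)] A(3) H(4,5) by blast
    moreover have "opair x y \<in> elts E"
      if x: "x \<in> Internal" "elts x \<subseteq> elts A" "sz Internal x n" and y: "y \<in> Internal" "elts y \<subseteq> elts A" "sz Internal y n" for x y
    proof -
      \<comment> \<open>Every \<open>n\<close>-subset of \<open>A\<close> lies below the top part
        \<open>z\<close> and so behaves like the given pair. Thus \<open>z\<close> links any two of
        them, even overlapping ones.\<close>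
      have *: "opair v z \<in> elts E" if v: "v \<in> Internal" "elts v \<subseteq> elts A" "sz Internal v n" for v
      proof -
        have "below v z" using A(4) v(2) unfolding below_def by blast
        moreover have "elts v \<subseteq> elts H" "elts z \<subseteq> elts H" using v(2) eH by blast+
        ultimately show ?thesis using hom[OF v(1) A(2) x0(1,2)] v(3) A(5) x0 by blast
      qed
      show ?thesis using trans[OF *[OF x] sym[OF *[OF y]]] .
    qed
    moreover have "elts A \<subseteq> elts \<kappa>" using eH H(2) by blast
    ultimately show ?thesis using A(1) v by blast
  next
    case False
    have nE: "opair x y \<notin> elts E" if "x \<in> Internal" "y \<in> Internal" "elts x \<subseteq> elts H" "elts y \<subseteq> elts H"
      "sz Internal x n" "sz Internal y n" "below x y" for x y using False that by blast
    \<comment> \<open>The empty set is vacuously below itself, so for \<open>n\<close> zero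
      reflexivity would contradict this case.\<close>
    have n0: "n \<noteq> zero"
    proof
      assume n0: "n = zero"
      have "opair zero zero \<notin> elts E" by (rule nE) (simp_all add: n0 below_def)
      then show False using refl n0 by simp
    qed
    \<comment> \<open>For a pair \<open>a\<close> below \<open>c\<close>: the interval from
      \<open>a\<close> inclusive to \<open>c\<close> exclusive contains \<open>n\<close> elements of
      \<open>H\<close>. Homogeneity for \<open>Q\<close> replaces counting.\<close>
    define Q where "Q w \<longleftrightarrow> (\<exists>a\<in>elts w. \<exists>c\<in>elts w. a \<in> elts c \<and> (\<exists>x\<in>Internal. elts x \<subseteq> elts H \<and> sz Internal x n \<and>
       (\<forall>d\<in>elts x. (d = a \<or> a \<in> elts d) \<and> d \<in> elts c)))" for w
    have Qd: "H.dD (\<lambda>e. Q (e 0))" unfolding Q_def by (intro ufi H nI)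
    have two: "sc (sc zero) \<in> elts U" using U_sc U_zero by blast
    have pair: "upair a c \<in> Internal \<and> sz Internal (upair a c) (sc (sc zero)) \<and> elts (upair a c) \<subseteq> elts H'"
      if H': "H' \<in> Internal" and ac: "a \<in> elts H'" "c \<in> elts H'" "a \<noteq> c" for a c H'  :: 'a
    proof -
      have I: "a \<in> Internal" "c \<in> Internal" using internal_trans[OF H'] ac by blast+
      have "sz Internal (ins c zero) (sc zero)" using H.sz_ins[OF H.sz_zero I(2)] by simp
      then have "sz Internal (ins a (ins c zero)) (sc (sc zero))" by (rule H.sz_ins) (use I ac in auto)
      moreover have "ins a (ins c zero) = upair a c" by (intro Extensionality) simp
      ultimately show ?thesis using I ac by simp
    qed
    obtain H' u' where H': "H' \<in> Internal" "elts H' \<subseteq> elts H" "u' \<in> elts hnat" "u' \<notin> elts U" "sz Internal H' u'" and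
      hom': "(\<forall>w\<in>Internal. elts w \<subseteq> elts H' \<longrightarrow> sz Internal w (sc (sc zero)) \<longrightarrow> Q w) \<or>
        (\<forall>w\<in>Internal. elts w \<subseteq> elts H' \<longrightarrow> sz Internal w (sc (sc zero)) \<longrightarrow> \<not> Q w)"
      using ramsey_two_colours[OF H(1,3,4,5) two Qd] by blast
    have H'N: "elts H' \<subseteq> elts hnat" using H'(2) HN by blast
    \<comment> \<open>One positive pair excludes the negative alternative: the least element
      \<open>a\<close> of \<open>H'\<close> and its greatest \<open>b\<close>. All of
      \<open>H'\<close> except \<open>b\<close> lies between them and, with a size outside the cut,
      has \<open>n\<close> elements.\<close>
    have "\<exists>w\<in>Internal. elts w \<subseteq> elts H' \<and> sz Internal w (sc (sc zero)) \<and> Q w"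
    proof -
      have one: "sc zero \<in> elts U" using U_sc U_zero by blast
      have 1: "sc zero \<in> elts (sc u')" using U_lt[OF one H'(3,4)] by simp
      obtain y z where yz: "y \<in> Internal" "z \<in> Internal" "un y z = H'" "below y z" "sz Internal z (sc zero)"
        using H.top_ex[OF U_N[OF one] H'(1) H'N H'(3,5) 1] by blast
      have eH: "elts H' = elts y \<union> elts z" using yz(3) elts_un by metis
      obtain v where v: "v \<in> elts hnat" "sz Internal y v" using H.sz_subset[OF H'(3,1,5) yz(1)] eH by blast
      have vU: "v \<notin> elts U" using U_add[OF yz(1) _ v(2) yz(2) one yz(5) H'(3)] yz(3) H'(4,5) by blast
      obtain b where b: "b \<in> elts z" using H.sz_sc_ex[OF yz(5)] by blast
      have nv: "n \<in> elts (sc v)" using U_lt[OF n v(1) vU] by simp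
      obtain x where x: "x \<in> Internal" "elts x \<subseteq> elts y" "sz Internal x n" using H.sz_sub_ex[OF v(1) nv yz(1) v(2)] by blast
      have "elts y \<noteq> {}"
      proof
        assume "elts y = {}"
        then have "y = zero" by (simp add: eq_zero_iff)
        then have "v = zero" using H.sz_unique[OF v(1) H.zero_N yz(1) v(2)] by simp
        then show False using vU U_zero by simp
      qed
      then obtain a where a: "a \<in> elts y" "\<forall>c\<in>elts y. c = a \<or> a \<in> elts c"
        using H.min_ex[OF yz(1)] eH H'N by blast
      have ab: "a \<in> elts b" using yz(4) a(1) b unfolding below_def by blast
      have aN: "a \<in> elts hnat" using a(1) eH H'N by blast
      have "a \<noteq> b" using ab H.N_irrefl[OF aN] by metis
      then have w: "upair a b \<in> Internal \<and> sz Internal (upair a b) (sc (sc zero)) \<and> elts (upair a b) \<subseteq> elts H'"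
        using pair[OF H'(1)] a(1) b eH by blast
      have "\<forall>d\<in>elts x. (d = a \<or> a \<in> elts d) \<and> d \<in> elts b"
        using x(2) a(2) yz(4) b unfolding below_def by blast
      moreover have "elts x \<subseteq> elts H" using x(2) eH H'(2) by blast
      moreover have "a \<in> elts (upair a b)" "b \<in> elts (upair a b)" by simp_all
      ultimately have "Q (upair a b)" unfolding Q_def using ab x(1,3) by blast
      then show ?thesis using w by blast
    qed
    then have Qall: "Q w" if "w \<in> Internal" "elts w \<subseteq> elts H'" "sz Internal w (sc (sc zero))" for w
      using hom' that by blast
    have sparse: "\<exists>x\<in>Internal. elts x \<subseteq> elts H \<and> sz Internal x n \<and> (\<forall>d\<in>elts x. (d = a \<or> a \<in> elts d) \<and> d \<in> elts c)"
      if ac: "a \<in> elts H'" "c \<in> elts H'" "a \<in> elts c" for a c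
    proof -
      have aN: "a \<in> elts hnat" "c \<in> elts hnat" using ac H'N by blast+
      have "a \<noteq> c" using ac(3) H.N_irrefl[OF aN(1)] by metis
      then have "Q (upair a c)" using pair[OF H'(1) ac(1,2)] Qall by blast
      then obtain a' c' x where q: "a' = a \<or> a' = c" "c' = a \<or> c' = c" "a' \<in> elts c'" "x \<in> Internal" "elts x \<subseteq> elts H"
        "sz Internal x n" "\<forall>d\<in>elts x. (d = a' \<or> a' \<in> elts d) \<and> d \<in> elts c'" unfolding Q_def elts_upair by blast
      \<comment> \<open>\<open>Q\<close> sees an unordered pair; asymmetry of the order restores
        which of the two is smaller.\<close>
      have "a' = a \<and> c' = c" using q(1-3) H.N_irrefl[OF aN(1)] H.N_irrefl[OF aN(2)] H.N_asym[OF aN(2) ac(3)] by metis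
      then show ?thesis using q(4-7) by blast
    qed
    show ?thesis
    proof (cases rule: H.N_cases[OF H'(3)])
      case 1
      then show ?thesis using H'(4) U_zero by simp
    next
      case (2 k)
      \<comment> \<open>One block is lost against the number of separators, which closure under
        successors tolerates.\<close>
      then have kU: "k \<notin> elts U" using U_sc H'(4) by blast
      have szk: "sz Internal H' (sc k)" using H'(5) 2(2) by simp
      obtain Y where Y: "Y \<in> Internal" "sz Internal Y k" "\<forall>x\<in>elts Y. elts x \<subseteq> elts H \<and> sz Internal x n"
        "\<forall>x\<in>elts Y. \<forall>y\<in>elts Y. x = y \<or> below x y \<or> below y x"
        using H.blocks[OF H(1) HN H'(1) H'N nN n0 sparse 2(1) szk] by blast
      have "opair x y \<notin> elts E" if xy: "x \<in> elts Y" "y \<in> elts Y" "x \<noteq> y" for x y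
      proof -
        have I: "x \<in> Internal" "y \<in> Internal" using internal_trans[OF Y(1)] xy by blast+
        have s: "elts x \<subseteq> elts H" "sz Internal x n" "elts y \<subseteq> elts H" "sz Internal y n" using Y(3) xy by blast+
        consider "below x y" | "below y x" using Y(4) xy by blast
        then show ?thesis
        proof cases
          case 1 then show ?thesis using nE I s by blast
        next
          case 2
          then have "opair y x \<notin> elts E" using nE I s by blast
          then show ?thesis using sym by blast
        qed
      qed
      moreover have "\<forall>x\<in>elts Y. elts x \<subseteq> elts \<kappa> \<and> sz Internal x n" using Y(3) H(2) by blast
      ultimately show ?thesis using Y(1,2) 2(1) kU by blast
    qed
  qed
qed

end

theorem theorem13p1:
  fixes U n \<kappa> E :: "'a::hst"
  assumes "is_cut U"
    and "elts U \<noteq> elts hnat"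
    and "Delta_ss_2 U"
    and "elts omega \<subseteq> elts U"
    and "closed_under_star_ramsey U"
    and "exponential U"
    and "n \<in> elts omega"
    and "\<kappa> \<in> elts hnat - elts U"
    and "Delta_ss_2 E"
    and "is_equivalence_on (nsubsets \<kappa> n) E"
    and "\<not> (\<exists>Y\<in>Internal. elts Y \<subseteq> elts (nsubsets \<kappa> n) \<and>
           (\<forall>x\<in>elts Y. \<forall>y\<in>elts Y. x \<noteq> y \<longrightarrow> opair x y \<notin> elts E) \<and>
           icard Y \<notin> elts U)"
  shows "\<exists>A\<in>Internal. elts A \<subseteq> elts \<kappa> \<and> icard A \<notin> elts U \<and>
           (\<forall>x\<in>elts (nsubsets A n). \<forall>y\<in>elts (nsubsets A n). opair x y \<in> elts E)"
proof -
  interpret ramsey_cut U by unfold_locales (rule assms)+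
  have \<kappa>: "\<kappa> \<in> elts hnat" "\<kappa> \<notin> elts U" using assms(8) by auto
  have nU: "n \<in> elts U" using assms(4,7) by blast
  have nN: "n \<in> elts hnat" using U_N[OF nU] .
  have \<kappa>I: "\<kappa> \<in> Internal" using \<kappa> by simp
  \<comment> \<open>\<open>nsubsets\<close> is defined through \<open>icard\<close>; since \<kappa>
    is finite in the internal sense, it can be rewritten with \<open>sz\<close>, the notion used in
    the dichotomy.\<close>
  note ns = H.nsub_eq(1)[OF \<kappa>I \<kappa>(1) H.sz_self[OF \<kappa>(1)] nN]
  have eq: "equiv (elts (nsubsets \<kappa> n)) {(x, y). opair x y \<in> elts E}"
    using assms(10) unfolding is_equivalence_on_def by blast
  have refl: "\<forall>x\<in>Internal. elts x \<subseteq> elts \<kappa> \<longrightarrow> sz Internal x n \<longrightarrow> opair x x \<in> elts E"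
  proof (intro ballI impI)
    fix x :: 'a assume "x \<in> Internal" "elts x \<subseteq> elts \<kappa>" "sz Internal x n"
    then have "x \<in> elts (nsubsets \<kappa> n)" unfolding ns by blast
    then show "opair x x \<in> elts E" using eq unfolding equiv_def refl_on_def by blast
  qed
  have sym: "\<forall>x y. opair x y \<in> elts E \<longrightarrow> opair y x \<in> elts E"
    using eq unfolding equiv_def sym_def by blast
  have trans: "\<forall>x y z. opair x y \<in> elts E \<longrightarrow> opair y z \<in> elts E \<longrightarrow> opair x z \<in> elts E"
    using eq unfolding equiv_def trans_def by blast
  from homogeneous_or_independent[OF \<kappa> nU assms(9) refl sym trans] show ?thesis
  proof (elim disjE bexE conjE)
    fix A u assume A: "A \<in> Internal" "elts A \<subseteq> elts \<kappa>" and u: "u \<in> elts hnat" "u \<notin> elts U" "sz Internal A u"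
      and h: "\<forall>x\<in>Internal. \<forall>y\<in>Internal. elts x \<subseteq> elts A \<and> sz Internal x n \<and> elts y \<subseteq> elts A \<and> sz Internal y n \<longrightarrow> opair x y \<in> elts E"
    have "icard A = u" using H.card_eq[OF A(1) u(1,3)] .
    moreover have "\<forall>x\<in>elts (nsubsets A n). \<forall>y\<in>elts (nsubsets A n). opair x y \<in> elts E"
      unfolding H.nsub_eq(1)[OF A(1) u(1,3) nN] using h by blast
    ultimately show ?thesis using A u(2) by blast
  next
    fix Y u assume Y: "Y \<in> Internal" "\<forall>x\<in>elts Y. elts x \<subseteq> elts \<kappa> \<and> sz Internal x n"
      "\<forall>x\<in>elts Y. \<forall>y\<in>elts Y. x \<noteq> y \<longrightarrow> opair x y \<notin> elts E" and u: "u \<in> elts hnat" "u \<notin> elts U" "sz Internal Y u"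
    have "icard Y = u" using H.card_eq[OF Y(1) u(1,3)] .
    moreover have "elts Y \<subseteq> elts (nsubsets \<kappa> n)" unfolding ns using Y(2) internal_trans[OF Y(1)] by blast
    ultimately show ?thesis using assms(11) Y(1,3) u(2) by blast
  qed
qed

end
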